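(* Let $r\geq 2$, $m\geq 0$, and let $G$ be a connected graph with vertex set $V_G=[r+m]$ such that the subgraph induced by $G$ on $[r]$ is connected and the endpoints $r+1,\dots,r+m$ are pairwise non-adjacent in $G$. If $m=0$, assume that $\mu$ is a finite diffuse measure on $\mathbb{R}^d$ and that $\varphi:\mathbb{R}^d\times\mathbb{R}^d\to[0,1]$ is symmetric and measurable. If $m\geq 1$, assume that $\mu$ is the Lebesgue measure on $\mathbb{R}^d$ and that $\varphi:\mathbb{R}^d\times\mathbb{R}^d\to[0,1]$ is symmetric, measurable, translation invariant (i.e. $\varphi(x,y)=\varphi(0,y-x)$ for all $x,y$), with $\int_{\mathbb{R}^d}\varphi(0,x)\,\mathrm{d}x<\infty$. Suppose that the balance condition $$\frac{e(H)-a_m(G)}{v(H)-m-1}\leq \frac{e(G)-a_m(G)}{r-1}\qquad\text{for all subgraphs } H\subset G \text{ with } v(H)\geq m+2$$ holds, and that $$1\gtrsim c_\lambda\gg\lambda^{-\min(r/e(G),\,1/a_m(G))}$$ (with $1/a_m(G):=\infty$ if $a_m(G)=0$). Then the normalized subgraph count $\overline{N}_G:=(N_G-\kappa_1(N_G))/\sqrt{\kappa_2(N_G)}$ converges in distribution to a standard normal random variable as $\lambda\to\infty$. In particular, when $m=0$ or $m=1$, the condition on $c_\lambda$ reduces to $1\gtrsim c_\lambda\gg\lambda^{-r/e(G)}$, i.e. to $1\gtrsim c_\lambda\gg\lambda^{-v(G)/e(G)}$ when $G$ has no endpoints ($m=0$).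
   Context: Notation: $[n]:=\{1,\dots,n\}$; for a graph $H$, $v(H)$ and $e(H)$ are its numbers of vertices and edges, and $E_H$ its edge set. For functions $f(\lambda)$ and $g(\lambda)>0$, as $\lambda\to\infty$: $f\lesssim g$ (or $g\gtrsim f$) means $\limsup f/g<\infty$; $f\ll g$ (or $g\gg f$) means $f\geq0$ and $f/g\to0$. For $G$ with $V_G=[r+m]$, vertices $r+1,\dots,r+m$ are called endpoints, and $a_m(G):=\max_{i\in[r]}|\{j\in\{r+1,\dots,r+m\}:\{i,j\}\in E_G\}|$ (so $a_0(G)=0$). Random-connection model: let $d\ge1$, let $y_1,\dots,y_m\in\mathbb{R}^d$ be fixed distinct points, let $\lambda>0$, let $\mu$ be a diffuse sigma-finite measure on $\mathbb{R}^d$, and under the probability $\mathbb{P}_\lambda$ let $\eta=\sum_{i=1}^\tau\delta_{X_i}$ be a Poisson point process on $\mathbb{R}^d$ with intensity measure $\lambda\cdot\mu$ ($\tau$ is $\mathbb{N}\cup\{\infty\}$-valued). Given $\varphi$ symmetric measurable with values in $[0,1]$ and $c_\lambda\in(0,1)$, set $\varphi_\lambda:=c_\lambda\varphi$. The random graph $G_\varphi(\eta\cup\{y_1,\dots,y_m\})$ has vertex set $\eta\cup\{y_1,\dots,y_m\}$, any two distinct vertices $x,y$ being independently connected by an edge (written $x\leftrightarrow y$) with probability $\varphi_\lambda(x,y)$. Subgraph count: $N_G$ is the number of (labelled) copies of $G$ in this random graph in which endpoint $r+l$ is mapped to $y_l$, $l=1,\dots,m$, that is $$N_G=\sum_{(\alpha_1,\dots,\alpha_r)}\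 \prod_{\{i,j\}\in E_G,\ i,j\in[r]}\mathbf{1}_{\{X_{\alpha_i}\leftrightarrow X_{\alpha_j}\}}\prod_{\{r+j,i\}\in E_G,\ i\in[r],\,j\in[m]}\mathbf{1}_{\{y_j\leftrightarrow X_{\alpha_i}\}},$$ the sum being over $r$-tuples of pairwise distinct indices $\alpha_1,\dots,\alpha_r\in\{1,\dots,\tau\}$. $\kappa_n(X)$ denotes the cumulant of order $n$ of $X$ under $\mathbb{P}_\lambda$.
   Formalization: The convergence claim additionally assumes that the variance κ₂(N_G) is positive for all sufficiently large λ, so that the normalized count is defined; without this it fails, e.g. for φ = 0, where N_G = 0 almost surely. *)

theory Defs
  imports "HOL-Probability.Probability"
begin

section \<open>Asymptotic notation\<close>

definition lesssim :: "(real \<Rightarrow> real) \<Rightarrow> (real \<Rightarrow> real) \<Rightarrow> bool" where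
  "lesssim f g \<longleftrightarrow> Limsup at_top (\<lambda>x. ereal (f x / g x)) < \<infinity>"

definition much_less :: "(real \<Rightarrow> real) \<Rightarrow> (real \<Rightarrow> real) \<Rightarrow> bool" where
  "much_less f g \<longleftrightarrow> (\<forall>x>0. 0 \<le> f x) \<and> ((\<lambda>x. f x / g x) \<longlongrightarrow> 0) at_top"

section \<open>Finite simple graphs\<close>

definition simple_graph :: "'v set \<Rightarrow> 'v set set \<Rightarrow> bool" where
  "simple_graph V E \<longleftrightarrow> finite V \<and> (\<forall>e\<in>E. e \<subseteq> V \<and> card e = 2)"

definition subgraph :: "'v set \<Rightarrow> 'v set set \<Rightarrow> 'v set \<Rightarrow> 'v set set \<Rightarrow> bool" where
  "subgraph VH EH V E \<longleftrightarrow> simple_graph VH EH \<and> VH \<subseteq> V \<and> EH \<subseteq> E"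

definition induced_edges :: "'v set set \<Rightarrow> 'v set \<Rightarrow> 'v set set" where
  "induced_edges E W = {e \<in> E. e \<subseteq> W}"

definition connected_graph :: "'v set \<Rightarrow> 'v set set \<Rightarrow> bool" where
  "connected_graph V E \<longleftrightarrow>
     V \<noteq> {} \<and> (\<forall>u\<in>V. \<forall>v\<in>V. (u, v) \<in> {(x, y). x \<in> V \<and> y \<in> V \<and> {x, y} \<in> E}\<^sup>*)"

definition graph_with_endpoints :: "nat \<Rightarrow> nat \<Rightarrow> nat set set \<Rightarrow> bool" where
  "graph_with_endpoints r m E \<longleftrightarrow>
     simple_graph {1..r + m} E \<and>
     connected_graph {1..r + m} E \<and>
     connected_graph {1..r} (induced_edges E {1..r}) \<and>
     (\<forall>i\<in>{r + 1..r + m}. \<forall>j\<in>{r + 1..r + m}. {i, j} \<notin> E)"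

definition a_deg :: "nat \<Rightarrow> nat \<Rightarrow> nat set set \<Rightarrow> nat" where
  "a_deg r m E = Max ((\<lambda>i. card {j \<in> {r + 1..r + m}. {i, j} \<in> E}) ` {1..r})"

definition balanced :: "nat \<Rightarrow> nat \<Rightarrow> nat set set \<Rightarrow> bool" where
  "balanced r m E \<longleftrightarrow>
     (\<forall>VH EH. subgraph VH EH {1..r + m} E \<and> card VH \<ge> m + 2 \<longrightarrow>
        (real (card EH) - real (a_deg r m E)) / (real (card VH) - real m - 1)
          \<le> (real (card E) - real (a_deg r m E)) / (real r - 1))"

text \<open>The exponent \<open>min (r / e(G)) (1 / a\<^sub>m(G))\<close>, where \<open>1 / 0\<close> stands for infinity
  (and not for \<open>0\<close>, as it does in the type of reals).\<close>

definition crit_exponent :: "nat \<Rightarrow> nat \<Rightarrow> nat set set \<Rightarrow> real" where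
  "crit_exponent r m E =
     (if a_deg r m E = 0 then real r / real (card E)
      else min (real r / real (card E)) (1 / real (a_deg r m E)))"

section \<open>Poisson point processes\<close>

definition diffuse :: "'a measure \<Rightarrow> bool" where
  "diffuse \<mu> \<longleftrightarrow> (\<forall>x\<in>space \<mu>. emeasure \<mu> {x} = 0)"

text \<open>A point process is given by an enumeration \<open>X 1, X 2, \<dots>\<close> of its points and their
  number \<open>\<tau>\<close>, which may be infinite; the values \<open>X i \<omega>\<close> with \<open>i > \<tau> \<omega>\<close> are irrelevant.\<close>

definition indices :: "('w \<Rightarrow> enat) \<Rightarrow> 'w \<Rightarrow> nat set" where
  "indices \<tau> \<omega> = {i. 1 \<le> i \<and> enat i \<le> \<tau> \<omega>}"

definition point_count ::
    "('w \<Rightarrow> enat) \<Rightarrow> (nat \<Rightarrow> 'w \<Rightarrow> 'a) \<Rightarrow> 'a set \<Rightarrow> 'w \<Rightarrow> enat" where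
  "point_count \<tau> X B \<omega> =
     (let I = {i \<in> indices \<tau> \<omega>. X i \<omega> \<in> B} in if finite I then enat (card I) else \<infinity>)"

locale poisson_process = prob_space M
  for M :: "'w measure" and \<tau> :: "'w \<Rightarrow> enat" and X :: "nat \<Rightarrow> 'w \<Rightarrow> 'a::euclidean_space"
    and \<Lambda> :: "'a measure" +
  assumes measurable_number: "\<tau> \<in> measurable M (count_space UNIV)"
    and measurable_points: "\<And>i. X i \<in> borel_measurable M"
    and poisson_finite: "\<And>B k. B \<in> sets \<Lambda> \<Longrightarrow> emeasure \<Lambda> B < \<infinity> \<Longrightarrow>
      prob {\<omega> \<in> space M. point_count \<tau> X B \<omega> = enat k}
        = measure \<Lambda> B ^ k / fact k * exp (- measure \<Lambda> B)"
    and poisson_infinite: "\<And>B. B \<in> sets \<Lambda> \<Longrightarrow> emeasure \<Lambda> B = \<infinity> \<Longrightarrow>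
      prob {\<omega> \<in> space M. point_count \<tau> X B \<omega> = \<infinity>} = 1"
    and independent_counts: "\<And>(I :: nat set) B. finite I \<Longrightarrow> (\<And>i. i \<in> I \<Longrightarrow> B i \<in> sets \<Lambda>) \<Longrightarrow>
      disjoint_family_on B I \<Longrightarrow>
      indep_vars (\<lambda>_. count_space UNIV) (\<lambda>i. point_count \<tau> X (B i)) I"

section \<open>The random-connection model\<close>

text \<open>Vertices are labelled: \<open>Poi i\<close> is the \<open>i\<close>-th point of the Poisson process and \<open>Fixed j\<close>
  is the \<open>j\<close>-th deterministic point.  Diffuseness of the intensity makes
  distinct labels sit at distinct positions almost surely.\<close>

datatype vertex = Poi nat | Fixed nat

fun position :: "(nat \<Rightarrow> 'w \<Rightarrow> 'a) \<Rightarrow> (nat \<Rightarrow> 'a) \<Rightarrow> 'w \<Rightarrow> vertex \<Rightarrow> 'a" where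
  "position X y \<omega> (Poi i) = X i \<omega>"
| "position X y \<omega> (Fixed j) = y j"

definition vertices :: "nat \<Rightarrow> ('w \<Rightarrow> enat) \<Rightarrow> 'w \<Rightarrow> vertex set" where
  "vertices m \<tau> \<omega> = Poi ` indices \<tau> \<omega> \<union> Fixed ` {1..m}"

definition points_algebra ::
    "'w measure \<Rightarrow> ('w \<Rightarrow> enat) \<Rightarrow> (nat \<Rightarrow> 'w \<Rightarrow> 'a::euclidean_space) \<Rightarrow> 'w measure" where
  "points_algebra M \<tau> X = vimage_algebra (space M) (\<lambda>\<omega>. (\<tau> \<omega>, \<lambda>i. X i \<omega>))
     (count_space UNIV \<Otimes>\<^sub>M (\<Pi>\<^sub>M i\<in>(UNIV :: nat set). borel))"

text \<open>\<open>\<Gamma> \<omega>\<close> is the edge set of the random graph.  The last axiom says that, conditionally on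
  the points, the edges are independent, \<open>{u, v}\<close> being present with
  probability \<open>\<phi> (position of u) (position of v)\<close>; \<open>S\<close> lists finitely many different
  unordered pairs of labels, each in one of its two orientations.\<close>

locale random_connection_model = poisson_process M \<tau> X \<Lambda>
  for M :: "'w measure" and \<tau> :: "'w \<Rightarrow> enat" and X :: "nat \<Rightarrow> 'w \<Rightarrow> 'a::euclidean_space"
    and \<Lambda> :: "'a measure" +
  fixes \<Gamma> :: "'w \<Rightarrow> vertex set set" and m :: nat and y :: "nat \<Rightarrow> 'a"
    and \<phi> :: "'a \<Rightarrow> 'a \<Rightarrow> real"
  assumes edges_wf: "\<And>\<omega> e. \<omega> \<in> space M \<Longrightarrow> e \<in> \<Gamma> \<omega> \<Longrightarrow> e \<subseteq> vertices m \<tau> \<omega> \<and> card e = 2"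
    and measurable_edges: "\<And>u v. {\<omega> \<in> space M. {u, v} \<in> \<Gamma> \<omega>} \<in> sets M"
    and conditional_edges: "\<And>S. finite S \<Longrightarrow> (\<forall>(u, v)\<in>S. u \<noteq> v) \<Longrightarrow> inj_on (\<lambda>(u, v). {u, v}) S \<Longrightarrow>
      AE \<omega> in M.
        real_cond_exp M (points_algebra M \<tau> X) (\<lambda>\<omega>. of_bool (\<forall>(u, v)\<in>S. {u, v} \<in> \<Gamma> \<omega>)) \<omega>
          = of_bool (\<forall>(u, v)\<in>S. {u, v} \<subseteq> vertices m \<tau> \<omega>) *
            (\<Prod>(u, v)\<in>S. \<phi> (position X y \<omega> u) (position X y \<omega> v))"

section \<open>Subgraph counts, cumulants, convergence in distribution\<close>

definition subgraph_count ::
    "nat \<Rightarrow> nat \<Rightarrow> nat set set \<Rightarrow> ('w \<Rightarrow> enat) \<Rightarrow> ('w \<Rightarrow> vertex set set) \<Rightarrow> 'w \<Rightarrow> real" where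
  "subgraph_count r m E \<tau> \<Gamma> \<omega> =
     (\<Sum>\<^sub>\<infinity>\<alpha> \<in> {\<alpha> \<in> {1..r} \<rightarrow>\<^sub>E indices \<tau> \<omega>. inj_on \<alpha> {1..r}}.
        (\<Prod>e \<in> induced_edges E {1..r}. of_bool ((\<lambda>i. Poi (\<alpha> i)) ` e \<in> \<Gamma> \<omega>)) *
        (\<Prod>(j, i) \<in> {(j, i). j \<in> {1..m} \<and> i \<in> {1..r} \<and> {r + j, i} \<in> E}.
            of_bool ({Fixed j, Poi (\<alpha> i)} \<in> \<Gamma> \<omega>)))"

text \<open>The cumulant of order \<open>n \<ge> 1\<close>, by the moment-cumulant formula.\<close>

definition cumulant :: "'w measure \<Rightarrow> nat \<Rightarrow> ('w \<Rightarrow> real) \<Rightarrow> real" where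
  "cumulant M n Z =
     (\<Sum>P \<in> {P. partition_on {1..n} P}.
        (- 1) ^ (card P - 1) * fact (card P - 1) * (\<Prod>B\<in>P. \<integral>\<omega>. Z \<omega> ^ card B \<partial>M))"

text \<open>Meaningful only if the second cumulant is positive; otherwise division by zero or the
  square root of a negative number gives a conventional value.\<close>

definition normalized :: "'w measure \<Rightarrow> ('w \<Rightarrow> real) \<Rightarrow> 'w \<Rightarrow> real" where
  "normalized M Z \<omega> = (Z \<omega> - cumulant M 1 Z) / sqrt (cumulant M 2 Z)"

text \<open>The library's \<open>weak_conv_m\<close> is restricted to sequences; this is the same notion along
  an arbitrary filter.\<close>

definition weak_conv_filter :: "('i \<Rightarrow> real measure) \<Rightarrow> real measure \<Rightarrow> 'i filter \<Rightarrow> bool" where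
  "weak_conv_filter N L F \<longleftrightarrow>
     (\<forall>x. isCont (cdf L) x \<longrightarrow> ((\<lambda>i. cdf (N i) x) \<longlongrightarrow> cdf L x) F)"

lemma weak_conv_filter_sequentially: "weak_conv_filter N L sequentially \<longleftrightarrow> weak_conv_m N L"
  by (simp add: weak_conv_filter_def weak_conv_m_def weak_conv_def)

end

theory Submission
  imports Defs
begin

text \<open>
  Everything is read off from moments. Counting \<open>n\<close>-tuples of copies of \<open>G\<close> according to which
  of their labels coincide, the multivariate Mecke formula turns \<open>E N\<^sup>n\<close> into a finite sum over
  coincidence patterns, a pattern with \<open>v\<close> labels and \<open>e\<close> edges contributing
  \<open>lam\<^sup>v c\<^sup>e\<close> times an integral that does not depend on \<open>lam\<close>. Patterns factorise over their connected
  components, so the cumulants are the sums over connected patterns.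

  Building a connected pattern row by row, each new copy overlaps the previous ones in a subgraph \<open>H\<close>
  with \<open>k \<ge> 1\<close> Poisson vertices, which costs a factor \<open>lam\<^sup>k c\<^sup>e\<^sup>(\<^sup>H\<^sup>)\<close>. By the balance
  condition this factor is at least \<open>D = min (lam c\<^sup>a) (lam\<^sup>r c\<^sup>e\<^sup>(\<^sup>G\<^sup>))\<close>, whence
  \<open>\<kappa>\<^sub>n \<le> C (lam\<^sup>r c\<^sup>e\<^sup>(\<^sup>G\<^sup>))\<^sup>n / D\<^sup>n\<^sup>-\<^sup>1\<close>. Two equal copies, and two copies sharing a single vertex
  with \<open>a\<close> endpoint neighbours, show that \<open>\<kappa>\<^sub>2\<close> is of this exact order. Hence
  \<open>\<kappa>\<^sub>n / \<kappa>\<^sub>2\<^sup>n\<^sup>/\<^sup>2 = O (D\<^sup>1\<^sup>-\<^sup>n\<^sup>/\<^sup>2)\<close>, which tends to \<open>0\<close> for \<open>n \<ge> 3\<close>, the normalised moments converge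
  to the Gaussian ones, and Levy's theorem applies.
\<close>

section \<open>The multivariate Mecke formula\<close>

text \<open>The process is known only through its counts on sets, and the graph only through edges
  between deterministic labels. Hence a sum over points is written as a sum over all injective maps
  into the naturals, the existence of the points being an indicator: this index set is deterministic
  and countable, so the sum commutes with expectations.

  Rows of a pattern are connected by common Poisson labels only; a common endpoint causes no
  dependence. If two copies share one vertex, its edges to endpoints are shared as well, and this is
  the source of the exponent \<open>a\<close> in \<open>D\<close>.

  \<open>cumulant\<close> is evaluated at orders 1 and 2 only. Higher orders enter as
  \<open>kappa\<close>, the connected part of the moment, through the recursion that ties it to the
  moments; the central moments obey a recursion of the same kind.

  The integrals attached to patterns are free of \<open>lam\<close> and \<open>c\<close>. So whether
  the count vanishes almost surely does not depend on \<open>lam\<close>: a positive variance at one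
  \<open>lam\<close> makes the integral of a single copy positive, and then the lower bound on the
  variance holds for every \<open>lam\<close>.\<close>

definition label_maps :: "'j set \<Rightarrow> ('j \<Rightarrow> nat) set" where
  "label_maps J = {\<beta> \<in> J \<rightarrow>\<^sub>E UNIV. inj_on \<beta> J}"

lemma countable_label_maps: "finite J \<Longrightarrow> countable (label_maps J)"
  unfolding label_maps_def by (rule countable_subset[OF _ countable_PiE[of J "\<lambda>_. UNIV"]]) auto

text \<open>The slots are filled one at a time: a slot of colour \<open>t\<close> has the values of
  \<open>C t\<close> minus those taken by earlier slots of its colour, since the other colours use
  disjoint values. If a colour runs out, one truncated difference is 0, so no case distinction is
  needed.\<close>

lemma card_coloured_label_maps:
  assumes "finite J" and R: "finite R" and "f \<in> J \<rightarrow> R"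
    and fin: "\<And>t. t \<in> R \<Longrightarrow> finite (C t)" and disj: "disjoint_family_on C R"
  shows "finite {\<beta> \<in> label_maps J. \<forall>j\<in>J. \<beta> j \<in> C (f j)} \<and>
    card {\<beta> \<in> label_maps J. \<forall>j\<in>J. \<beta> j \<in> C (f j)}
      = (\<Prod>t\<in>R. \<Prod>i<card {j \<in> J. f j = t}. card (C t) - i)"
  using assms(1,3)
proof (induction J)
  case empty
  have "{\<beta> \<in> label_maps {}. \<forall>j\<in>{}. \<beta> j \<in> C (f j)} = {\<lambda>_. undefined}"
    by (auto simp: label_maps_def)
  then show ?case by simp
next
  case (insert j J)
  let ?A = "{\<beta> \<in> label_maps J. \<forall>j\<in>J. \<beta> j \<in> C (f j)}"
  let ?B = "{\<beta> \<in> label_maps (insert j J). \<forall>j\<in>insert j J. \<beta> j \<in> C (f j)}"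
  from insert have IH: "finite ?A" "card ?A = (\<Prod>t\<in>R. \<Prod>i<card {j \<in> J. f j = t}. card (C t) - i)"
    and fj: "f j \<in> R" and fJ: "f \<in> J \<rightarrow> R" by auto
  define S where "S = (SIGMA \<beta>:?A. C (f j) - \<beta> ` J)"
  define g where "g = (\<lambda>(\<beta>::'a \<Rightarrow> nat, x::nat). \<beta>(j := x))"
  have gS: "g ` S = ?B"
  proof
    show "g ` S \<subseteq> ?B"
    proof
      fix \<beta> assume "\<beta> \<in> g ` S"
      then obtain \<gamma> x where \<beta>: "\<beta> = \<gamma>(j := x)" and g: "\<gamma> \<in> ?A" and x: "x \<in> C (f j)" "x \<notin> \<gamma> ` J"
        by (auto simp: S_def g_def)
      have "inj_on \<beta> (insert j J)" unfolding \<beta> using g x insert.hyps(2)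
        by (auto simp: label_maps_def inj_on_insert inj_on_fun_updI)
      moreover have "\<beta> \<in> insert j J \<rightarrow>\<^sub>E UNIV" unfolding \<beta> using g
        by (auto simp: label_maps_def PiE_def extensional_def)
      ultimately show "\<beta> \<in> ?B"
        using g x insert.hyps(2) by (auto simp: label_maps_def \<beta>)
    qed
    show "?B \<subseteq> g ` S"
    proof
      fix \<beta> assume b: "\<beta> \<in> ?B"
      define \<gamma> where "\<gamma> = restrict \<beta> J"
      have "\<beta> = g (\<gamma>, \<beta> j)" using b insert.hyps
        by (auto simp: g_def \<gamma>_def label_maps_def PiE_def extensional_def fun_eq_iff)
      moreover have "(\<gamma>, \<beta> j) \<in> S"
        using b insert.hyps unfolding S_def \<gamma>_def label_maps_def
        by (auto simp: inj_on_def)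
      ultimately show "\<beta> \<in> g ` S" by blast
    qed
  qed
  have gi: "inj_on g S"
  proof (rule inj_onI)
    fix u v assume u: "u \<in> S" and v: "v \<in> S" and eq: "g u = g v"
    have r: "fst w = restrict (g w) J \<and> snd w = g w j" if "w \<in> S" for w
      using that insert.hyps(2)
      by (auto simp: S_def g_def label_maps_def PiE_def extensional_def fun_eq_iff)
    show "u = v" using r[OF u] r[OF v] eq by (simp add: prod_eq_iff)
  qed
  have fS: "finite S" unfolding S_def using IH(1) fin[OF fj] by auto
  have cS: "card S = card ?A * (card (C (f j)) - card {i \<in> J. f i = f j})"
  proof -
    have "card (C (f j) - \<beta> ` J) = card (C (f j)) - card {i \<in> J. f i = f j}" if b: "\<beta> \<in> ?A" for \<beta>
    proof -
      have "C (f j) \<inter> \<beta> ` J = \<beta> ` {i \<in> J. f i = f j}"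
      proof -
        have "f i = f j" if "i \<in> J" "\<beta> i \<in> C (f j)" for i
        proof (rule ccontr)
          assume "f i \<noteq> f j"
          moreover have "f i \<in> R" using fJ that by auto
          ultimately have "C (f i) \<inter> C (f j) = {}" using disj fj by (auto simp: disjoint_family_on_def)
          then show False using b that by auto
        qed
        note fc = this
        show ?thesis
        proof (intro equalityI subsetI)
          fix x assume "x \<in> C (f j) \<inter> \<beta> ` J"
          then obtain i where "i \<in> J" "x = \<beta> i" "\<beta> i \<in> C (f j)" by auto
          then show "x \<in> \<beta> ` {i \<in> J. f i = f j}" using fc by auto
        next
          fix x assume "x \<in> \<beta> ` {i \<in> J. f i = f j}"
          then obtain i where i: "i \<in> J" "x = \<beta> i" "f i = f j" by auto
          then have "\<beta> i \<in> C (f i)" using b by blast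
          then show "x \<in> C (f j) \<inter> \<beta> ` J" using i by simp
        qed
      qed
      moreover have "card (\<beta> ` {i \<in> J. f i = f j}) = card {i \<in> J. f i = f j}"
        using b by (intro card_image) (auto simp: label_maps_def inj_on_def)
      ultimately show ?thesis
        using insert.hyps(1) by (simp add: card_Diff_subset_Int)
    qed
    then show ?thesis unfolding S_def
      using fin[OF fj] IH(1) by (subst card_SigmaI) auto
  qed
  have B: "finite ?B" "card ?B = card ?A * (card (C (f j)) - card {i \<in> J. f i = f j})"
    using finite_imageI[OF fS, of g] card_image[OF gi] by (simp_all only: gS cS)
  have c: "card {i \<in> insert j J. f i = t} = (if t = f j then Suc (card {i \<in> J. f i = t}) else card {i \<in> J. f i = t})"
    for t
  proof -
    have "{i \<in> insert j J. f i = t} = (if t = f j then insert j {i \<in> J. f i = t} else {i \<in> J. f i = t})"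
      by auto
    then show ?thesis using insert.hyps by auto
  qed
  have "(\<Prod>t\<in>R. \<Prod>i<card {i \<in> insert j J. f i = t}. card (C t) - i)
     = (\<Prod>i<card {i \<in> insert j J. f i = f j}. card (C (f j)) - i) *
       (\<Prod>t\<in>R-{f j}. \<Prod>i<card {i \<in> insert j J. f i = t}. card (C t) - i)"
    by (rule prod.remove[OF R fj])
  also have "\<dots> = (\<Prod>i<card {i \<in> J. f i = f j}. card (C (f j)) - i) *
       (\<Prod>t\<in>R-{f j}. \<Prod>i<card {i \<in> J. f i = t}. card (C t) - i) *
      (card (C (f j)) - card {i \<in> J. f i = f j})"
  proof -
    have "(\<Prod>t\<in>R-{f j}. \<Prod>i<card {i \<in> insert j J. f i = t}. card (C t) - i)
      = (\<Prod>t\<in>R-{f j}. \<Prod>i<card {i \<in> J. f i = t}. card (C t) - i)"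
      by (intro prod.cong refl arg_cong[where f = "\<lambda>n. {..<n}"]) (simp_all only: c, auto)
    moreover have "card {i \<in> insert j J. f i = f j} = Suc (card {i \<in> J. f i = f j})"
      using c[of "f j"] by simp
    ultimately show ?thesis by (simp only: prod.lessThan_Suc mult_ac)
  qed
  also have "\<dots> = card ?A * (card (C (f j)) - card {i \<in> J. f i = f j})"
    by (simp only: IH(2) prod.remove[OF R fj])
  finally show ?case using B by simp
qed

text \<open>For \<open>n < k\<close> one truncated factor is 0, and shifting by \<open>k\<close>
  leaves the exponential series. In probabilistic terms this is the factorial moment of order
  \<open>k\<close> of a Poisson variable.\<close>

lemma poisson_factorial_moment:
  assumes "l \<ge> (0::real)"
  shows "(\<Sum>n. ennreal (\<Prod>i<k. real (n - i)) * ennreal (l ^ n / fact n * exp (- l))) = ennreal (l ^ k)"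
proof -
  have *: "(\<Prod>i<k. real (n + k - i)) * (l ^ (n + k) / fact (n + k)) = l ^ k * (l ^ n / fact n)" for n
  proof -
    have "(\<Prod>i<k. real (n + k - i)) = fact (n + k) / fact n"
    proof (induction k)
      case (Suc k)
      have "(\<Prod>i<Suc k. real (n + Suc k - i)) = real (n + Suc k) * (\<Prod>i<k. real (n + k - i))"
        unfolding prod.lessThan_Suc_shift by simp
      then show ?case using Suc by simp
    qed simp
    then show ?thesis by (simp add: power_add field_simps)
  qed
  have s: "(\<lambda>n. l ^ k * (l ^ n / fact n) * exp (- l)) sums (l ^ k * exp l * exp (- l))"
    using exp_converges[of l]
    by (intro sums_mult sums_mult2) (simp add: divide_inverse mult.commute scaleR_conv_of_real)
  have z: "(\<Prod>i<k. real (n - i)) = 0" if "n < k" for n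
    using that by (intro prod_zero) auto
  have "(\<lambda>n. (\<Prod>i<k. real (n - i)) * (l ^ n / fact n * exp (- l))) sums (l ^ k)"
    apply (subst sums_zero_iff_shift[of k, symmetric])
    subgoal using z by simp
    subgoal
    proof -
      have "(\<Prod>i<k. real (n + k - i)) * (l ^ (n + k) / fact (n + k) * exp (- l))
          = l ^ k * (l ^ n / fact n) * exp (- l)" for n
        using *[of n] by (metis mult.assoc)
      moreover have "l ^ k * exp l * exp (- l) = l ^ k"
        by (simp add: mult.assoc mult_exp_exp)
      ultimately show ?thesis using s by (simp only:)
    qed
    done
  then have "(\<lambda>n. ennreal ((\<Prod>i<k. real (n - i)) * (l ^ n / fact n * exp (- l)))) sums ennreal (l ^ k)"
    by (subst sums_ennreal) (use assms in \<open>auto intro!: mult_nonneg_nonneg divide_nonneg_nonneg prod_nonneg\<close>)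
  moreover have "ennreal ((\<Prod>i<k. real (n - i)) * (l ^ n / fact n * exp (- l)))
      = ennreal (\<Prod>i<k. real (n - i)) * ennreal (l ^ n / fact n * exp (- l))" for n
    using assms by (intro ennreal_mult) (auto intro!: prod_nonneg)
  ultimately show ?thesis by (simp only: sums_iff)
qed

lemma borel_measurable_nn_integral_count_space:
  fixes f :: "'b \<Rightarrow> 'c \<Rightarrow> ennreal"
  assumes "countable A" "\<And>a. a \<in> A \<Longrightarrow> (\<lambda>x. f x a) \<in> borel_measurable N"
  shows "(\<lambda>x. \<integral>\<^sup>+a. f x a \<partial>count_space A) \<in> borel_measurable N"
proof -
  interpret sigma_finite_measure "count_space A"
    by (rule sigma_finite_measure_count_space_countable) fact
  have "(\<lambda>(a, x). f x a) \<in> borel_measurable (count_space A \<Otimes>\<^sub>M N)"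
    using assms by (intro measurable_pair_measure_countable1) simp_all
  from measurable_pair_swap[OF this] show ?thesis
    by (intro borel_measurable_nn_integral) simp
qed

context poisson_process
begin

abbreviation label_sum :: "'j set \<Rightarrow> (('j \<Rightarrow> nat) \<Rightarrow> ennreal) \<Rightarrow> 'w \<Rightarrow> ennreal" where
  "label_sum J F \<omega> \<equiv> \<integral>\<^sup>+\<beta>. of_bool (\<beta> ` J \<subseteq> indices \<tau> \<omega>) * F \<beta> \<partial>count_space (label_maps J)"

lemma measurable_index [measurable]: "{\<omega> \<in> space M. i \<in> indices \<tau> \<omega>} \<in> sets M"
proof -
  have "{\<omega> \<in> space M. i \<in> indices \<tau> \<omega>} = \<tau> -` {n. 1 \<le> i \<and> enat i \<le> n} \<inter> space M"
    by (auto simp: indices_def)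
  also have "\<dots> \<in> sets M" by (rule measurable_sets[OF measurable_number]) simp
  finally show ?thesis .
qed

lemma measurable_indices [measurable]:
  assumes "finite J" shows "{\<omega> \<in> space M. \<beta> ` J \<subseteq> indices \<tau> \<omega>} \<in> sets M"
proof -
  have "{\<omega> \<in> space M. \<beta> ` J \<subseteq> indices \<tau> \<omega>} = {\<omega> \<in> space M. \<forall>j\<in>J. \<beta> j \<in> indices \<tau> \<omega>}"
    by auto
  then show ?thesis using assms by auto
qed

lemma borel_measurable_indices [measurable]:
  assumes "finite J" shows "(\<lambda>\<omega>. of_bool (\<beta> ` J \<subseteq> indices \<tau> \<omega>) :: ennreal) \<in> borel_measurable M"
proof -
  have "(\<lambda>\<omega>. indicator {\<omega> \<in> space M. \<beta> ` J \<subseteq> indices \<tau> \<omega>} \<omega> :: ennreal) \<in> borel_measurable M"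
    using measurable_indices[OF assms] by (rule borel_measurable_indicator)
  then show ?thesis
    by (rule measurable_cong[THEN iffD1, rotated]) (auto simp: indicator_def)
qed

lemma
  assumes "B \<in> sets \<Lambda>" "emeasure \<Lambda> B < \<infinity>"
  shows point_count_finite_AE: "AE \<omega> in M. finite {i \<in> indices \<tau> \<omega>. X i \<omega> \<in> B}"
    and point_count_factorial_moment: "(\<integral>\<^sup>+\<omega>. ennreal (\<Prod>i<k. real (card {i \<in> indices \<tau> \<omega>. X i \<omega> \<in> B} - i)) \<partial>M) = emeasure \<Lambda> B ^ k"
proof -
  let ?N = "point_count \<tau> X B"
  let ?l = "measure \<Lambda> B"
  \<comment> \<open>A single count is trivially independent; the axiom is invoked for the
    measurability of the count that \<open>indep_vars\<close> contains.\<close>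
  have "indep_vars (\<lambda>_. count_space UNIV) (\<lambda>i. point_count \<tau> X B) {0::nat}"
    using assms by (intro independent_counts) (auto simp: disjoint_family_on_def)
  then have N[measurable]: "?N \<in> measurable M (count_space UNIV)"
    by (auto simp: indep_vars_def)
  have l0: "?l \<ge> 0" by simp
  have P: "emeasure M {\<omega> \<in> space M. ?N \<omega> = enat n} = ennreal (?l ^ n / fact n * exp (- ?l))" for n
    using poisson_finite[OF assms, of n] by (simp add: emeasure_eq_measure)
  \<comment> \<open>The Poisson probabilities sum to 1, so no mass is left for an infinite
    count.\<close>
  have tot: "(\<Sum>n. ennreal (?l ^ n / fact n * exp (- ?l))) = 1"
    using poisson_factorial_moment[OF l0, of 0] by simp
  have "prob {\<omega> \<in> space M. ?N \<omega> \<noteq> \<infinity>} = 1"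
  proof -
    have "emeasure M {\<omega> \<in> space M. ?N \<omega> \<noteq> \<infinity>} = emeasure M (\<Union>n. {\<omega> \<in> space M. ?N \<omega> = enat n})"
      by (rule arg_cong[where f = "emeasure M"]) auto
    also have "\<dots> = (\<Sum>n. emeasure M {\<omega> \<in> space M. ?N \<omega> = enat n})"
      by (intro suminf_emeasure[symmetric]) (auto simp: disjoint_family_on_def)
    finally show ?thesis unfolding P tot by (simp add: emeasure_eq_measure)
  qed
  then have AE: "AE \<omega> in M. ?N \<omega> \<noteq> \<infinity>"
    by (subst (asm) prob_Collect_eq_1) auto
  then show "AE \<omega> in M. finite {i \<in> indices \<tau> \<omega>. X i \<omega> \<in> B}"
    by eventually_elim (auto simp: point_count_def Let_def split: if_splits)
  show "(\<integral>\<^sup>+\<omega>. ennreal (\<Prod>i<k. real (card {i \<in> indices \<tau> \<omega>. X i \<omega> \<in> B} - i)) \<partial>M) = emeasure \<Lambda> B ^ k"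
  proof -
    have "(\<integral>\<^sup>+\<omega>. ennreal (\<Prod>i<k. real (card {i \<in> indices \<tau> \<omega>. X i \<omega> \<in> B} - i)) \<partial>M)
      = (\<integral>\<^sup>+\<omega>. (\<Sum>n. ennreal (\<Prod>i<k. real (n - i)) * indicator {\<omega> \<in> space M. ?N \<omega> = enat n} \<omega>) \<partial>M)"
    proof (rule nn_integral_cong_AE, use AE AE_space in eventually_elim)
      case (elim \<omega>)
      then have f: "finite {i \<in> indices \<tau> \<omega>. X i \<omega> \<in> B}"
        and e: "?N \<omega> = enat (card {i \<in> indices \<tau> \<omega>. X i \<omega> \<in> B})"
        by (auto simp: point_count_def Let_def split: if_splits)
      let ?n = "card {i \<in> indices \<tau> \<omega>. X i \<omega> \<in> B}"
      have "(\<Sum>n. ennreal (\<Prod>i<k. real (n - i)) * indicator {\<omega> \<in> space M. ?N \<omega> = enat n} \<omega>)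
        = (\<Sum>n\<in>{?n}. ennreal (\<Prod>i<k. real (n - i)) * indicator {\<omega> \<in> space M. ?N \<omega> = enat n} \<omega>)"
        by (rule suminf_finite) (auto simp: e indicator_def)
      then show ?case using elim e by simp
    qed
    also have "\<dots> = (\<Sum>n. \<integral>\<^sup>+\<omega>. ennreal (\<Prod>i<k. real (n - i)) * indicator {\<omega> \<in> space M. ?N \<omega> = enat n} \<omega> \<partial>M)"
      by (rule nn_integral_suminf) measurable
    also have "\<dots> = (\<Sum>n. ennreal (\<Prod>i<k. real (n - i)) * ennreal (?l ^ n / fact n * exp (- ?l)))"
      by (subst nn_integral_cmult_indicator) (simp_all only: P, measurable)
    also have "\<dots> = ennreal (?l ^ k)" by (rule poisson_factorial_moment[OF l0])
    also have "\<dots> = emeasure \<Lambda> B ^ k"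
      using assms by (simp add: emeasure_eq_ennreal_measure ennreal_power)
    finally show ?thesis .
  qed
qed

text \<open>With disjoint sides the label sum counts coloured injections. It is thus a product of
  falling factorials of independent Poisson counts, and its expectation factorises.\<close>

lemma factorial_measure_disjoint:
  fixes A :: "nat \<Rightarrow> 'a set"
  assumes J: "finite J" and R: "finite R" and f: "f \<in> J \<rightarrow> R"
    and A: "\<And>t. t \<in> R \<Longrightarrow> A t \<in> sets \<Lambda>" "\<And>t. t \<in> R \<Longrightarrow> emeasure \<Lambda> (A t) < \<infinity>"
    and disj: "disjoint_family_on A R"
  shows "(\<integral>\<^sup>+\<omega>. label_sum J (\<lambda>\<beta>. \<Prod>j\<in>J. indicator (A (f j)) (X (\<beta> j) \<omega>)) \<omega> \<partial>M) = (\<Prod>j\<in>J. emeasure \<Lambda> (A (f j)))"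
proof -
  define C where "C \<omega> t = {i \<in> indices \<tau> \<omega>. X i \<omega> \<in> A t}" for \<omega> t
  define n where "n t = card {j \<in> J. f j = t}" for t
  \<comment> \<open>The value at an infinite count is arbitrary, as the counts are almost surely
    finite. \<open>h\<close> lives on \<open>enat\<close> so that it can be composed with the
    independent variables \<open>point_count\<close>.\<close>
  define h where "h t x = ennreal (case x of enat a \<Rightarrow> \<Prod>i<n t. real (a - i) | \<infinity> \<Rightarrow> 1)" for t x
  have AE: "AE \<omega> in M. \<forall>t\<in>R. finite (C \<omega> t)"
    unfolding C_def using R point_count_finite_AE[OF A] by (simp add: AE_ball_countable countable_finite)
  have "(\<integral>\<^sup>+\<omega>. label_sum J (\<lambda>\<beta>. \<Prod>j\<in>J. indicator (A (f j)) (X (\<beta> j) \<omega>)) \<omega> \<partial>M) = (\<integral>\<^sup>+\<omega>. (\<Prod>t\<in>R. h t (point_count \<tau> X (A t) \<omega>)) \<partial>M)"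
  proof (rule nn_integral_cong_AE, use AE in eventually_elim)
    case (elim \<omega>)
    have "disjoint_family_on (C \<omega>) R" using disj by (auto simp: C_def disjoint_family_on_def)
    note c = card_coloured_label_maps[OF J R f _ this]
    let ?S = "{\<beta> \<in> label_maps J. \<forall>j\<in>J. \<beta> j \<in> C \<omega> (f j)}"
    have "label_sum J (\<lambda>\<beta>. \<Prod>j\<in>J. indicator (A (f j)) (X (\<beta> j) \<omega>)) \<omega> = (\<integral>\<^sup>+\<beta>. indicator ?S \<beta> \<partial>count_space (label_maps J))"
    proof (rule nn_integral_cong)
      fix \<beta> assume "\<beta> \<in> space (count_space (label_maps J))"
      then have b: "\<beta> \<in> label_maps J" by simp
      have "(\<Prod>j\<in>J. indicator (A (f j)) (X (\<beta> j) \<omega>)) = (of_bool (\<forall>j\<in>J. X (\<beta> j) \<omega> \<in> A (f j)) :: ennreal)"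
        using J by (auto simp: indicator_def intro: prod_zero)
      then show "of_bool (\<beta> ` J \<subseteq> indices \<tau> \<omega>) * (\<Prod>j\<in>J. indicator (A (f j)) (X (\<beta> j) \<omega>)) = (indicator ?S \<beta> :: ennreal)"
        using b by (auto simp: indicator_def C_def)
    qed
    also have "\<dots> = emeasure (count_space (label_maps J)) ?S"
      by (rule nn_integral_indicator) auto
    also have "\<dots> = of_nat (card ?S)"
      using c elim by (subst emeasure_count_space_finite) auto
    also have "\<dots> = (\<Prod>t\<in>R. h t (point_count \<tau> X (A t) \<omega>))"
      using c elim unfolding h_def n_def
      by (auto simp: point_count_def Let_def C_def[symmetric] prod_ennreal prod_nonneg ennreal_of_nat_eq_real_of_nat)
    finally show ?case .
  qed
  also have "\<dots> = (\<Prod>t\<in>R. \<integral>\<^sup>+\<omega>. h t (point_count \<tau> X (A t) \<omega>) \<partial>M)"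
    by (rule indep_vars_nn_integral[OF R indep_vars_compose2[OF independent_counts[OF R A(1) disj]]]) auto
  also have "\<dots> = (\<Prod>t\<in>R. emeasure \<Lambda> (A t) ^ n t)"
  proof (rule prod.cong[OF refl])
    fix t assume t: "t \<in> R"
    have "(\<integral>\<^sup>+\<omega>. h t (point_count \<tau> X (A t) \<omega>) \<partial>M)
      = (\<integral>\<^sup>+\<omega>. ennreal (\<Prod>i<n t. real (card {i \<in> indices \<tau> \<omega>. X i \<omega> \<in> A t} - i)) \<partial>M)"
      using AE by (intro nn_integral_cong_AE, eventually_elim)
        (use t in \<open>auto simp: h_def C_def[symmetric] point_count_def Let_def\<close>)
    also have "\<dots> = emeasure \<Lambda> (A t) ^ n t" by (rule point_count_factorial_moment) (use A t in auto)
    finally show "(\<integral>\<^sup>+\<omega>. h t (point_count \<tau> X (A t) \<omega>) \<partial>M) = emeasure \<Lambda> (A t) ^ n t" .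
  qed
  also have "\<dots> = (\<Prod>t\<in>R. \<Prod>j\<in>{j \<in> J. f j = t}. emeasure \<Lambda> (A (f j)))"
    by (intro prod.cong refl) (simp add: n_def)
  also have "\<dots> = (\<Prod>j\<in>J. emeasure \<Lambda> (A (f j)))"
    by (rule prod.group) (use J R f in auto)
  finally show ?thesis .
qed

text \<open>Overlapping sides are cut into the atoms of the algebra they generate. The atoms are numbered
  by \<open>e\<close> because \<open>independent_counts\<close> is restricted to index sets of naturals.\<close>

lemma factorial_measure_rectangle:
  fixes B :: "'j \<Rightarrow> 'a set"
  assumes J: "finite J" and B: "\<And>j. j \<in> J \<Longrightarrow> B j \<in> sets \<Lambda>" "\<And>j. j \<in> J \<Longrightarrow> emeasure \<Lambda> (B j) < \<infinity>"
    and borel: "sets \<Lambda> = sets borel"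
  shows "(\<integral>\<^sup>+\<omega>. label_sum J (\<lambda>\<beta>. \<Prod>j\<in>J. indicator (B j) (X (\<beta> j) \<omega>)) \<omega> \<partial>M) = (\<Prod>j\<in>J. emeasure \<Lambda> (B j))"
proof -
  obtain e where e: "bij_betw e (Pow J) {..<card (Pow J)}"
    using J ex_bij_betw_finite_nat[of "Pow J"] by (auto simp: atLeast0LessThan)
  define d where "d = the_inv_into (Pow J) e"
  \<comment> \<open>\<open>A t\<close> collects the points lying in exactly the sides indexed by
    \<open>t\<close>. The second factor makes \<open>A {}\<close> empty, as the complement of all
    sides may have infinite measure.\<close>
  define A where "A t = {x. {j \<in> J. x \<in> B j} = t} \<inter> (\<Union>j\<in>t. B j)" for t
  define R where "R = e ` (Pow J - {{}})"
  have d: "d (e t) = t" if "t \<subseteq> J" for t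
    using that e unfolding d_def by (intro the_inv_into_f_f) (auto simp: bij_betw_def)
  have [simp]: "finite R" using J by (simp add: R_def)
  have sA: "A t \<in> sets \<Lambda>" if "t \<subseteq> J" for t
  proof -
    have "A t = (\<Union>j\<in>t. B j) \<inter> (\<Inter>j\<in>t. B j) - (\<Union>j\<in>J - t. B j)" if "t \<noteq> {}"
      using that \<open>t \<subseteq> J\<close> by (auto simp: A_def)
    moreover have "A {} = {}" by (auto simp: A_def)
    ultimately show ?thesis using J B(1) that
      by (cases "t = {}") (auto intro!: sets.Diff sets.Int sets.finite_UN sets.finite_INT dest: finite_subset)
  qed
  have A_sub: "A t \<subseteq> B j" if "j \<in> t" for t j using that by (auto simp: A_def)
  have Adisj: "A t \<inter> A t' = {}" if "t \<noteq> t'" for t t' using that by (auto simp: A_def)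
  have Afin: "emeasure \<Lambda> (A t) < \<infinity>" if "t \<subseteq> J" for t
  proof (cases "t = {}")
    case True then show ?thesis by (simp add: A_def)
  next
    case False
    then obtain j where "j \<in> t" by auto
    then show ?thesis using emeasure_mono[OF A_sub B(1), of j t] B(2)[of j] that by (auto simp: less_top)
  qed
  have UA: "B j = (\<Union>t\<in>{t. t \<subseteq> J \<and> j \<in> t}. A t)" if "j \<in> J" for j
  proof
    show "B j \<subseteq> (\<Union>t\<in>{t. t \<subseteq> J \<and> j \<in> t}. A t)"
    proof
      fix x assume "x \<in> B j"
      show "x \<in> (\<Union>t\<in>{t. t \<subseteq> J \<and> j \<in> t}. A t)"
      proof (rule UN_I)
        show "{i \<in> J. x \<in> B i} \<in> {t. t \<subseteq> J \<and> j \<in> t}" using that \<open>x \<in> B j\<close> by simp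
        show "x \<in> A {i \<in> J. x \<in> B i}" using that \<open>x \<in> B j\<close> unfolding A_def by simp blast
      qed
    qed
    show "(\<Union>t\<in>{t. t \<subseteq> J \<and> j \<in> t}. A t) \<subseteq> B j" using A_sub by auto
  qed
  let ?T = "\<lambda>j. {t. t \<subseteq> J \<and> j \<in> t}"
  have fT: "finite (?T j)" for j using J by auto
  have ind: "indicator (B j) x = (\<Sum>t\<in>?T j. indicator (A t) x :: ennreal)" if "j \<in> J" for j x
    unfolding UA[OF that] using fT Adisj
    by (subst indicator_UN_disjoint) (auto simp: disjoint_family_on_def)
  have em: "emeasure \<Lambda> (B j) = (\<Sum>t\<in>?T j. emeasure \<Lambda> (A t))" if "j \<in> J" for j
    unfolding UA[OF that] using fT Adisj sA
    by (intro sum_emeasure[symmetric]) (auto simp: disjoint_family_on_def)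
  \<comment> \<open>\<open>g\<close> selects for each slot the atom that contains its point; the
    product over slots of sums over atoms expands into a sum over \<open>g\<close>.\<close>
  let ?G = "\<lambda>g \<omega> \<beta>. of_bool (\<beta> ` J \<subseteq> indices \<tau> \<omega>) * (\<Prod>j\<in>J. indicator (A (g j)) (X (\<beta> j) \<omega>)) :: ennreal"
  have meas[measurable]: "(\<lambda>\<omega>. \<integral>\<^sup>+\<beta>. ?G g \<omega> \<beta> \<partial>count_space (label_maps J)) \<in> borel_measurable M"
    if "g \<in> Pi\<^sub>E J ?T" for g
  proof -
    have [measurable]: "A (g j) \<in> sets borel" if "j \<in> J" for j
      using \<open>g \<in> _\<close> that sA borel by (auto simp: PiE_iff)
    note measurable_points[measurable]
    have "(\<lambda>\<omega>. ?G g \<omega> \<beta>) \<in> borel_measurable M" for \<beta>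
    proof (intro borel_measurable_times_ennreal borel_measurable_prod_ennreal borel_measurable_indices J)
      fix j assume [simp]: "j \<in> J"
      show "(\<lambda>\<omega>. indicator (A (g j)) (X (\<beta> j) \<omega>) :: ennreal) \<in> borel_measurable M" by measurable
    qed
    then show ?thesis
      by (intro borel_measurable_nn_integral_count_space countable_label_maps[OF J])
  qed
  have "(\<integral>\<^sup>+\<omega>. label_sum J (\<lambda>\<beta>. \<Prod>j\<in>J. indicator (B j) (X (\<beta> j) \<omega>)) \<omega> \<partial>M)
      = (\<integral>\<^sup>+\<omega>. (\<integral>\<^sup>+\<beta>. (\<Sum>g\<in>Pi\<^sub>E J ?T. ?G g \<omega> \<beta>) \<partial>count_space (label_maps J)) \<partial>M)"
  proof (intro nn_integral_cong)
    fix \<omega> \<beta>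
    have "(\<Prod>j\<in>J. indicator (B j) (X (\<beta> j) \<omega>)) = (\<Prod>j\<in>J. \<Sum>t\<in>?T j. indicator (A t) (X (\<beta> j) \<omega>) :: ennreal)"
      by (intro prod.cong refl ind)
    also have "\<dots> = (\<Sum>g\<in>Pi\<^sub>E J ?T. \<Prod>j\<in>J. indicator (A (g j)) (X (\<beta> j) \<omega>))"
      using J fT by (rule prod_sum_PiE)
    finally show "of_bool (\<beta> ` J \<subseteq> indices \<tau> \<omega>) * (\<Prod>j\<in>J. indicator (B j) (X (\<beta> j) \<omega>)) = (\<Sum>g\<in>Pi\<^sub>E J ?T. ?G g \<omega> \<beta>)"
      by (simp add: sum_distrib_left)
  qed
  also have "\<dots> = (\<integral>\<^sup>+\<omega>. (\<Sum>g\<in>Pi\<^sub>E J ?T. (\<integral>\<^sup>+\<beta>. ?G g \<omega> \<beta> \<partial>count_space (label_maps J))) \<partial>M)"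
    by (simp add: nn_integral_sum)
  also have "\<dots> = (\<Sum>g\<in>Pi\<^sub>E J ?T. \<integral>\<^sup>+\<omega>. (\<integral>\<^sup>+\<beta>. ?G g \<omega> \<beta> \<partial>count_space (label_maps J)) \<partial>M)"
    by (rule nn_integral_sum) (rule meas)
  also have "\<dots> = (\<Sum>g\<in>Pi\<^sub>E J ?T. \<Prod>j\<in>J. emeasure \<Lambda> (A (g j)))"
  proof (rule sum.cong[OF refl])
    fix g assume g: "g \<in> Pi\<^sub>E J ?T"
    have gd: "d (e (g j)) = g j" if "j \<in> J" for j using g that d by (auto simp: PiE_iff)
    have disjA: "disjoint_family_on (\<lambda>t. A (d t)) R"
    proof (unfold disjoint_family_on_def, intro ballI impI)
      fix u v assume "u \<in> R" "v \<in> R" "u \<noteq> v"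
      then show "A (d u) \<inter> A (d v) = {}" using d by (intro Adisj) (auto simp: R_def)
    qed
    have Rs: "d t \<subseteq> J" if "t \<in> R" for t using that d by (auto simp: R_def)
    have f: "(\<lambda>j. e (g j)) \<in> J \<rightarrow> R" using g by (auto simp: R_def PiE_iff)
    have "(\<integral>\<^sup>+\<omega>. label_sum J (\<lambda>\<beta>. \<Prod>j\<in>J. indicator (A (d (e (g j)))) (X (\<beta> j) \<omega>)) \<omega> \<partial>M) = (\<Prod>j\<in>J. emeasure \<Lambda> (A (d (e (g j)))))"
      using sA Afin Rs by (intro factorial_measure_disjoint[OF J \<open>finite R\<close> f _ _ disjA]) auto
    then show "(\<integral>\<^sup>+\<omega>. (\<integral>\<^sup>+\<beta>. ?G g \<omega> \<beta> \<partial>count_space (label_maps J)) \<partial>M) = (\<Prod>j\<in>J. emeasure \<Lambda> (A (g j)))"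
      by (simp add: gd cong: prod.cong)
  qed
  also have "\<dots> = (\<Prod>j\<in>J. \<Sum>t\<in>?T j. emeasure \<Lambda> (A t))"
    using J fT by (rule prod_sum_PiE[symmetric])
  also have "\<dots> = (\<Prod>j\<in>J. emeasure \<Lambda> (B j))" by (intro prod.cong refl em[symmetric])
  finally show ?thesis .
qed

text \<open>Both sides integrate \<open>F\<close> against a measure on \<open>J\<close>-tuples: the
  intensity measure of tuples of distinct points, and the product measure. These agree on
  rectangles, and uniqueness of the product measure does the rest.\<close>

lemma mecke:
  fixes F :: "('j \<Rightarrow> 'a) \<Rightarrow> ennreal"
  assumes J: "finite J" and borel: "sets \<Lambda> = sets borel" and sf: "sigma_finite_measure \<Lambda>"
    and F: "F \<in> borel_measurable (\<Pi>\<^sub>M j\<in>J. \<Lambda>)"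
  shows "(\<integral>\<^sup>+\<omega>. label_sum J (\<lambda>\<beta>. F (\<lambda>j\<in>J. X (\<beta> j) \<omega>)) \<omega> \<partial>M) = (\<integral>\<^sup>+x. F x \<partial>(\<Pi>\<^sub>M j\<in>J. \<Lambda>))"
proof -
  interpret \<Lambda>: sigma_finite_measure \<Lambda> by fact
  interpret P: product_sigma_finite "\<lambda>_::'j. \<Lambda>" by standard
  let ?C = "count_space (label_maps J)"
  note measurable_points[measurable] measurable_indices[OF J, measurable]
  have cl: "countable (label_maps J)" using J by (rule countable_label_maps)
  interpret C: sigma_finite_measure ?C by (rule sigma_finite_measure_count_space_countable[OF cl])
  interpret CM: pair_sigma_finite ?C M ..
  \<comment> \<open>Pairs of a label map and an outcome, restricted to maps whose labels exist. The
    image \<open>N\<close> under evaluation of the points is the intensity measure of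
    tuples.\<close>
  define D where "D = density (?C \<Otimes>\<^sub>M M) (\<lambda>(\<beta>, \<omega>). of_bool (\<beta> ` J \<subseteq> indices \<tau> \<omega>))"
  define N where "N = distr D (\<Pi>\<^sub>M j\<in>J. \<Lambda>) (\<lambda>(\<beta>, \<omega>). \<lambda>j\<in>J. X (\<beta> j) \<omega>)"
  have X: "X i \<in> measurable M \<Lambda>" for i
    using measurable_points[of i] by (simp add: measurable_cong_sets[OF refl borel])
  have m1[measurable]: "(\<lambda>(\<beta>, \<omega>). of_bool (\<beta> ` J \<subseteq> indices \<tau> \<omega>) :: ennreal) \<in> borel_measurable (?C \<Otimes>\<^sub>M M)"
    by (rule measurable_pair_measure_countable1[OF cl]) simp
  have m2[measurable]: "(\<lambda>(\<beta>, \<omega>). \<lambda>j\<in>J. X (\<beta> j) \<omega>) \<in> measurable (?C \<Otimes>\<^sub>M M) (\<Pi>\<^sub>M j\<in>J. \<Lambda>)"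
    by (rule measurable_pair_measure_countable1[OF cl]) (auto intro!: measurable_restrict X)
  have NF: "(\<integral>\<^sup>+x. G x \<partial>N) = (\<integral>\<^sup>+\<omega>. label_sum J (\<lambda>\<beta>. G (\<lambda>j\<in>J. X (\<beta> j) \<omega>)) \<omega> \<partial>M)"
    if G[measurable]: "G \<in> borel_measurable (\<Pi>\<^sub>M j\<in>J. \<Lambda>)" for G
  proof -
    have "(\<integral>\<^sup>+x. G x \<partial>N) = (\<integral>\<^sup>+z. (case z of (\<beta>, \<omega>) \<Rightarrow> of_bool (\<beta> ` J \<subseteq> indices \<tau> \<omega>) * G (\<lambda>j\<in>J. X (\<beta> j) \<omega>)) \<partial>(?C \<Otimes>\<^sub>M M))"
      unfolding N_def
      apply (subst nn_integral_distr)
      subgoal by (simp add: D_def)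
      subgoal by measurable
      subgoal unfolding D_def
        apply (subst nn_integral_density)
        subgoal by measurable
        subgoal
          using measurable_compose[OF m2 G] by (simp add: case_prod_beta')
        subgoal by (simp add: case_prod_beta')
        done
      done
    also have "\<dots> = (\<integral>\<^sup>+\<omega>. label_sum J (\<lambda>\<beta>. G (\<lambda>j\<in>J. X (\<beta> j) \<omega>)) \<omega> \<partial>M)"
      apply (subst CM.nn_integral_snd[symmetric])
      subgoal
        using measurable_compose[OF m2 G] m1 by (simp add: case_prod_beta')
      subgoal by simp
      done
    finally show ?thesis .
  qed
  have rect: "emeasure N (Pi\<^sub>E J A) = (\<Prod>i\<in>J. emeasure \<Lambda> (A i))"
    if A: "\<And>i. i \<in> J \<Longrightarrow> A i \<in> sets \<Lambda>" "\<And>i. i \<in> J \<Longrightarrow> emeasure \<Lambda> (A i) < \<infinity>" for A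
  proof -
    have S[measurable]: "Pi\<^sub>E J A \<in> sets (\<Pi>\<^sub>M j\<in>J. \<Lambda>)" using J A by (intro sets_PiM_I_finite) auto
    then have "emeasure N (Pi\<^sub>E J A) = (\<integral>\<^sup>+x. indicator (Pi\<^sub>E J A) x \<partial>N)"
      by (intro nn_integral_indicator[symmetric]) (simp add: N_def)
    also have "\<dots> = (\<integral>\<^sup>+\<omega>. label_sum J (\<lambda>\<beta>. indicator (Pi\<^sub>E J A) (\<lambda>j\<in>J. X (\<beta> j) \<omega>)) \<omega> \<partial>M)"
      by (rule NF) measurable
    also have "\<dots> = (\<integral>\<^sup>+\<omega>. label_sum J (\<lambda>\<beta>. \<Prod>j\<in>J. indicator (A j) (X (\<beta> j) \<omega>)) \<omega> \<partial>M)"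
    proof (intro nn_integral_cong arg_cong2[where f = "(*)"] refl)
      fix \<omega> \<beta>
      show "indicator (Pi\<^sub>E J A) (\<lambda>j\<in>J. X (\<beta> j) \<omega>) = (\<Prod>j\<in>J. indicator (A j) (X (\<beta> j) \<omega>) :: ennreal)"
        using J by (auto simp: indicator_def PiE_iff intro: prod_zero)
    qed
    also have "\<dots> = (\<Prod>i\<in>J. emeasure \<Lambda> (A i))"
      by (rule factorial_measure_rectangle[OF J A borel])
    finally show ?thesis .
  qed
  have "N = (\<Pi>\<^sub>M j\<in>J. \<Lambda>)"
  proof (rule P.PiM_eqI[OF J])
    show "sets N = sets (\<Pi>\<^sub>M j\<in>J. \<Lambda>)" by (simp add: N_def)
    fix A assume A: "\<And>i. i \<in> J \<Longrightarrow> A i \<in> sets \<Lambda>"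
    \<comment> \<open>\<open>rect\<close> covers sides of finite measure only; general sides are
      exhausted by these.\<close>
    obtain C :: "nat \<Rightarrow> 'a set" where C: "range C \<subseteq> sets \<Lambda>" "(\<Union>i. C i) = space \<Lambda>" "\<And>i. emeasure \<Lambda> (C i) \<noteq> \<infinity>" "incseq C"
      using \<Lambda>.sigma_finite_incseq by metis
    let ?A = "\<lambda>n i. A i \<inter> C n"
    have s: "?A n i \<in> sets \<Lambda>" "emeasure \<Lambda> (?A n i) < \<infinity>" if "i \<in> J" for i n
    proof -
      have Cn: "C n \<in> sets \<Lambda>" using C(1) by auto
      then show "?A n i \<in> sets \<Lambda>" using A[OF that] by simp
      have "emeasure \<Lambda> (?A n i) \<le> emeasure \<Lambda> (C n)" by (rule emeasure_mono[OF _ Cn]) simp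
      also have "\<dots> < \<infinity>" using C(3)[of n] by (simp add: less_top)
      finally show "emeasure \<Lambda> (?A n i) < \<infinity>" .
    qed
    have inc: "incseq (\<lambda>n. Pi\<^sub>E J (?A n))"
      unfolding incseq_def
    proof (intro allI impI PiE_mono)
      fix k n :: nat and i assume "k \<le> n"
      then show "?A k i \<subseteq> ?A n i" using C(4) by (auto dest: incseqD)
    qed
    have "Pi\<^sub>E J A = (\<Union>n. Pi\<^sub>E J (?A n))"
    proof
      show "(\<Union>n. Pi\<^sub>E J (?A n)) \<subseteq> Pi\<^sub>E J A" by auto
      show "Pi\<^sub>E J A \<subseteq> (\<Union>n. Pi\<^sub>E J (?A n))"
      proof
        fix x assume x: "x \<in> Pi\<^sub>E J A"
        have "\<exists>n. x i \<in> C n" if "i \<in> J" for i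
        proof -
          have "x i \<in> A i" using x that by auto
          then have "x i \<in> space \<Lambda>" using sets.sets_into_space[OF A[OF that]] by auto
          then show ?thesis using C(2) by auto
        qed
        then obtain n where n: "\<And>i. i \<in> J \<Longrightarrow> x i \<in> C (n i)" by metis
        have "x i \<in> C (Max (n ` J))" if "i \<in> J" for i
          using n[OF that] C(4) J that by (meson Max_ge finite_imageI imageI incseq_def subsetD)
        then show "x \<in> (\<Union>n. Pi\<^sub>E J (?A n))" using x by (auto simp: PiE_iff)
      qed
    qed
    note U = this
    have rs: "range (\<lambda>n. Pi\<^sub>E J (?A n)) \<subseteq> sets (\<Pi>\<^sub>M j\<in>J. \<Lambda>)"
      using s J by (auto intro!: sets_PiM_I_finite)
    then have "range (\<lambda>n. Pi\<^sub>E J (?A n)) \<subseteq> sets N" by (simp add: N_def)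
    then have "emeasure N (Pi\<^sub>E J A) = (SUP n. emeasure N (Pi\<^sub>E J (?A n)))"
      unfolding U by (rule SUP_emeasure_incseq[OF _ inc, symmetric])
    also have "\<dots> = (SUP n. \<Prod>i\<in>J. emeasure \<Lambda> (?A n i))"
      by (intro SUP_cong refl rect s)
    also have "\<dots> = (SUP n. emeasure (\<Pi>\<^sub>M j\<in>J. \<Lambda>) (Pi\<^sub>E J (?A n)))"
      using J s by (intro SUP_cong refl P.emeasure_PiM[symmetric])
    also have "\<dots> = emeasure (\<Pi>\<^sub>M j\<in>J. \<Lambda>) (Pi\<^sub>E J A)"
      unfolding U by (rule SUP_emeasure_incseq[OF rs inc])
    also have "\<dots> = (\<Prod>i\<in>J. emeasure \<Lambda> (A i))" using J A by (simp add: P.emeasure_PiM)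
    finally show "emeasure N (Pi\<^sub>E J A) = (\<Prod>i\<in>J. emeasure \<Lambda> (A i))" .
  qed
  then show ?thesis using NF[OF F] by simp
qed

end

section \<open>Edge probabilities\<close>

fun place :: "(nat \<Rightarrow> 'a) \<Rightarrow> (nat \<Rightarrow> 'a) \<Rightarrow> vertex \<Rightarrow> 'a" where
  "place x y (Poi i) = x i"
| "place x y (Fixed j) = y j"

fun relabel :: "(nat \<Rightarrow> nat) \<Rightarrow> vertex \<Rightarrow> vertex" where
  "relabel \<beta> (Poi i) = Poi (\<beta> i)"
| "relabel \<beta> (Fixed j) = Fixed j"

abbreviation relabel_edges :: "(nat \<Rightarrow> nat) \<Rightarrow> vertex set set \<Rightarrow> vertex set set" where
  "relabel_edges \<beta> Q \<equiv> (\<lambda>e. relabel \<beta> ` e) ` Q"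

lemma position_eq_place: "position X y \<omega> v = place (\<lambda>i. X i \<omega>) y v"
  by (cases v) auto

lemma place_relabel: "place x y (relabel \<beta> v) = place (\<lambda>i. x (\<beta> i)) y v"
  by (cases v) auto

text \<open>Edges are unordered, whereas \<open>\<phi>\<close> and the conditional law take ordered
  pairs. An orientation is chosen once and for all; symmetry makes the weight independent of
  it.\<close>

definition ends :: "vertex set \<Rightarrow> vertex \<times> vertex" where
  "ends e = (SOME p. e = {fst p, snd p})"

definition edge_weight :: "('a \<Rightarrow> 'a \<Rightarrow> real) \<Rightarrow> (nat \<Rightarrow> 'a) \<Rightarrow> (nat \<Rightarrow> 'a) \<Rightarrow> vertex set \<Rightarrow> real" where
  "edge_weight \<phi> y x e = \<phi> (place x y (fst (ends e))) (place x y (snd (ends e)))"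

definition weight :: "'a measure \<Rightarrow> ('a \<Rightarrow> 'a \<Rightarrow> real) \<Rightarrow> (nat \<Rightarrow> 'a) \<Rightarrow> nat set \<Rightarrow> vertex set set \<Rightarrow> ennreal" where
  "weight \<mu> \<phi> y L Q = (\<integral>\<^sup>+x. (\<Prod>e\<in>Q. ennreal (edge_weight \<phi> y x e)) \<partial>(\<Pi>\<^sub>M i\<in>L. \<mu>))"

lemma ends:
  assumes "card e = 2" shows "{fst (ends e), snd (ends e)} = e" "fst (ends e) \<noteq> snd (ends e)"
proof -
  obtain u v where "e = {u, v}" using assms by (auto simp: card_2_iff)
  then have "\<exists>p. e = {fst p, snd p}" by auto
  then show *: "{fst (ends e), snd (ends e)} = e" unfolding ends_def by (rule someI2_ex) auto
  show "fst (ends e) \<noteq> snd (ends e)" using * assms by (auto simp: card_2_iff doubleton_eq_iff)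
qed

lemma edge_weight_doubleton:
  assumes "\<And>a b. \<phi> a b = \<phi> b a" "u \<noteq> v"
  shows "edge_weight \<phi> y x {u, v} = \<phi> (place x y u) (place x y v)"
proof -
  have "{fst (ends {u, v}), snd (ends {u, v})} = {u, v}" using assms by (intro ends) auto
  then show ?thesis unfolding edge_weight_def using assms by (auto simp: doubleton_eq_iff)
qed

lemma edge_weight_relabel:
  assumes \<phi>: "\<And>a b. \<phi> a b = \<phi> b a" and e: "card e = 2" "card (relabel \<beta> ` e) = 2"
  shows "edge_weight \<phi> y x (relabel \<beta> ` e) = edge_weight \<phi> y (\<lambda>i. x (\<beta> i)) e"
proof -
  obtain u v where [simp]: "e = {u, v}" and "u \<noteq> v" using e by (auto simp: card_2_iff)
  moreover have "relabel \<beta> u \<noteq> relabel \<beta> v" using e by auto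
  ultimately show ?thesis
    using \<phi> by (simp add: edge_weight_doubleton place_relabel)
qed

lemma edge_weight_cong:
  assumes "card e = 2" "\<And>i. Poi i \<in> e \<Longrightarrow> x i = x' i"
  shows "edge_weight \<phi> y x e = edge_weight \<phi> y x' e"
proof -
  have "place x y v = place x' y v" if "v \<in> e" for v using assms that by (cases v) auto
  then show ?thesis unfolding edge_weight_def using ends(1)[OF assms(1)] by (metis insertI1 insert_commute)
qed

lemma edge_weight_measurable:
  fixes \<phi> :: "'a::euclidean_space \<Rightarrow> 'a \<Rightarrow> real"
  assumes \<phi>: "(\<lambda>(x, y). \<phi> x y) \<in> borel_measurable (borel \<Otimes>\<^sub>M borel)"
    and e: "card e = 2" "e \<subseteq> Poi ` L \<union> range Fixed"
    and b: "sets \<mu> = sets borel"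
  shows "(\<lambda>x. edge_weight \<phi> y x e) \<in> borel_measurable (\<Pi>\<^sub>M i\<in>L. \<mu>)"
proof -
  have "(\<lambda>x. place x y v) \<in> measurable (\<Pi>\<^sub>M i\<in>L. \<mu>) borel" if "v \<in> e" for v
  proof (cases v)
    case (Poi i)
    then have "i \<in> L" using that e by auto
    then have "(\<lambda>x. x i) \<in> measurable (\<Pi>\<^sub>M i\<in>L. \<mu>) \<mu>" by (rule measurable_component_singleton)
    then show ?thesis using Poi by (simp add: measurable_cong_sets[OF refl b])
  qed simp
  moreover have "fst (ends e) \<in> e" "snd (ends e) \<in> e" using ends(1)[OF e(1)] by auto
  ultimately have "(\<lambda>x. (place x y (fst (ends e)), place x y (snd (ends e)))) \<in> measurable (\<Pi>\<^sub>M i\<in>L. \<mu>) (borel \<Otimes>\<^sub>M borel)"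
    by (intro measurable_Pair) auto
  from measurable_compose[OF this \<phi>] show ?thesis by (simp add: edge_weight_def)
qed

definition edges_on :: "nat set \<Rightarrow> vertex set set \<Rightarrow> bool" where
  "edges_on L Q \<longleftrightarrow> finite Q \<and> (\<forall>e\<in>Q. card e = 2) \<and> \<Union>Q \<subseteq> Poi ` L \<union> range Fixed"

lemma edges_on_relabel:
  assumes Q: "edges_on L Q" and \<beta>: "inj_on \<beta> L"
  shows "inj_on (\<lambda>e. relabel \<beta> ` e) Q" "e \<in> Q \<Longrightarrow> card (relabel \<beta> ` e) = 2"
    "edges_on (\<beta> ` L) (relabel_edges \<beta> Q)"
proof -
  have inj: "inj_on (relabel \<beta>) (Poi ` L \<union> range Fixed)"
  proof (rule inj_onI)
    fix u v assume "u \<in> Poi ` L \<union> range Fixed" "v \<in> Poi ` L \<union> range Fixed" "relabel \<beta> u = relabel \<beta> v"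
    then show "u = v" using \<beta> by (cases u; cases v) (auto dest: inj_onD)
  qed
  have sub: "e \<subseteq> Poi ` L \<union> range Fixed" if "e \<in> Q" for e using that Q unfolding edges_on_def by blast
  show "inj_on (\<lambda>e. relabel \<beta> ` e) Q"
    by (rule inj_onI) (metis inj inj_on_image_eq_iff sub)
  show card: "card (relabel \<beta> ` e) = 2" if "e \<in> Q" for e
    using Q that by (simp add: edges_on_def card_image inj_on_subset[OF inj sub[OF that]])
  have "relabel \<beta> v \<in> Poi ` \<beta> ` L \<union> range Fixed" if "v \<in> e" "e \<in> Q" for v e
    using sub[OF that(2)] that(1) by auto
  then show "edges_on (\<beta> ` L) (relabel_edges \<beta> Q)"
    using Q card by (auto simp: edges_on_def)
qed

lemma edge_prod_measurable:
  fixes \<phi> :: "'a::euclidean_space \<Rightarrow> 'a \<Rightarrow> real"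
  assumes "edges_on L Q" "(\<lambda>(x, y). \<phi> x y) \<in> borel_measurable (borel \<Otimes>\<^sub>M borel)" "sets \<mu> = sets borel"
  shows "(\<lambda>x. \<Prod>e\<in>Q. ennreal (edge_weight \<phi> y x e)) \<in> borel_measurable (\<Pi>\<^sub>M i\<in>L. \<mu>)"
  using assms unfolding edges_on_def
  by (intro borel_measurable_prod_ennreal measurable_compose[OF edge_weight_measurable measurable_ennreal]) auto

lemma sigma_finite_scale_measure:
  assumes "sigma_finite_measure \<mu>" shows "sigma_finite_measure (scale_measure (ennreal l) \<mu>)"
proof
  interpret sigma_finite_measure \<mu> by fact
  obtain A where "countable A" "A \<subseteq> sets \<mu>" "\<Union>A = space \<mu>" "\<forall>a\<in>A. emeasure \<mu> a \<noteq> \<infinity>"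
    using sigma_finite_countable by blast
  then show "\<exists>A. countable A \<and> A \<subseteq> sets (scale_measure (ennreal l) \<mu>) \<and>
      \<Union>A = space (scale_measure (ennreal l) \<mu>) \<and> (\<forall>a\<in>A. emeasure (scale_measure (ennreal l) \<mu>) a \<noteq> \<infinity>)"
    by (intro exI[of _ A]) (auto simp: space_scale_measure ennreal_mult_eq_top_iff)
qed

context random_connection_model
begin

abbreviation present :: "vertex set set \<Rightarrow> 'w set" where
  "present Q \<equiv> {\<omega> \<in> space M. Q \<subseteq> \<Gamma> \<omega>}"

lemma edges_present:
  assumes Q: "finite Q" "\<And>e. e \<in> Q \<Longrightarrow> card e = 2"
  shows "present Q \<in> sets M"
    "(\<lambda>\<omega>. of_bool (Q \<subseteq> \<Gamma> \<omega>) :: ennreal) \<in> borel_measurable M"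
    "(\<integral>\<^sup>+\<omega>. of_bool (Q \<subseteq> \<Gamma> \<omega>) \<partial>M) = emeasure M (present Q)"
proof -
  have "{\<omega> \<in> space M. e \<in> \<Gamma> \<omega>} \<in> sets M" if "e \<in> Q" for e
    using measurable_edges[of "fst (ends e)" "snd (ends e)"] ends(1)[OF Q(2)[OF that]] by simp
  then have "{\<omega> \<in> space M. \<forall>e\<in>Q. e \<in> \<Gamma> \<omega>} \<in> sets M" using Q(1) by (intro sets.sets_Collect_finite_All) auto
  then show S: "present Q \<in> sets M" by (simp add: subset_eq)
  have eq: "of_bool (Q \<subseteq> \<Gamma> \<omega>) = (indicator (present Q) \<omega> :: ennreal)" if "\<omega> \<in> space M" for \<omega>
    using that by (simp add: indicator_def)
  show "(\<lambda>\<omega>. of_bool (Q \<subseteq> \<Gamma> \<omega>) :: ennreal) \<in> borel_measurable M"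
    using S by (subst measurable_cong[OF eq]) auto
  show "(\<integral>\<^sup>+\<omega>. of_bool (Q \<subseteq> \<Gamma> \<omega>) \<partial>M) = emeasure M (present Q)"
    using S by (simp add: eq cong: nn_integral_cong)
qed

text \<open>The tower property for the conditional law of the edges. \<open>ends\<close> is
  injective on \<open>Q\<close> and turns it into the set of oriented pairs for which that law is
  stated.\<close>

lemma emeasure_edges:
  assumes Q: "finite Q" "\<And>e. e \<in> Q \<Longrightarrow> card e = 2"
    and \<phi>: "\<And>a b. \<phi> a b \<ge> 0"
  shows "emeasure M (present Q) =
    (\<integral>\<^sup>+\<omega>. of_bool (\<Union>Q \<subseteq> vertices m \<tau> \<omega>) * (\<Prod>e\<in>Q. ennreal (edge_weight \<phi> y (\<lambda>i. X i \<omega>) e)) \<partial>M)"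
proof -
  define S where "S = ends ` Q"
  let ?F = "points_algebra M \<tau> X"
  have sub: "subalgebra M ?F"
  proof -
    have "(\<lambda>\<omega>. (\<tau> \<omega>, \<lambda>i. X i \<omega>)) \<in> measurable M (count_space UNIV \<Otimes>\<^sub>M (\<Pi>\<^sub>M i\<in>(UNIV :: nat set). borel))"
      by (intro measurable_Pair measurable_number measurable_PiM_single' measurable_points) auto
    then show ?thesis unfolding points_algebra_def subalgebra_def
      by (simp add: sets_vimage_algebra measurable_iff_sets)
  qed
  interpret finite_measure_subalgebra M ?F by standard (rule sub)
  have ie: "inj_on ends Q"
    by (rule inj_onI) (metis Q(2) ends(1))
  have S1: "finite S" using Q by (simp add: S_def)
  have S2: "\<forall>(u, v)\<in>S. u \<noteq> v" using ends(2)[OF Q(2)] by (auto simp: S_def case_prod_beta')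
  have S3: "inj_on (\<lambda>(u, v). {u, v}) S"
  proof (rule inj_onI)
    fix p q assume "p \<in> S" "q \<in> S" and *: "(\<lambda>(u, v). {u, v}) p = (\<lambda>(u, v). {u, v}) q"
    then obtain e e' where "e \<in> Q" "e' \<in> Q" "p = ends e" "q = ends e'" by (auto simp: S_def)
    moreover have "e = e'" using * calculation ends(1)[OF Q(2)] by (simp add: case_prod_beta')
    ultimately show "p = q" by simp
  qed
  have eqS: "(\<forall>(u, v)\<in>S. {u, v} \<in> A) \<longleftrightarrow> Q \<subseteq> A" for A
    unfolding S_def using ends(1)[OF Q(2)] by (auto simp: case_prod_beta')
  have eqV: "(\<forall>(u, v)\<in>S. {u, v} \<subseteq> A) \<longleftrightarrow> \<Union>Q \<subseteq> A" for A
  proof -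
    have "(\<forall>(u, v)\<in>S. {u, v} \<subseteq> A) \<longleftrightarrow> (\<forall>e\<in>Q. {fst (ends e), snd (ends e)} \<subseteq> A)"
      by (simp add: S_def case_prod_beta')
    also have "\<dots> \<longleftrightarrow> (\<forall>e\<in>Q. e \<subseteq> A)" using ends(1)[OF Q(2)] by (intro ball_cong refl) (simp only:)
    finally show ?thesis by (simp add: Sup_le_iff)
  qed
  have eqP: "(\<Prod>(u, v)\<in>S. \<phi> (position X y \<omega> u) (position X y \<omega> v)) = (\<Prod>e\<in>Q. edge_weight \<phi> y (\<lambda>i. X i \<omega>) e)" for \<omega>
    unfolding S_def by (subst prod.reindex[OF ie]) (simp add: case_prod_beta' position_eq_place edge_weight_def)
  have AE: "AE \<omega> in M. real_cond_exp M ?F (\<lambda>\<omega>. of_bool (Q \<subseteq> \<Gamma> \<omega>)) \<omega>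
      = of_bool (\<Union>Q \<subseteq> vertices m \<tau> \<omega>) * (\<Prod>e\<in>Q. edge_weight \<phi> y (\<lambda>i. X i \<omega>) e)"
    using conditional_edges[OF S1 S2 S3] by (simp only: eqS eqV eqP)
  note mQ = edges_present(1)[OF Q]
  have ind: "(\<lambda>\<omega>. of_bool (Q \<subseteq> \<Gamma> \<omega>) :: real) \<in> borel_measurable M"
  proof -
    have "(\<lambda>\<omega>. indicator (present Q) \<omega> :: real) \<in> borel_measurable M"
      using mQ by (rule borel_measurable_indicator)
    then show ?thesis
      by (rule measurable_cong[THEN iffD1, rotated]) (auto simp: indicator_def)
  qed
  have i: "integrable M (\<lambda>\<omega>. of_bool (Q \<subseteq> \<Gamma> \<omega>) :: real)"
    by (rule integrable_const_bound[where B = 1]) (use ind in auto)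
  have nn: "of_bool (\<Union>Q \<subseteq> vertices m \<tau> \<omega>) * (\<Prod>e\<in>Q. edge_weight \<phi> y (\<lambda>i. X i \<omega>) e) \<ge> 0" for \<omega>
    using \<phi> by (auto intro!: mult_nonneg_nonneg prod_nonneg simp: edge_weight_def)
  have "emeasure M (present Q) = ennreal (\<integral>\<omega>. of_bool (Q \<subseteq> \<Gamma> \<omega>) \<partial>M)"
  proof -
    have "(\<integral>\<omega>. of_bool (Q \<subseteq> \<Gamma> \<omega>) \<partial>M) = (\<integral>\<omega>. indicator (present Q) \<omega> \<partial>M)"
      by (intro Bochner_Integration.integral_cong refl) (auto simp: indicator_def)
    also have "\<dots> = prob (present Q)"
      by (simp add: Int_absorb2 Collect_conj_eq)
    finally show ?thesis by (simp add: emeasure_eq_measure)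
  qed
  also have "\<dots> = ennreal (\<integral>\<omega>. real_cond_exp M ?F (\<lambda>\<omega>. of_bool (Q \<subseteq> \<Gamma> \<omega>)) \<omega> \<partial>M)"
    using real_cond_exp_int(2)[OF i] by simp
  also have "\<dots> = (\<integral>\<^sup>+\<omega>. ennreal (real_cond_exp M ?F (\<lambda>\<omega>. of_bool (Q \<subseteq> \<Gamma> \<omega>)) \<omega>) \<partial>M)"
    using AE nn by (intro nn_integral_eq_integral[symmetric] real_cond_exp_int(1)[OF i]) auto
  also have "\<dots> = (\<integral>\<^sup>+\<omega>. of_bool (\<Union>Q \<subseteq> vertices m \<tau> \<omega>) * (\<Prod>e\<in>Q. ennreal (edge_weight \<phi> y (\<lambda>i. X i \<omega>) e)) \<partial>M)"
    using AE by (intro nn_integral_cong_AE, eventually_elim)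
      (use \<phi> in \<open>auto simp: prod_ennreal edge_weight_def\<close>)
  finally show ?thesis .
qed

text \<open>Averaging over the edges leaves, for each relabelling, an expectation over the points
  alone; summed over the relabellings it is the left side of the Mecke formula.\<close>

lemma sum_emeasure_relabelled_edges:
  assumes Q: "finite Q" "\<And>e. e \<in> Q \<Longrightarrow> card e = 2"
    and L: "finite L" "\<Union>Q \<subseteq> Poi ` L \<union> Fixed ` {1..m}" "Poi ` L \<subseteq> \<Union>Q"
    and \<phi>: "\<And>a b. \<phi> a b \<ge> 0" "\<And>a b. \<phi> a b = \<phi> b a" "(\<lambda>(x, y). \<phi> x y) \<in> borel_measurable (borel \<Otimes>\<^sub>M borel)"
    and \<Lambda>: "sets \<Lambda> = sets borel" "sigma_finite_measure \<Lambda>"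
  shows "(\<integral>\<^sup>+\<beta>. emeasure M (present (relabel_edges \<beta> Q)) \<partial>count_space (label_maps L)) = weight \<Lambda> \<phi> y L Q"
proof -
  let ?F = "\<lambda>x. \<Prod>e\<in>Q. ennreal (edge_weight \<phi> y x e)"
  have on: "edges_on L Q" using Q L(2) by (auto simp: edges_on_def)
  note F = edge_prod_measurable[OF on \<phi>(3) \<Lambda>(1), of y]
  have R: "emeasure M (present (relabel_edges \<beta> Q))
      = (\<integral>\<^sup>+\<omega>. of_bool (\<beta> ` L \<subseteq> indices \<tau> \<omega>) * ?F (\<lambda>i\<in>L. X (\<beta> i) \<omega>) \<partial>M)" if b: "\<beta> \<in> label_maps L" for \<beta>
  proof -
    have "inj_on \<beta> L" using b by (simp add: label_maps_def)
    note injQ = edges_on_relabel(1)[OF on this] and card = edges_on_relabel(2)[OF on this]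
    \<comment> \<open>The edges of \<open>Q\<close> cover all labels of \<open>L\<close>, so the
      requirement that they join actual vertices becomes exactly the indicator in
      \<open>label_sum\<close>.\<close>
    have V: "\<Union>(relabel_edges \<beta> Q) \<subseteq> vertices m \<tau> \<omega> \<longleftrightarrow> \<beta> ` L \<subseteq> indices \<tau> \<omega>" for \<omega>
    proof
      assume *: "\<Union>(relabel_edges \<beta> Q) \<subseteq> vertices m \<tau> \<omega>"
      show "\<beta> ` L \<subseteq> indices \<tau> \<omega>"
      proof
        fix k assume "k \<in> \<beta> ` L"
        then obtain i where "i \<in> L" "k = \<beta> i" by auto
        moreover from this have "Poi i \<in> \<Union>Q" using L(3) by blast
        ultimately have "relabel \<beta> (Poi i) \<in> vertices m \<tau> \<omega>" using * by blast
        then show "k \<in> indices \<tau> \<omega>" using \<open>k = _\<close> by (auto simp: vertices_def)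
      qed
    next
      assume *: "\<beta> ` L \<subseteq> indices \<tau> \<omega>"
      have "relabel \<beta> v \<in> vertices m \<tau> \<omega>" if "v \<in> \<Union>Q" for v
      proof -
        have "v \<in> Poi ` L \<union> Fixed ` {1..m}" using L(2) that by blast
        then show ?thesis using * by (auto simp: vertices_def)
      qed
      then show "\<Union>(relabel_edges \<beta> Q) \<subseteq> vertices m \<tau> \<omega>" by auto
    qed
    have P: "(\<Prod>e\<in>relabel_edges \<beta> Q. ennreal (edge_weight \<phi> y (\<lambda>i. X i \<omega>) e)) = ?F (\<lambda>i\<in>L. X (\<beta> i) \<omega>)" for \<omega>
    proof (subst prod.reindex[OF injQ], intro prod.cong refl)
      fix e assume e: "e \<in> Q"
      have "edge_weight \<phi> y (\<lambda>i. X i \<omega>) (relabel \<beta> ` e) = edge_weight \<phi> y (\<lambda>i. X (\<beta> i) \<omega>) e"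
        by (rule edge_weight_relabel[OF \<phi>(2) Q(2)[OF e] card[OF e]])
      also have "\<dots> = edge_weight \<phi> y (\<lambda>i\<in>L. X (\<beta> i) \<omega>) e"
        using e L by (intro edge_weight_cong Q(2)) auto
      finally show "((\<lambda>e. ennreal (edge_weight \<phi> y (\<lambda>i. X i \<omega>) e)) \<circ> (\<lambda>e. relabel \<beta> ` e)) e
        = ennreal (edge_weight \<phi> y (\<lambda>i\<in>L. X (\<beta> i) \<omega>) e)" by simp
    qed
    show ?thesis
      using Q card by (subst emeasure_edges) (auto simp: \<phi> V P)
  qed
  have mk: "(\<lambda>\<omega>. of_bool (\<beta> ` L \<subseteq> indices \<tau> \<omega>) * ?F (\<lambda>i\<in>L. X (\<beta> i) \<omega>)) \<in> borel_measurable M" for \<beta>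
  proof -
    have "X i \<in> measurable M \<Lambda>" for i using measurable_points[of i] by (simp add: measurable_cong_sets[OF refl \<Lambda>(1)])
    then have "(\<lambda>\<omega>. \<lambda>i\<in>L. X (\<beta> i) \<omega>) \<in> measurable M (\<Pi>\<^sub>M i\<in>L. \<Lambda>)" by (intro measurable_restrict)
    from measurable_compose[OF this F] show ?thesis
      by (intro borel_measurable_times_ennreal borel_measurable_indices L)
  qed
  have "(\<integral>\<^sup>+\<beta>. emeasure M (present (relabel_edges \<beta> Q)) \<partial>count_space (label_maps L))
    = (\<integral>\<^sup>+\<beta>. (\<integral>\<^sup>+\<omega>. of_bool (\<beta> ` L \<subseteq> indices \<tau> \<omega>) * ?F (\<lambda>i\<in>L. X (\<beta> i) \<omega>) \<partial>M) \<partial>count_space (label_maps L))"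
    by (intro nn_integral_cong R) simp
  also have "\<dots> = (\<integral>\<^sup>+\<omega>. (\<integral>\<^sup>+\<beta>. of_bool (\<beta> ` L \<subseteq> indices \<tau> \<omega>) * ?F (\<lambda>i\<in>L. X (\<beta> i) \<omega>) \<partial>count_space (label_maps L)) \<partial>M)"
    using mk by (intro nn_integral_count_space_nn_integral[symmetric] countable_label_maps L) auto
  also have "\<dots> = weight \<Lambda> \<phi> y L Q"
    unfolding weight_def by (rule mecke[OF L(1) \<Lambda> F])
  finally show ?thesis .
qed

end

text \<open>Every label contributes \<open>l\<close> through the measure and every edge contributes
  \<open>c\<close> through its weight. The scaled product measure is identified by its values on
  rectangles.\<close>

lemma weight_scale:
  fixes \<mu> :: "'a::euclidean_space measure"
  assumes \<mu>: "sigma_finite_measure \<mu>" "sets \<mu> = sets borel" and L: "finite L" and Q: "edges_on L Q"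
    and \<phi>: "\<And>a b. \<phi> a b \<ge> 0" "(\<lambda>(x, y). \<phi> x y) \<in> borel_measurable (borel \<Otimes>\<^sub>M borel)"
    and c: "c \<ge> 0" "l > 0"
  shows "weight (scale_measure (ennreal l) \<mu>) (\<lambda>x y. c * \<phi> x y) y L Q
    = ennreal (l ^ card L * c ^ card Q) * weight \<mu> \<phi> y L Q"
proof -
  interpret \<mu>: sigma_finite_measure \<mu> by fact
  interpret P: product_sigma_finite "\<lambda>_. \<mu>" by standard
  let ?\<Lambda> = "scale_measure (ennreal l) \<mu>"
  interpret \<Lambda>: sigma_finite_measure ?\<Lambda> by (rule sigma_finite_scale_measure[OF \<mu>(1)])
  interpret PL: product_sigma_finite "\<lambda>_. ?\<Lambda>" by standard
  have s: "sets (\<Pi>\<^sub>M i\<in>L. ?\<Lambda>) = sets (\<Pi>\<^sub>M i\<in>L. \<mu>)" by (intro sets_PiM_cong) auto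
  have eq: "scale_measure (ennreal (l ^ card L)) (\<Pi>\<^sub>M i\<in>L. \<mu>) = (\<Pi>\<^sub>M i\<in>L. ?\<Lambda>)"
  proof (rule PL.PiM_eqI[OF L])
    fix A assume A: "\<And>i. i \<in> L \<Longrightarrow> A i \<in> sets ?\<Lambda>"
    then show "emeasure (scale_measure (ennreal (l ^ card L)) (\<Pi>\<^sub>M i\<in>L. \<mu>)) (Pi\<^sub>E L A) = (\<Prod>i\<in>L. emeasure ?\<Lambda> (A i))"
      using L c by (simp add: P.emeasure_PiM prod.distrib ennreal_power)
  qed (simp add: s)
  have mF: "(\<lambda>x. \<Prod>e\<in>Q. ennreal (edge_weight (\<lambda>x y. c' * \<phi> x y) y x e)) \<in> borel_measurable (\<Pi>\<^sub>M i\<in>L. \<mu>)" for c'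
  proof -
    have "(\<lambda>(x, y). c' * \<phi> x y) \<in> borel_measurable (borel \<Otimes>\<^sub>M borel)"
      using \<phi>(2) by (simp add: case_prod_beta')
    then show ?thesis using Q \<mu> by (intro edge_prod_measurable)
  qed
  have "weight ?\<Lambda> (\<lambda>x y. c * \<phi> x y) y L Q =
    ennreal (l ^ card L) * (\<integral>\<^sup>+x. (\<Prod>e\<in>Q. ennreal (edge_weight (\<lambda>x y. c * \<phi> x y) y x e)) \<partial>(\<Pi>\<^sub>M i\<in>L. \<mu>))"
    unfolding weight_def eq[symmetric] by (rule nn_integral_scale_measure[OF mF])
  also have "(\<integral>\<^sup>+x. (\<Prod>e\<in>Q. ennreal (edge_weight (\<lambda>x y. c * \<phi> x y) y x e)) \<partial>(\<Pi>\<^sub>M i\<in>L. \<mu>))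
    = (\<integral>\<^sup>+x. ennreal (c ^ card Q) * (\<Prod>e\<in>Q. ennreal (edge_weight \<phi> y x e)) \<partial>(\<Pi>\<^sub>M i\<in>L. \<mu>))"
    using c \<phi> by (simp add: edge_weight_def ennreal_mult prod.distrib ennreal_power)
  also have "\<dots> = ennreal (c ^ card Q) * weight \<mu> \<phi> y L Q"
    unfolding weight_def using mF[of 1] by (intro nn_integral_cmult) simp
  finally show ?thesis using c by (simp add: ennreal_mult mult.assoc)
qed

section \<open>Families of copies and their label patterns\<close>

text \<open>A path from inside \<open>U\<close> to outside has to leave \<open>U\<close> at some
  edge.\<close>

lemma connected_graph_cut:
  assumes "connected_graph V E" "U \<subseteq> V" "U \<noteq> {}" "U \<noteq> V"
  obtains u v where "u \<in> U" "v \<in> V - U" "{u, v} \<in> E"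
proof -
  let ?R = "{(x, y). x \<in> V \<and> y \<in> V \<and> {x, y} \<in> E}"
  obtain a b where a: "a \<in> U" and b: "b \<in> V - U" using assms by auto
  then have "(a, b) \<in> ?R\<^sup>*" using assms unfolding connected_graph_def by blast
  then have "b \<in> U \<or> (\<exists>u v. u \<in> U \<and> v \<in> V - U \<and> {u, v} \<in> E)"
    by (induction rule: rtrancl_induct) (use a in auto)
  then show thesis using b that by auto
qed

locale endpoint_graph =
  fixes r m :: nat and E :: "nat set set"
  assumes r2: "2 \<le> r" and G: "graph_with_endpoints r m E"
begin

definition place_slot :: "(nat \<Rightarrow> nat) \<Rightarrow> nat \<Rightarrow> vertex" where
  "place_slot \<alpha> i = (if i \<le> r then Poi (\<alpha> i) else Fixed (i - r))"

definition copy_edges :: "(nat \<Rightarrow> nat) \<Rightarrow> vertex set set" where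
  "copy_edges \<alpha> = (\<lambda>e. place_slot \<alpha> ` e) ` E"

text \<open>A union of sets: an edge common to several copies is a single event and costs a single
  factor \<open>c\<close>.\<close>

definition fam_edges :: "nat set \<Rightarrow> (nat \<Rightarrow> nat \<Rightarrow> nat) \<Rightarrow> vertex set set" where
  "fam_edges T p = (\<Union>t\<in>T. copy_edges (p t))"

definition fam_labels :: "nat set \<Rightarrow> (nat \<Rightarrow> nat \<Rightarrow> nat) \<Rightarrow> nat set" where
  "fam_labels T p = (\<Union>t\<in>T. p t ` {1..r})"

definition families :: "nat set \<Rightarrow> (nat \<Rightarrow> nat \<Rightarrow> nat) set" where
  "families T = (T \<rightarrow>\<^sub>E label_maps {1..r})"

text \<open>The edges that a new copy can share with earlier ones if exactly its slots in
  \<open>W\<close> carry old labels. They are the edges of the subgraph of \<open>G\<close> induced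
  on \<open>W\<close> and all endpoints, the \<open>H\<close> of the overview.\<close>

definition closed_edges :: "nat set \<Rightarrow> nat set set" where
  "closed_edges W = {e \<in> E. e \<inter> {1..r} \<subseteq> W}"

lemma edgeD: assumes "e \<in> E" shows "e \<subseteq> {1..r + m}" "card e = 2" "finite e"
proof -
  show "e \<subseteq> {1..r + m}" "card e = 2"
    using assms G by (auto simp: graph_with_endpoints_def simple_graph_def)
  then show "finite e" using finite_subset by blast
qed

lemma finite_E: "finite E"
proof (rule finite_subset)
  show "E \<subseteq> Pow {1..r + m}" using edgeD by auto
qed simp

lemma edge_meets: assumes "e \<in> E" obtains i where "i \<in> e" "i \<in> {1..r}"
proof -
  obtain u v where e: "e = {u, v}" using edgeD(2)[OF assms] by (auto simp: card_2_iff)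
  have "\<not> (u \<in> {r + 1..r + m} \<and> v \<in> {r + 1..r + m})"
    using G assms e by (auto simp: graph_with_endpoints_def)
  moreover have "u \<in> {1..r + m}" "v \<in> {1..r + m}" using edgeD(1)[OF assms] e by auto
  ultimately have "u \<in> {1..r} \<or> v \<in> {1..r}" by auto
  then show ?thesis using that e by blast
qed

lemma slot_in_edge: assumes "i \<in> {1..r}" obtains e where "e \<in> E" "i \<in> e"
proof -
  have "connected_graph {1..r} (induced_edges E {1..r})"
    using G by (simp add: graph_with_endpoints_def)
  moreover have "{i} \<noteq> {1..r}"
  proof
    assume "{i} = {1..r}"
    then have "card {i} = card {1..r}" by simp
    then show False using r2 by simp
  qed
  ultimately obtain u v where "u \<in> {i}" "{u, v} \<in> induced_edges E {1..r}"
    using assms by (elim connected_graph_cut[where U = "{i}"]) auto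
  then show ?thesis using that by (auto simp: induced_edges_def)
qed

lemma place_slot_simps [simp]:
  "1 \<le> i \<Longrightarrow> i \<le> r \<Longrightarrow> place_slot \<alpha> i = Poi (\<alpha> i)"
  by (simp add: place_slot_def)

lemma place_slot_range: "i \<in> {1..r + m} \<Longrightarrow> place_slot \<alpha> i \<in> Poi ` \<alpha> ` {1..r} \<union> Fixed ` {1..m}"
proof (cases "i \<le> r")
  case False
  assume "i \<in> {1..r + m}"
  with False have "i - r \<in> {1..m}" by auto
  with False show ?thesis by (simp add: place_slot_def)
qed (auto simp: place_slot_def)

lemma inj_place_slot:
  assumes "\<alpha> \<in> label_maps {1..r}" shows "inj_on (place_slot \<alpha>) {1..r + m}"
proof (rule inj_onI)
  fix i j assume "i \<in> {1..r + m}" "j \<in> {1..r + m}" "place_slot \<alpha> i = place_slot \<alpha> j"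
  then show "i = j" using assms inj_onD[of \<alpha> "{1..r}" i j]
    by (auto simp: place_slot_def label_maps_def split: if_splits)
qed

lemma inj_copy:
  assumes "\<alpha> \<in> label_maps {1..r}" shows "inj_on (\<lambda>e. place_slot \<alpha> ` e) E"
  by (rule inj_onI) (use inj_place_slot[OF assms] edgeD(1) in \<open>metis inj_on_image_eq_iff\<close>)

lemma copy_edges:
  assumes "\<alpha> \<in> label_maps {1..r}"
  shows "finite (copy_edges \<alpha>)" "card (copy_edges \<alpha>) = card E"
    "f \<in> copy_edges \<alpha> \<Longrightarrow> card f = 2"
    "\<Union>(copy_edges \<alpha>) \<subseteq> Poi ` \<alpha> ` {1..r} \<union> Fixed ` {1..m}"
    "Poi ` \<alpha> ` {1..r} \<subseteq> \<Union>(copy_edges \<alpha>)"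
    "f \<in> copy_edges \<alpha> \<Longrightarrow> \<exists>l\<in>\<alpha> ` {1..r}. Poi l \<in> f"
proof -
  show "finite (copy_edges \<alpha>)" by (simp add: copy_edges_def finite_E)
  show "card (copy_edges \<alpha>) = card E"
    unfolding copy_edges_def by (rule card_image[OF inj_copy[OF assms]])
  show "card f = 2" if f: "f \<in> copy_edges \<alpha>" for f
  proof -
    obtain e where "e \<in> E" "f = place_slot \<alpha> ` e" using f by (auto simp: copy_edges_def)
    then show ?thesis
      using edgeD[of e] by (simp add: card_image inj_on_subset[OF inj_place_slot[OF assms]])
  qed
  show "\<Union>(copy_edges \<alpha>) \<subseteq> Poi ` \<alpha> ` {1..r} \<union> Fixed ` {1..m}"
  proof
    fix x assume "x \<in> \<Union>(copy_edges \<alpha>)"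
    then obtain e i where "e \<in> E" "i \<in> e" "x = place_slot \<alpha> i" by (auto simp: copy_edges_def)
    then show "x \<in> Poi ` \<alpha> ` {1..r} \<union> Fixed ` {1..m}"
      using edgeD(1)[of e] place_slot_range[of i \<alpha>] by auto
  qed
  show "Poi ` \<alpha> ` {1..r} \<subseteq> \<Union>(copy_edges \<alpha>)"
  proof
    fix x assume "x \<in> Poi ` \<alpha> ` {1..r}"
    then obtain i where i: "i \<in> {1..r}" "x = Poi (\<alpha> i)" by auto
    obtain e where e: "e \<in> E" "i \<in> e" using slot_in_edge[OF i(1)] .
    have "x \<in> place_slot \<alpha> ` e" using i e by (metis imageI place_slot_simps atLeastAtMost_iff)
    then show "x \<in> \<Union>(copy_edges \<alpha>)" using e by (auto simp: copy_edges_def)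
  qed
  show "\<exists>l\<in>\<alpha> ` {1..r}. Poi l \<in> f" if f: "f \<in> copy_edges \<alpha>"
  proof -
    obtain e where e: "e \<in> E" "f = place_slot \<alpha> ` e" using f by (auto simp: copy_edges_def)
    obtain i where "i \<in> e" "i \<in> {1..r}" using edge_meets[OF e(1)] .
    then show ?thesis using e(2) by (metis imageI place_slot_simps atLeastAtMost_iff)
  qed
qed

lemma familiesD: "p \<in> families T \<Longrightarrow> t \<in> T \<Longrightarrow> p t \<in> label_maps {1..r}"
  by (auto simp: families_def)

lemma fam_edges:
  assumes "finite T" "p \<in> families T"
  shows "finite (fam_edges T p)" "finite (fam_labels T p)"
    "f \<in> fam_edges T p \<Longrightarrow> card f = 2"
    "\<Union>(fam_edges T p) \<subseteq> Poi ` fam_labels T p \<union> Fixed ` {1..m}"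
    "Poi ` fam_labels T p \<subseteq> \<Union>(fam_edges T p)"
    "f \<in> fam_edges T p \<Longrightarrow> \<exists>l\<in>fam_labels T p. Poi l \<in> f"
proof -
  note c = copy_edges[OF familiesD[OF assms(2)]]
  show "finite (fam_edges T p)" "finite (fam_labels T p)"
    using assms c(1) by (simp_all add: fam_edges_def fam_labels_def)
  show "card f = 2" if f: "f \<in> fam_edges T p"
  proof -
    obtain t where "t \<in> T" "f \<in> copy_edges (p t)" using f by (auto simp: fam_edges_def)
    then show ?thesis by (rule c(3))
  qed
  have "Poi ` p t ` {1..r} \<union> Fixed ` {1..m} \<subseteq> Poi ` fam_labels T p \<union> Fixed ` {1..m}" if "t \<in> T" for t
    unfolding fam_labels_def using that by blast
  then have "\<Union>(copy_edges (p t)) \<subseteq> Poi ` fam_labels T p \<union> Fixed ` {1..m}" if t: "t \<in> T" for t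
    by (rule order_trans[OF c(4)[OF t]]) (rule t)
  then show "\<Union>(fam_edges T p) \<subseteq> Poi ` fam_labels T p \<union> Fixed ` {1..m}"
    unfolding fam_edges_def by blast
  have "Poi ` p t ` {1..r} \<subseteq> \<Union>(fam_edges T p)" if "t \<in> T" for t
    using c(5)[OF that] that unfolding fam_edges_def by blast
  then show "Poi ` fam_labels T p \<subseteq> \<Union>(fam_edges T p)"
    unfolding fam_labels_def image_UN by blast
  show "\<exists>l\<in>fam_labels T p. Poi l \<in> f" if f: "f \<in> fam_edges T p"
  proof -
    obtain t where t: "t \<in> T" "f \<in> copy_edges (p t)" using f by (auto simp: fam_edges_def)
    from c(6)[OF this] obtain l where "l \<in> p t ` {1..r}" "Poi l \<in> f" by blast
    then show ?thesis using t unfolding fam_labels_def by blast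
  qed
qed

text \<open>Each label is replaced by the code of the first slot that carries it, so that \<open>rep T a\<close> is a
  canonical member of the orbit of \<open>a\<close> under injective relabelling.\<close>

definition rep :: "nat set \<Rightarrow> (nat \<Rightarrow> nat \<Rightarrow> nat) \<Rightarrow> nat \<Rightarrow> nat \<Rightarrow> nat" where
  "rep T a = (\<lambda>t\<in>T. \<lambda>i\<in>{1..r}. LEAST k. \<exists>t'\<in>T. \<exists>i'\<in>{1..r}. k = prod_encode (t', i') \<and> a t' i' = a t i)"

definition reps :: "nat set \<Rightarrow> (nat \<Rightarrow> nat \<Rightarrow> nat) set" where
  "reps T = {p \<in> families T. rep T p = p}"

lemma rep_cong:
  assumes "\<And>t i t' i'. t \<in> T \<Longrightarrow> t' \<in> T \<Longrightarrow> i \<in> {1..r} \<Longrightarrow> i' \<in> {1..r} \<Longrightarrow> (a t i = a t' i') = (b t i = b t' i')"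
  shows "rep T a = rep T b"
  unfolding rep_def using assms by (intro restrict_ext arg_cong[where f = Least] ext) blast

lemma rep_code:
  assumes "t \<in> T" "i \<in> {1..r}"
  obtains t' i' where "t' \<in> T" "i' \<in> {1..r}" "rep T a t i = prod_encode (t', i')" "a t' i' = a t i"
proof -
  let ?P = "\<lambda>k. \<exists>t'\<in>T. \<exists>i'\<in>{1..r}. k = prod_encode (t', i') \<and> a t' i' = a t i"
  have "?P (prod_encode (t, i))" using assms by blast
  then have "?P (Least ?P)" by (rule LeastI)
  then show ?thesis using that assms unfolding rep_def by auto
qed

lemma rep_eq_iff:
  assumes t: "t \<in> T" "i \<in> {1..r}" and t': "t' \<in> T" "i' \<in> {1..r}"
  shows "rep T a t i = rep T a t' i' \<longleftrightarrow> a t i = a t' i'"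
proof
  assume *: "rep T a t i = rep T a t' i'"
  obtain s j where s: "rep T a t i = prod_encode (s, j)" "a s j = a t i" using rep_code[OF t] by metis
  obtain s' j' where s': "rep T a t' i' = prod_encode (s', j')" "a s' j' = a t' i'" using rep_code[OF t'] by metis
  have "(s, j) = (s', j')" using * s s' by (metis prod_encode_eq)
  then show "a t i = a t' i'" using s s' by simp
next
  assume "a t i = a t' i'"
  then show "rep T a t i = rep T a t' i'" using assms by (simp add: rep_def)
qed

lemma rep_in_reps: assumes "a \<in> families T" shows "rep T a \<in> reps T"
proof -
  have "rep T (rep T a) = rep T a" by (rule rep_cong) (auto simp: rep_eq_iff)
  moreover have "rep T a t \<in> label_maps {1..r}" if "t \<in> T" for t
  proof -
    have "inj_on (a t) {1..r}" using familiesD[OF assms that] by (simp add: label_maps_def)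
    then have "inj_on (rep T a t) {1..r}" 
      by (intro inj_onI) (metis rep_eq_iff that inj_onD)
    moreover have "rep T a t \<in> {1..r} \<rightarrow>\<^sub>E UNIV" using that by (simp add: rep_def)
    ultimately show ?thesis by (simp add: label_maps_def)
  qed
  ultimately show ?thesis by (auto simp: reps_def families_def rep_def)
qed

text \<open>Canonical labels are codes of slots and so come from a finite set. This makes a moment a
  finite sum, each term standing for a whole orbit of families.\<close>

lemma finite_reps: assumes "finite T" shows "finite (reps T)"
proof (rule finite_subset)
  let ?C = "prod_encode ` (T \<times> {1..r})"
  show "reps T \<subseteq> T \<rightarrow>\<^sub>E ({1..r} \<rightarrow>\<^sub>E ?C)"
  proof
    fix p assume p: "p \<in> reps T"
    have "p t i \<in> ?C" if ti: "t \<in> T" "i \<in> {1..r}" for t i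
    proof -
      have "p t i = rep T p t i" using p by (simp add: reps_def)
      moreover obtain t' i' where "t' \<in> T" "i' \<in> {1..r}" "rep T p t i = prod_encode (t', i')"
        using rep_code[OF ti, of p] by metis
      ultimately show ?thesis by (metis SigmaI imageI)
    qed
    then show "p \<in> T \<rightarrow>\<^sub>E ({1..r} \<rightarrow>\<^sub>E ?C)"
      using p by (auto simp: reps_def families_def label_maps_def PiE_iff)
  qed
  show "finite (T \<rightarrow>\<^sub>E ({1..r} \<rightarrow>\<^sub>E ?C))" using assms by (intro finite_PiE) auto
qed

definition relabelled :: "nat set \<Rightarrow> (nat \<Rightarrow> nat) \<Rightarrow> (nat \<Rightarrow> nat \<Rightarrow> nat) \<Rightarrow> nat \<Rightarrow> nat \<Rightarrow> nat" where
  "relabelled T \<beta> p = (\<lambda>t\<in>T. \<lambda>i\<in>{1..r}. \<beta> (p t i))"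

text \<open>Families have the same canonical form exactly when the same slots coincide, so those
  with form \<open>p\<close> are the injective relabellings of \<open>p\<close>. The relabelling is
  unique because every label of \<open>p\<close> sits in some slot.\<close>

lemma bij_relabelled:
  assumes p: "p \<in> reps T"
  shows "bij_betw (\<lambda>\<beta>. relabelled T \<beta> p) (label_maps (fam_labels T p)) {a \<in> families T. rep T a = p}"
proof -
  have lab: "p t i \<in> fam_labels T p" if "t \<in> T" "i \<in> {1..r}" for t i
    using that unfolding fam_labels_def by blast
  have pf: "p \<in> families T" and pr: "rep T p = p" using p by (auto simp: reps_def)
  show ?thesis
  proof (intro bij_betwI' iffI)
    fix \<beta> \<gamma> assume b: "\<beta> \<in> label_maps (fam_labels T p)" and g: "\<gamma> \<in> label_maps (fam_labels T p)"
      and eq: "relabelled T \<beta> p = relabelled T \<gamma> p"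
    have "\<beta> l = \<gamma> l" if l: "l \<in> fam_labels T p" for l
    proof -
      obtain t i where ti: "t \<in> T" "i \<in> {1..r}" "l = p t i" using l by (auto simp: fam_labels_def)
      have "relabelled T \<beta> p t i = relabelled T \<gamma> p t i" using eq by simp
      then show ?thesis using ti by (simp add: relabelled_def)
    qed
    then show "\<beta> = \<gamma>" using b g by (auto simp: label_maps_def intro: PiE_ext)
  next
    fix \<beta> assume b: "\<beta> \<in> label_maps (fam_labels T p)"
    have eq: "(relabelled T \<beta> p t i = relabelled T \<beta> p t' i') = (p t i = p t' i')"
      if "t \<in> T" "t' \<in> T" "i \<in> {1..r}" "i' \<in> {1..r}" for t i t' i'
    proof -
      have "inj_on \<beta> (fam_labels T p)" using b by (simp add: label_maps_def)
      then have "\<beta> (p t i) = \<beta> (p t' i') \<longleftrightarrow> p t i = p t' i'"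
        using lab that by (intro inj_on_eq_iff)
      then show ?thesis using that by (simp add: relabelled_def)
    qed
    have "rep T (relabelled T \<beta> p) = p" using rep_cong[OF eq] pr by simp
    moreover have "relabelled T \<beta> p t \<in> label_maps {1..r}" if "t \<in> T" for t
    proof -
      have "inj_on (p t) {1..r}" using familiesD[OF pf that] by (simp add: label_maps_def)
      then have "inj_on (relabelled T \<beta> p t) {1..r}"
        by (intro inj_onI) (metis eq[OF that that] inj_onD)
      moreover have "relabelled T \<beta> p t \<in> {1..r} \<rightarrow>\<^sub>E UNIV" using that by (simp add: relabelled_def)
      ultimately show ?thesis by (simp add: label_maps_def)
    qed
    ultimately show "relabelled T \<beta> p \<in> {a \<in> families T. rep T a = p}"
      by (auto simp: families_def relabelled_def)
  next
    fix a assume a: "a \<in> {a \<in> families T. rep T a = p}"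
    then have af: "a \<in> families T" by simp
    have eq: "p t i = p t' i' \<longleftrightarrow> a t i = a t' i'" if "t \<in> T" "t' \<in> T" "i \<in> {1..r}" "i' \<in> {1..r}" for t i t' i'
      using a rep_eq_iff[OF that(1,3,2,4), of a] by simp
    \<comment> \<open>The new value of a label is read off \<open>a\<close> at any slot that carries
      it; \<open>eq\<close> makes the choice of slot immaterial.\<close>
    define \<beta> where "\<beta> = (\<lambda>l\<in>fam_labels T p. SOME k. \<exists>t\<in>T. \<exists>i\<in>{1..r}. l = p t i \<and> k = a t i)"
    have \<beta>: "\<beta> (p t i) = a t i" if ti: "t \<in> T" "i \<in> {1..r}" for t i
    proof -
      have "\<exists>k. \<exists>t'\<in>T. \<exists>i'\<in>{1..r}. p t i = p t' i' \<and> k = a t' i'" using ti by blast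
      then have "\<exists>t'\<in>T. \<exists>i'\<in>{1..r}. p t i = p t' i' \<and> (SOME k. \<exists>t'\<in>T. \<exists>i'\<in>{1..r}. p t i = p t' i' \<and> k = a t' i') = a t' i'"
        by (rule someI_ex)
      then show ?thesis unfolding \<beta>_def using lab[OF ti] eq[OF ti(1) _ ti(2)] by auto
    qed
    have "inj_on \<beta> (fam_labels T p)"
    proof (rule inj_onI)
      fix k l assume "k \<in> fam_labels T p" "l \<in> fam_labels T p" "\<beta> k = \<beta> l"
      then show "k = l" using \<beta> eq unfolding fam_labels_def by fastforce
    qed
    then have "\<beta> \<in> label_maps (fam_labels T p)" by (simp add: label_maps_def \<beta>_def)
    moreover have "relabelled T \<beta> p = a"
    proof
      fix t show "relabelled T \<beta> p t = a t"
      proof (cases "t \<in> T")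
        case True
        then have "a t \<in> {1..r} \<rightarrow>\<^sub>E UNIV" using familiesD[OF af] by (simp add: label_maps_def)
        then show ?thesis using True \<beta>
          by (auto simp: relabelled_def fun_eq_iff PiE_def extensional_def)
      next
        case False
        then show ?thesis using af by (auto simp: relabelled_def families_def PiE_def extensional_def)
      qed
    qed
    ultimately show "\<exists>\<beta>\<in>label_maps (fam_labels T p). a = relabelled T \<beta> p" by blast
  qed simp
qed

lemma fam_edges_relabelled:
  "fam_edges T (relabelled T \<beta> p) = relabel_edges \<beta> (fam_edges T p)"
proof -
  have "place_slot (relabelled T \<beta> p t) i = relabel \<beta> (place_slot (p t) i)"
    if "t \<in> T" "i \<in> {1..r + m}" for t i
    using that by (auto simp: place_slot_def relabelled_def)
  then have "place_slot (relabelled T \<beta> p t) ` e = relabel \<beta> ` place_slot (p t) ` e" if "t \<in> T" "e \<in> E" for t e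
    using that edgeD(1)[of e] unfolding image_image by (intro image_cong refl) blast
  then show ?thesis by (auto simp: fam_edges_def copy_edges_def image_UN image_image)
qed

section \<open>Connected families and the decomposition into components\<close>

text \<open>Connectedness is phrased by cuts instead of paths: a cut directly supplies the next row
  when rows are added one by one, and a missing overlap directly supplies a factorisation.\<close>

definition connected_family :: "nat set \<Rightarrow> nat \<Rightarrow> (nat \<Rightarrow> nat \<Rightarrow> nat) \<Rightarrow> bool" where
  "connected_family T t0 p \<longleftrightarrow> t0 \<in> T \<and>
     (\<forall>S. S \<subset> T \<longrightarrow> t0 \<in> S \<longrightarrow> fam_labels S p \<inter> fam_labels (T - S) p \<noteq> {})"

definition connected_reps :: "nat set \<Rightarrow> nat \<Rightarrow> (nat \<Rightarrow> nat \<Rightarrow> nat) set" where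
  "connected_reps T t0 = {p \<in> reps T. connected_family T t0 p}"

lemma fam_labels_cong: "(\<And>t. t \<in> T \<Longrightarrow> p t = q t) \<Longrightarrow> fam_labels T p = fam_labels T q"
  by (simp add: fam_labels_def)

lemma fam_edges_cong: "(\<And>t. t \<in> T \<Longrightarrow> p t = q t) \<Longrightarrow> fam_edges T p = fam_edges T q"
  by (simp add: fam_edges_def)

lemma fam_labels_mono: "S \<subseteq> T \<Longrightarrow> fam_labels S p \<subseteq> fam_labels T p"
  by (auto simp: fam_labels_def)

lemma connected_family_cong:
  assumes "\<And>t. t \<in> T \<Longrightarrow> p t = q t" shows "connected_family T t0 p = connected_family T t0 q"
proof -
  have "fam_labels S p = fam_labels S q" if "S \<subseteq> T" for S
    using that assms by (intro fam_labels_cong) auto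
  then show ?thesis unfolding connected_family_def
    by (metis (no_types, lifting) Diff_subset psubset_imp_subset)
qed

text \<open>The component is a smallest set of rows around \<open>t0\<close> sharing no label with
  the other rows; a cut without common label would yield a smaller one.\<close>

lemma component_exists:
  assumes T: "finite T" "t0 \<in> T"
  obtains A where "A \<subseteq> T" "connected_family A t0 p" "fam_labels A p \<inter> fam_labels (T - A) p = {}"
proof -
  let ?P = "\<lambda>A. A \<subseteq> T \<and> t0 \<in> A \<and> fam_labels A p \<inter> fam_labels (T - A) p = {}"
  have "?P T" using T by (simp add: fam_labels_def)
  then obtain A where A: "?P A" and min: "\<And>B. ?P B \<Longrightarrow> card A \<le> card B"
    using ex_has_least_nat[of ?P T card] by metis
  have "fam_labels S p \<inter> fam_labels (A - S) p \<noteq> {}" if S: "S \<subset> A" "t0 \<in> S" for S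
  proof
    assume *: "fam_labels S p \<inter> fam_labels (A - S) p = {}"
    have "T - S = (A - S) \<union> (T - A)" using S A by auto
    then have "fam_labels (T - S) p = fam_labels (A - S) p \<union> fam_labels (T - A) p"
      by (auto simp: fam_labels_def)
    moreover have "fam_labels S p \<subseteq> fam_labels A p" using S by (intro fam_labels_mono) auto
    ultimately have "?P S" using A S * by auto
    moreover have "card S < card A" using S A T by (intro psubset_card_mono) (auto intro: finite_subset)
    ultimately show False using min[of S] by simp
  qed
  then show ?thesis using that A by (auto simp: connected_family_def)
qed

text \<open>Otherwise \<open>A \<inter> B\<close> would be a cut of \<open>A\<close> without common
  label. Applied in both directions, this makes the component unique.\<close>

lemma component_subset:
  assumes A: "A \<subseteq> T" "connected_family A t0 p"
    and B: "B \<subseteq> T" "t0 \<in> B" "fam_labels B p \<inter> fam_labels (T - B) p = {}"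
  shows "A \<subseteq> B"
proof (rule ccontr)
  assume "\<not> A \<subseteq> B"
  then have "A \<inter> B \<subset> A" by auto
  then have "fam_labels (A \<inter> B) p \<inter> fam_labels (A - A \<inter> B) p \<noteq> {}"
    using A B by (auto simp: connected_family_def)
  moreover have "fam_labels (A \<inter> B) p \<subseteq> fam_labels B p" "fam_labels (A - A \<inter> B) p \<subseteq> fam_labels (T - B) p"
    using A by (auto intro!: fam_labels_mono)
  ultimately show False using B by blast
qed

definition merge_rows :: "nat set \<Rightarrow> (nat \<Rightarrow> nat \<Rightarrow> nat) \<Rightarrow> nat set \<Rightarrow> (nat \<Rightarrow> nat \<Rightarrow> nat) \<Rightarrow> nat \<Rightarrow> nat \<Rightarrow> nat" where
  "merge_rows A p B q = (\<lambda>t\<in>A \<union> B. if t \<in> A then p t else q t)"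

text \<open>Canonical labels remember the rows they come from. Hence canonical families on disjoint
  sets of rows have disjoint labels and can be merged without relabelling.\<close>

lemma reps_labels_codes:
  assumes "p \<in> reps A" "l \<in> fam_labels A p" shows "fst (prod_decode l) \<in> A"
proof -
  obtain t i where ti: "t \<in> A" "i \<in> {1..r}" "l = p t i" using assms by (auto simp: fam_labels_def)
  have "p t i = rep A p t i" using assms by (simp add: reps_def)
  then show ?thesis using rep_code[OF ti(1,2), of p] ti by (metis fst_conv prod_encode_inverse)
qed

text \<open>All slots carrying a label of a row in \<open>A\<close> lie in \<open>A\<close>, so the
  search for the least code is not affected by \<open>B\<close>.\<close>

lemma rep_union:
  assumes dis: "fam_labels A p \<inter> fam_labels B p = {}" and t: "t \<in> A"
  shows "rep (A \<union> B) p t = rep A p t"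
proof -
  have "(\<exists>t'\<in>A \<union> B. \<exists>i'\<in>{1..r}. k = prod_encode (t', i') \<and> p t' i' = p t i) \<longleftrightarrow>
    (\<exists>t'\<in>A. \<exists>i'\<in>{1..r}. k = prod_encode (t', i') \<and> p t' i' = p t i)" if i: "i \<in> {1..r}" for i k
  proof -
    have "p t' i' \<noteq> p t i" if "t' \<in> B" "i' \<in> {1..r}" for t' i'
    proof -
      have "p t' i' \<in> fam_labels B p" "p t i \<in> fam_labels A p"
        unfolding fam_labels_def using that t i by blast+
      then show ?thesis using dis by (metis disjoint_iff)
    qed
    then show ?thesis by blast
  qed
  then show ?thesis using t by (auto simp: rep_def intro!: restrict_ext)
qed

lemma rep_restrict_rows: "(\<And>t. t \<in> A \<Longrightarrow> p t = q t) \<Longrightarrow> rep A p = rep A q"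
  by (rule rep_cong) simp

lemma reps_restrict:
  assumes p: "p \<in> reps (A \<union> B)" and dis: "fam_labels A p \<inter> fam_labels B p = {}"
  shows "restrict p A \<in> reps A"
proof -
  have "rep A (restrict p A) = rep A p" by (rule rep_restrict_rows) simp
  also have "\<dots> = restrict p A"
  proof
    fix t show "rep A p t = restrict p A t"
    proof (cases "t \<in> A")
      case True
      then have "rep A p t = rep (A \<union> B) p t" using dis by (simp add: rep_union)
      then show ?thesis using p True by (simp add: reps_def)
    qed (simp add: rep_def)
  qed
  finally show ?thesis using p by (auto simp: reps_def families_def)
qed

lemma merge_rows:
  assumes p: "p \<in> reps A" and q: "q \<in> reps B" and AB: "A \<inter> B = {}"
  shows "merge_rows A p B q \<in> reps (A \<union> B)"
    "fam_labels A (merge_rows A p B q) \<inter> fam_labels B (merge_rows A p B q) = {}"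
    "restrict (merge_rows A p B q) A = p" "restrict (merge_rows A p B q) B = q"
proof -
  let ?s = "merge_rows A p B q"
  have sA: "?s t = p t" if "t \<in> A" for t using that by (simp add: merge_rows_def)
  have sB: "?s t = q t" if "t \<in> B" for t using that AB by (auto simp: merge_rows_def)
  have pf: "p \<in> families A" and qf: "q \<in> families B" using p q by (auto simp: reps_def)
  show rA: "restrict ?s A = p" using pf sA by (auto simp: families_def PiE_def extensional_def fun_eq_iff)
  show rB: "restrict ?s B = q" using qf sB by (auto simp: families_def PiE_def extensional_def fun_eq_iff)
  have lA: "fam_labels A ?s = fam_labels A p" using sA by (rule fam_labels_cong)
  have lB: "fam_labels B ?s = fam_labels B q" using sB by (rule fam_labels_cong)
  show dis: "fam_labels A ?s \<inter> fam_labels B ?s = {}"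
    unfolding lA lB using reps_labels_codes[OF p] reps_labels_codes[OF q] AB by blast
  have "rep (A \<union> B) ?s = ?s"
  proof
    fix t consider "t \<in> A" | "t \<in> B" | "t \<notin> A \<union> B" by blast
    then show "rep (A \<union> B) ?s t = ?s t"
    proof cases
      case 1
      then have "rep (A \<union> B) ?s t = rep A ?s t" using dis by (rule rep_union[rotated])
      also have "rep A ?s = rep A p" using sA by (rule rep_restrict_rows)
      finally show ?thesis using p 1 sA by (simp add: reps_def)
    next
      case 2
      then have "rep (B \<union> A) ?s t = rep B ?s t" using dis by (intro rep_union) auto
      also have "rep B ?s = rep B q" using sB by (rule rep_restrict_rows)
      finally show ?thesis using q 2 sB by (simp add: reps_def Un_commute)
    next
      case 3 then show ?thesis by (auto simp: rep_def merge_rows_def)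
    qed
  qed
  then show "?s \<in> reps (A \<union> B)"
    using pf qf by (auto simp: reps_def families_def merge_rows_def)
qed

text \<open>A pattern splits uniquely into the component \<open>A\<close> of \<open>t0\<close> and a
  pattern on the remaining rows, and both parts can be prescribed freely. About the weight it is
  only used that it is local in the rows and multiplicative over disjoint labels.\<close>

lemma sum_reps_components:
  fixes w :: "nat set \<Rightarrow> (nat \<Rightarrow> nat \<Rightarrow> nat) \<Rightarrow> real"
  assumes T: "finite T" "t0 \<in> T"
    and w_cong: "\<And>A p q. A \<subseteq> T \<Longrightarrow> (\<And>t. t \<in> A \<Longrightarrow> p t = q t) \<Longrightarrow> w A p = w A q"
    and w_mult: "\<And>A p. A \<subseteq> T \<Longrightarrow> p \<in> reps T \<Longrightarrow> fam_labels A p \<inter> fam_labels (T - A) p = {} \<Longrightarrow>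
      w T p = w A p * w (T - A) p"
  shows "(\<Sum>p\<in>reps T. w T p) =
    (\<Sum>A\<in>{A. A \<subseteq> T \<and> t0 \<in> A}. (\<Sum>p\<in>connected_reps A t0. w A p) * (\<Sum>q\<in>reps (T - A). w (T - A) q))"
proof -
  let ?I = "{A. A \<subseteq> T \<and> t0 \<in> A}"
  define S where "S = (SIGMA A:?I. connected_reps A t0 \<times> reps (T - A))"
  define g where "g = (\<lambda>(A, p, q). merge_rows A p (T - A) q)"
  have finA: "finite A" if "A \<in> ?I" for A using that T finite_subset by blast
  have S: "g (A, p, q) \<in> reps T" "fam_labels A (g (A, p, q)) \<inter> fam_labels (T - A) (g (A, p, q)) = {}"
     "restrict (g (A, p, q)) A = p" "restrict (g (A, p, q)) (T - A) = q" "connected_family A t0 (g (A, p, q))"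
    "w T (g (A, p, q)) = w A p * w (T - A) q"
    if apq: "(A, p, q) \<in> S" for A p q
  proof -
    have A: "A \<subseteq> T" "t0 \<in> A" and p: "p \<in> reps A" "connected_family A t0 p" and q: "q \<in> reps (T - A)"
      using apq by (auto simp: S_def connected_reps_def)
    have TT: "A \<union> (T - A) = T" using A by auto
    note mr = merge_rows[OF p(1) q, unfolded TT]
    show 1: "g (A, p, q) \<in> reps T" "fam_labels A (g (A, p, q)) \<inter> fam_labels (T - A) (g (A, p, q)) = {}"
      "restrict (g (A, p, q)) A = p" "restrict (g (A, p, q)) (T - A) = q"
      using mr by (auto simp: g_def)
    have eA: "p t = g (A, p, q) t" if "t \<in> A" for t using that by (simp add: g_def merge_rows_def)
    have eB: "q t = g (A, p, q) t" if "t \<in> T - A" for t using that by (simp add: g_def merge_rows_def)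
    show "connected_family A t0 (g (A, p, q))" using p(2) connected_family_cong[OF eA] by simp
    have "w A p = w A (g (A, p, q))" by (rule w_cong[OF A(1) eA])
    moreover have "w (T - A) q = w (T - A) (g (A, p, q))" by (rule w_cong[OF _ eB]) auto
    ultimately show "w T (g (A, p, q)) = w A p * w (T - A) q"
      using w_mult[OF A(1) 1(1,2)] by simp
  qed
  have "bij_betw g S (reps T)"
    unfolding bij_betw_def
  proof
    show "inj_on g S"
    proof (rule inj_onI)
      fix u v assume u: "u \<in> S" and v: "v \<in> S" and eq: "g u = g v"
      obtain A p q where u': "u = (A, p, q)" by (cases u)
      obtain B p' q' where v': "v = (B, p', q')" by (cases v)
      note Su = S[OF u[unfolded u']] note Sv = S[OF v[unfolded v']]
      have AT: "A \<subseteq> T" "t0 \<in> A" "B \<subseteq> T" "t0 \<in> B" using u v u' v' by (auto simp: S_def)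
      have gg: "g (B, p', q') = g (A, p, q)" using eq u' v' by simp
      \<comment> \<open>Both sets are the component of \<open>t0\<close> in the same merged
        family.\<close>
      have "A \<subseteq> B" "B \<subseteq> A"
        using component_subset[OF AT(1) Su(5) AT(3,4)] component_subset[OF AT(3) Sv(5) AT(1,2)] Su(2) Sv(2) gg by auto
      then have "A = B" by simp
      then show "u = v" using Su(3,4) Sv(3,4) gg u' v' by simp
    qed
    show "g ` S = reps T"
    proof
      show "g ` S \<subseteq> reps T" using S(1) by auto
      show "reps T \<subseteq> g ` S"
      proof
        fix p assume p: "p \<in> reps T"
        obtain A where A: "A \<subseteq> T" "connected_family A t0 p" and dis: "fam_labels A p \<inter> fam_labels (T - A) p = {}"
          using component_exists[OF T] .
        have TT: "A \<union> (T - A) = T" "(T - A) \<union> A = T" using A by auto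
        have "restrict p A \<in> reps A" using reps_restrict[of p A "T - A"] p dis TT by simp
        moreover have "restrict p (T - A) \<in> reps (T - A)"
          using reps_restrict[of p "T - A" A] p dis TT by (simp add: Int_commute)
        moreover have "connected_family A t0 (restrict p A)"
          using A(2) connected_family_cong[of A p "restrict p A" t0] by simp
        moreover have "t0 \<in> A" using A by (simp add: connected_family_def)
        ultimately have "(A, restrict p A, restrict p (T - A)) \<in> S"
          using A by (simp add: S_def connected_reps_def)
        moreover have "g (A, restrict p A, restrict p (T - A)) = p"
        proof
          fix t show "g (A, restrict p A, restrict p (T - A)) t = p t"
            using p A TT by (cases "t \<in> T") (auto simp: g_def merge_rows_def reps_def families_def PiE_def extensional_def)
        qed
        ultimately show "p \<in> g ` S" by (metis imageI)
      qed
    qed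
  qed
  then have "(\<Sum>p\<in>reps T. w T p) = (\<Sum>u\<in>S. w T (g u))"
    by (rule sum.reindex_bij_betw[symmetric])
  also have "\<dots> = (\<Sum>(A, p, q)\<in>S. w A p * w (T - A) q)"
    by (intro sum.cong refl) (auto simp: S)
  also have "\<dots> = (\<Sum>A\<in>?I. \<Sum>(p, q)\<in>connected_reps A t0 \<times> reps (T - A). w A p * w (T - A) q)"
    unfolding S_def
  proof (subst sum.Sigma)
    show "\<forall>A\<in>?I. finite (connected_reps A t0 \<times> reps (T - A))"
    proof (intro ballI finite_cartesian_product)
      fix A assume A: "A \<in> ?I"
      show "finite (connected_reps A t0)"
        by (rule finite_subset[OF _ finite_reps[OF finA[OF A]]]) (auto simp: connected_reps_def)
      show "finite (reps (T - A))" using T by (simp add: finite_reps)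
    qed
  qed (use T in auto)
  also have "\<dots> = (\<Sum>A\<in>?I. (\<Sum>p\<in>connected_reps A t0. w A p) * (\<Sum>q\<in>reps (T - A). w (T - A) q))"
    by (simp add: sum_product sum.cartesian_product)
  finally show ?thesis .
qed

text \<open>The rows are added one by one, each overlapping the previous ones in a non-empty set \<open>W\<close> of slots.\<close>

lemma connected_family_bound:
  fixes l c D :: real
  assumes l: "l > 0" and c: "0 < c" "c < 1" and D: "D > 0"
    and W: "\<And>W. W \<subseteq> {1..r} \<Longrightarrow> W \<noteq> {} \<Longrightarrow> D \<le> l ^ card W * c ^ card (closed_edges W)"
    and T: "finite T" and p: "p \<in> families T" and conn: "connected_family T t0 p"
  shows "l ^ card (fam_labels T p) * c ^ card (fam_edges T p) \<le> (l ^ r * c ^ card E) ^ card T / D ^ (card T - 1)"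
proof -
  let ?b = "l ^ r * c ^ card E"
  have t0: "t0 \<in> T" using conn by (simp add: connected_family_def)
  have lm: "p t \<in> label_maps {1..r}" if "t \<in> T" for t by (rule familiesD[OF p that])
  have "\<exists>S\<subseteq>T. t0 \<in> S \<and> card S = k \<and> l ^ card (fam_labels S p) * c ^ card (fam_edges S p) \<le> ?b ^ k / D ^ (k - 1)"
    if "1 \<le> k" "k \<le> card T" for k
    using that
  proof (induction k rule: dec_induct)
    case base
    have "card (p t0 ` {1..r}) = r" using lm[OF t0] by (simp add: card_image label_maps_def)
    then show ?case using t0 copy_edges(2)[OF lm[OF t0]]
      by (intro exI[of _ "{t0}"]) (simp add: fam_labels_def fam_edges_def)
  next
    case (step k)
    then obtain S where S: "S \<subseteq> T" "t0 \<in> S" "card S = k"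
      and le: "l ^ card (fam_labels S p) * c ^ card (fam_edges S p) \<le> ?b ^ k / D ^ (k - 1)" by auto
    have "S \<subset> T" using S step.prems by auto
    then have "fam_labels S p \<inter> fam_labels (T - S) p \<noteq> {}" using conn S by (simp add: connected_family_def)
    then obtain b where b: "b \<in> fam_labels (T - S) p" "b \<in> fam_labels S p" by blast
    from b(1) obtain t i where "t \<in> T - S" "i \<in> {1..r}" "b = p t i"
      unfolding fam_labels_def by blast
    with b(2) have t: "t \<in> T - S" "i \<in> {1..r}" "p t i \<in> fam_labels S p" by auto
    \<comment> \<open>The slots of the new row whose labels occur already; the cut condition makes
      this set non-empty.\<close>
    define W where "W = {i \<in> {1..r}. p t i \<in> fam_labels S p}"
    have W1: "W \<subseteq> {1..r}" "W \<noteq> {}" using t by (auto simp: W_def)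
    have tT: "t \<in> T" using t by simp
    note lt = lm[OF tT]
    have injt: "inj_on (p t) {1..r}" using lt by (simp add: label_maps_def)
    have finS: "finite S" using S T finite_subset by blast
    have pS: "restrict p S \<in> families S" using p S by (auto simp: families_def)
    have "fam_edges S (restrict p S) = fam_edges S p" "fam_labels S (restrict p S) = fam_labels S p"
      by (auto intro!: fam_edges_cong fam_labels_cong)
    note fS = fam_edges[OF finS pS, unfolded this]
    have cW: "card W \<le> r" using card_mono[OF _ W1(1)] by simp
    have labels: "card (fam_labels (insert t S) p) = card (fam_labels S p) + (r - card W)"
    proof -
      have "fam_labels (insert t S) p = fam_labels S p \<union> p t ` ({1..r} - W)"
        by (auto simp: fam_labels_def W_def)
      moreover have "fam_labels S p \<inter> p t ` ({1..r} - W) = {}" by (auto simp: W_def)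
      moreover have "card (p t ` ({1..r} - W)) = card ({1..r} - W)"
        by (rule card_image) (rule inj_on_subset[OF injt], auto)
      moreover have "card ({1..r} - W) = r - card W"
        using W1 by (subst card_Diff_subset) (auto intro: finite_subset)
      ultimately show ?thesis using fS(2) by (simp add: card_Un_disjoint)
    qed
    \<comment> \<open>An edge of the new copy outside \<open>closed_edges W\<close> contains a label
      not seen before, so it is a new edge. The inequality suffices, because further edges only
      lower the weight when \<open>c < 1\<close>.\<close>
    have edges: "card (fam_edges S p) + (card E - card (closed_edges W)) \<le> card (fam_edges (insert t S) p)"
    proof -
      let ?N = "(\<lambda>e. place_slot (p t) ` e) ` (E - closed_edges W)"
      have "fam_edges S p \<union> ?N \<subseteq> fam_edges (insert t S) p" by (auto simp: fam_edges_def copy_edges_def)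
      moreover have "finite (fam_edges (insert t S) p)"
        using fS(1) finite_E by (simp add: fam_edges_def copy_edges_def)
      moreover have "fam_edges S p \<inter> ?N = {}"
      proof (rule ccontr)
        assume "fam_edges S p \<inter> ?N \<noteq> {}"
        then obtain e where e: "e \<in> E" "e \<notin> closed_edges W" "place_slot (p t) ` e \<in> fam_edges S p" by auto
        then have "\<not> e \<inter> {1..r} \<subseteq> W" by (simp add: closed_edges_def)
        then obtain j where j: "j \<in> e" "j \<in> {1..r}" "j \<notin> W" by blast
        then have "Poi (p t j) \<in> place_slot (p t) ` e" by (metis imageI place_slot_simps atLeastAtMost_iff)
        then have "Poi (p t j) \<in> \<Union>(fam_edges S p)" using e by blast
        then have "p t j \<in> fam_labels S p" using fS(4) by auto
        then show False using j by (simp add: W_def)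
      qed
      moreover have "card ?N = card (E - closed_edges W)"
        by (rule card_image) (rule inj_on_subset[OF inj_copy[OF lt]], auto)
      moreover have "card (E - closed_edges W) = card E - card (closed_edges W)"
        using finite_E by (intro card_Diff_subset) (auto simp: closed_edges_def)
      ultimately show ?thesis using fS(1) finite_E
        by (metis card_Un_disjoint card_mono finite_Diff finite_imageI)
    qed
    have ce: "card (closed_edges W) \<le> card E" using finite_E by (intro card_mono) (auto simp: closed_edges_def)
    let ?d = "l ^ card W * c ^ card (closed_edges W)"
    have d: "?d > 0" using l c by simp
    have "l ^ card (fam_labels (insert t S) p) * c ^ card (fam_edges (insert t S) p)
      \<le> l ^ card (fam_labels (insert t S) p) * c ^ (card (fam_edges S p) + (card E - card (closed_edges W)))"
      using edges l c by (intro mult_left_mono power_decreasing) auto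
    \<comment> \<open>The new row contributes the cost of a full copy divided by the cost of its
      overlap.\<close>
    also have "\<dots> = (l ^ card (fam_labels S p) * c ^ card (fam_edges S p)) * (?b / ?d)"
      using l c cW ce by (simp add: labels power_add power_diff)
    also have "\<dots> \<le> (?b ^ k / D ^ (k - 1)) * (?b / D)"
      using le W[OF W1] l c D d by (intro mult_mono divide_left_mono) auto
    also have "\<dots> = ?b ^ Suc k / D ^ (Suc k - 1)"
      using step.hyps by (cases k) (auto simp: field_simps)
    finally show ?case using S t tT finS by (intro exI[of _ "insert t S"]) auto
  qed
  moreover have "1 \<le> card T" using t0 T by (metis card_gt_0_iff empty_iff Suc_leI One_nat_def)
  ultimately obtain S where "S \<subseteq> T" "card S = card T"
    "l ^ card (fam_labels S p) * c ^ card (fam_edges S p) \<le> ?b ^ card T / D ^ (card T - 1)"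
    by blast
  moreover from this have "S = T" using T card_subset_eq by blast
  ultimately show ?thesis by simp
qed

end

section \<open>The method of moments\<close>

text \<open>In terms of exponential generating functions the hypothesis is \<open>F' = K' F\<close>, and centring
  multiplies \<open>F\<close> by \<open>exp (- K 1 X)\<close>.\<close>

lemma central_moment_recursion:
  fixes mom K :: "nat \<Rightarrow> real"
  assumes mom: "\<And>n. mom (Suc n) = (\<Sum>k\<le>n. real (n choose k) * K (Suc k) * mom (n - k))"
  defines "cm \<equiv> \<lambda>n. \<Sum>k\<le>n. real (n choose k) * (- K 1) ^ k * mom (n - k)"
  shows "cm (Suc n) = (\<Sum>k\<in>{1..n}. real (n choose k) * K (Suc k) * cm (n - k))"
proof -
  define F where "F = Abs_fps (\<lambda>n. mom n / fact n)"
  define Kd where "Kd = Abs_fps (\<lambda>n. K (Suc n) / fact n)"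
  define H where "H = fps_exp (- K 1) * F"
  have choose: "real (n choose k) = fact n / (fact k * fact (n - k))" if "k \<le> n" for n k
    using that by (rule binomial_fact)
  have dF: "fps_deriv F = Kd * F"
  proof (rule fps_ext)
    fix n
    have "fps_nth (fps_deriv F) n = mom (Suc n) / fact n"
      by (simp add: F_def divide_simps del: of_nat_Suc)
    also have "\<dots> = (\<Sum>k\<le>n. K (Suc k) / fact k * (mom (n - k) / fact (n - k)))"
      unfolding mom sum_divide_distrib by (intro sum.cong refl) (simp add: choose)
    also have "\<dots> = fps_nth (Kd * F) n"
      by (simp add: fps_mult_nth Kd_def F_def atLeast0AtMost)
    finally show "fps_nth (fps_deriv F) n = fps_nth (Kd * F) n" .
  qed
  have H: "fps_nth H n = cm n / fact n" for n
    unfolding H_def fps_mult_nth cm_def sum_divide_distrib F_def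
    by (auto simp: atLeast0AtMost choose intro!: sum.cong)
  have dH: "fps_deriv H = (Kd - fps_const (K 1)) * H"
    unfolding H_def by (simp add: dF algebra_simps fps_const_neg[symmetric] del: fps_const_neg)
  have "cm (Suc n) / fact n = fps_nth (fps_deriv H) n" by (simp add: H divide_simps del: of_nat_Suc)
  also have "\<dots> = (\<Sum>k\<le>n. fps_nth (Kd - fps_const (K 1)) k * fps_nth H (n - k))"
    unfolding dH by (simp add: fps_mult_nth atLeast0AtMost)
  also have "\<dots> = (\<Sum>k\<in>insert 0 {1..n}. fps_nth (Kd - fps_const (K 1)) k * fps_nth H (n - k))"
    by (intro sum.cong) auto
  \<comment> \<open>Centring removes the constant coefficient \<open>K 1\<close> of
    \<open>Kd\<close>, so the term at 0 vanishes and the sum starts at 1.\<close>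
  also have "\<dots> = (\<Sum>k\<in>{1..n}. K (Suc k) / fact k * (cm (n - k) / fact (n - k)))"
    by (subst sum.insert) (auto simp: Kd_def H fps_const_def intro!: sum.cong)
  also have "\<dots> = (\<Sum>k\<in>{1..n}. real (n choose k) * K (Suc k) * cm (n - k)) / fact n"
    unfolding sum_divide_distrib by (intro sum.cong refl) (simp add: choose)
  finally show ?thesis by simp
qed

text \<open>This is what \<open>central_moment_recursion\<close> becomes when the second cumulant is
  1 and all higher ones vanish.\<close>

fun gauss_moment :: "nat \<Rightarrow> real" where
  "gauss_moment 0 = 1"
| "gauss_moment (Suc 0) = 0"
| "gauss_moment (Suc (Suc n)) = real (Suc n) * gauss_moment n"

lemma gauss_moment_odd: "odd n \<Longrightarrow> gauss_moment n = 0"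
  by (induction n rule: gauss_moment.induct) auto

lemma gauss_moment_even: "gauss_moment (2 * k) = fact (2 * k) / (2 ^ k * fact k)"
proof (induction k)
  case (Suc k)
  have "gauss_moment (2 * Suc k) = real (Suc (2 * k)) * (fact (2 * k) / (2 ^ k * fact k))"
    using Suc by simp
  also have "\<dots> = fact (2 * Suc k) / (2 ^ Suc k * fact (Suc k))"
    by (simp add: divide_simps)
  finally show ?case .
qed simp

lemma std_normal_moment: "(LINT x|std_normal_distribution. x ^ n) = gauss_moment n"
proof (cases "even n")
  case True
  then obtain k where "n = 2 * k" by auto
  then show ?thesis by (simp add: std_normal_distribution_even_moments gauss_moment_even)
next
  case False
  then obtain k where "n = 2 * k + 1" by (auto elim: oddE)
  then show ?thesis
    using integral_std_normal_distribution_moment_odd[of n] False by (simp add: gauss_moment_odd)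
qed

lemma std_normal_integrable_moment: "integrable std_normal_distribution (\<lambda>x. x ^ n)"
proof (cases "even n")
  case True
  then obtain k where "n = 2 * k" by auto
  then show ?thesis using std_normal_distribution_even_moments by simp
next
  case False
  then obtain k where k: "n = 2 * k + 1" by (auto elim: oddE)
  show ?thesis
    using std_normal_moment_odd[of k] unfolding k
    by (subst integrable_density) (auto simp: normal_density_nonneg intro: integrable.intros)
qed

text \<open>After division by the power of the standard deviation the recursion passes to the limit
  term by term. Only \<open>k = 1\<close> survives, the term of the second cumulant.\<close>

lemma gaussian_moment_limit:
  fixes cm K :: "'i \<Rightarrow> nat \<Rightarrow> real"
  assumes cm0: "\<And>i. cm i 0 = 1"
    and rec: "\<And>i n. cm i (Suc n) = (\<Sum>k\<in>{1..n}. real (n choose k) * K i (Suc k) * cm i (n - k))"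
    and V: "\<forall>\<^sub>F i in F. K i 2 > 0"
    and K: "\<And>n. n \<ge> 3 \<Longrightarrow> ((\<lambda>i. K i n / sqrt (K i 2) ^ n) \<longlongrightarrow> 0) F"
  shows "((\<lambda>i. cm i n / sqrt (K i 2) ^ n) \<longlongrightarrow> gauss_moment n) F"
proof (induction n rule: less_induct)
  case (less n)
  show ?case
  proof (cases n)
    case 0 then show ?thesis by (simp add: cm0)
  next
    case (Suc j)
    let ?s = "\<lambda>i. sqrt (K i 2)"
    have K2: "((\<lambda>i. K i 2 / ?s i ^ 2) \<longlongrightarrow> 1) F"
      using V by (intro tendsto_eventually, eventually_elim) simp
    have Kl: "((\<lambda>i. K i (Suc k) / ?s i ^ Suc k) \<longlongrightarrow> (if k = 1 then 1 else 0)) F" if "k \<ge> 1" for k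
      using K[of "Suc k"] K2 that by (cases "k = 1") (auto simp: numeral_2_eq_2)
    have eq: "\<forall>\<^sub>F i in F. (\<Sum>k\<in>{1..j}. real (j choose k) * (K i (Suc k) / ?s i ^ Suc k) * (cm i (j - k) / ?s i ^ (j - k)))
      = cm i n / ?s i ^ n"
      using V
    proof eventually_elim
      case (elim i)
      have pw: "?s i ^ n = ?s i ^ Suc k * ?s i ^ (j - k)" if "k \<in> {1..j}" for k
        using that by (simp add: Suc power_add[symmetric])
      then show ?case unfolding rec Suc sum_divide_distrib
      proof (intro sum.cong refl)
        fix k assume k: "k \<in> {1..j}"
        show "real (j choose k) * (K i (Suc k) / ?s i ^ Suc k) * (cm i (j - k) / ?s i ^ (j - k))
          = real (j choose k) * K i (Suc k) * cm i (j - k) / ?s i ^ Suc j"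
          unfolding pw[OF k, unfolded Suc] by simp
      qed
    qed
    have "((\<lambda>i. \<Sum>k\<in>{1..j}. real (j choose k) * (K i (Suc k) / ?s i ^ Suc k) * (cm i (j - k) / ?s i ^ (j - k)))
      \<longlongrightarrow> (\<Sum>k\<in>{1..j}. real (j choose k) * (if k = 1 then 1 else 0) * gauss_moment (j - k))) F"
      using Suc by (intro tendsto_sum tendsto_mult tendsto_const Kl less) auto
    moreover have "(\<Sum>k\<in>{1..j}. real (j choose k) * (if k = 1 then 1 else 0) * gauss_moment (j - k)) = gauss_moment n"
    proof (cases j)
      case 0 then show ?thesis by (simp add: Suc)
    next
      case (Suc j')
      have "(\<Sum>k\<in>{1..j}. real (j choose k) * (if k = 1 then 1 else 0) * gauss_moment (j - k))
        = (\<Sum>k\<in>{1..j}. if k = 1 then real (j choose k) * gauss_moment (j - k) else 0)"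
        by (intro sum.cong) auto
      then show ?thesis using Suc \<open>n = Suc j\<close> by simp
    qed
    ultimately show ?thesis using eq by (simp add: tendsto_cong)
  qed
qed

text \<open>Characteristic functions are compared through their Taylor polynomials. Convergence of
  moments settles the polynomials; the remainders are controlled by the moment of order
  \<open>2 * j\<close>, whose Gaussian value is small enough against \<open>fact (2 * j)\<close> for
  the bound to vanish as \<open>j\<close> grows.\<close>

lemma gaussian_method_of_moments:
  assumes D: "\<And>n. real_distribution (D n)" and int: "\<And>n k. integrable (D n) (\<lambda>x. x ^ k)"
    and lim: "\<And>k. (\<lambda>n. LINT x|D n. x ^ k) \<longlonglongrightarrow> gauss_moment k"
  shows "weak_conv_m D std_normal_distribution"
proof (rule levy_continuity[OF D])
  show N: "real_distribution std_normal_distribution" by (rule real_dist_normal_dist)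
  fix t
  let ?N = std_normal_distribution
  \<comment> \<open>The order is even so that the absolute moment in the remainder of
    \<open>char_approx1\<close> is an ordinary moment, covered by \<open>lim\<close>.\<close>
  let ?b = "\<lambda>j n. (\<Sum>k\<le>2 * j. \<bar>t\<bar> ^ k / fact k * \<bar>(LINT x|D n. x ^ k) - gauss_moment k\<bar>)
      + (2 * \<bar>t\<bar> ^ (2 * j) / fact (2 * j)) * ((LINT x|D n. x ^ (2 * j)) + gauss_moment (2 * j))"
  have bound: "cmod (char (D n) t - char ?N t) \<le> ?b j n" for n j
  proof -
    interpret Dn: real_distribution "D n" by (rule D)
    interpret N: real_distribution ?N by (rule N)
    let ?P = "\<lambda>Q::real measure. \<Sum>k\<le>2 * j. ((\<i> * t) ^ k / fact k) * complex_of_real (LINT x|Q. x ^ k)"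
    have 1: "cmod (char (D n) t - ?P (D n)) \<le> (2 * \<bar>t\<bar> ^ (2 * j) / fact (2 * j)) * (LINT x|D n. x ^ (2 * j))"
      using Dn.char_approx1[of "2 * j" t] int by (simp add: power_even_abs)
    have 2: "cmod (char ?N t - ?P ?N) \<le> (2 * \<bar>t\<bar> ^ (2 * j) / fact (2 * j)) * gauss_moment (2 * j)"
      using N.char_approx1[of "2 * j" t] std_normal_integrable_moment std_normal_moment[of "2 * j"]
      by (simp add: power_even_abs)
    have "cmod (?P (D n) - ?P ?N) \<le> (\<Sum>k\<le>2 * j. \<bar>t\<bar> ^ k / fact k * \<bar>(LINT x|D n. x ^ k) - gauss_moment k\<bar>)"
    proof -
      have "?P (D n) - ?P ?N = (\<Sum>k\<le>2 * j. ((\<i> * t) ^ k / fact k) * of_real ((LINT x|D n. x ^ k) - gauss_moment k))"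
        by (simp add: sum_subtractf[symmetric] std_normal_moment right_diff_distrib)
      also have "cmod \<dots> \<le> (\<Sum>k\<le>2 * j. cmod (((\<i> * t) ^ k / fact k) * of_real ((LINT x|D n. x ^ k) - gauss_moment k)))"
        by (rule norm_sum)
      finally show ?thesis by (simp add: norm_mult norm_divide norm_power del: of_real_diff)
    qed
    then have "cmod ((char (D n) t - ?P (D n)) + (?P (D n) - ?P ?N) - (char ?N t - ?P ?N)) \<le> ?b j n"
      using 1 2 norm_triangle_ineq[of "char (D n) t - ?P (D n)" "?P (D n) - ?P ?N"]
       norm_triangle_ineq4[of "(char (D n) t - ?P (D n)) + (?P (D n) - ?P ?N)" "char ?N t - ?P ?N"]
      by (simp only: distrib_left)
    then show ?thesis by simp
  qed
  have tail: "2 * \<bar>t\<bar> ^ (2 * j) / fact (2 * j) * (gauss_moment (2 * j) + gauss_moment (2 * j)) = 4 * ((t\<^sup>2 / 2) ^ j / fact j)" for j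
    by (simp add: gauss_moment_even power_mult power_divide)
  have b_lim: "(\<lambda>n. ?b j n) \<longlonglongrightarrow> 4 * ((t\<^sup>2 / 2) ^ j / fact j)" for j
  proof -
    have "(\<lambda>n. ?b j n) \<longlonglongrightarrow> (\<Sum>k\<le>2 * j. \<bar>t\<bar> ^ k / fact k * \<bar>gauss_moment k - gauss_moment k\<bar>)
      + (2 * \<bar>t\<bar> ^ (2 * j) / fact (2 * j)) * (gauss_moment (2 * j) + gauss_moment (2 * j))"
      by (intro tendsto_intros lim)
    then show ?thesis using tail[of j] by simp
  qed
  have t0: "(\<lambda>j. 4 * ((t\<^sup>2 / 2) ^ j / fact j)) \<longlonglongrightarrow> 0"
  proof -
    have "(\<lambda>j. (t\<^sup>2 / 2) ^ j / fact j) \<longlonglongrightarrow> 0"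
      using summable_LIMSEQ_zero[OF summable_exp[of "t\<^sup>2 / 2"]] by (simp only: divide_inverse[of _ "fact _"] mult.commute)
    from tendsto_mult_left[OF this, of 4] show ?thesis by simp
  qed
  show "(\<lambda>n. char (D n) t) \<longlonglongrightarrow> char ?N t"
  proof (rule LIMSEQ_I)
    fix e :: real assume e: "e > 0"
    \<comment> \<open>\<open>j\<close> is fixed first, by the limiting bound alone; the threshold
      \<open>n0\<close> may then depend on it.\<close>
    obtain j where "4 * ((t\<^sup>2 / 2) ^ j / fact j) < e"
      using order_tendstoD(2)[OF t0 e] by (auto simp: eventually_sequentially)
    from order_tendstoD(2)[OF b_lim this] obtain n0 where "\<And>n. n \<ge> n0 \<Longrightarrow> ?b j n < e"
      by (auto simp: eventually_sequentially)
    then show "\<exists>n0. \<forall>n\<ge>n0. cmod (char (D n) t - char ?N t) < e"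
      using bound[of _ j] by (meson order_le_less_trans)
  qed
qed

section \<open>The balance condition as a lower bound on the cost of an overlap\<close>

context endpoint_graph
begin

lemma closed_edges_singleton:
  assumes i: "i \<in> {1..r}"
  shows "card (closed_edges {i}) = card {j \<in> {r + 1..r + m}. {i, j} \<in> E}"
proof -
  have "closed_edges {i} = (\<lambda>j. {i, j}) ` {j \<in> {r + 1..r + m}. {i, j} \<in> E}"
  proof
    show "closed_edges {i} \<subseteq> (\<lambda>j. {i, j}) ` {j \<in> {r + 1..r + m}. {i, j} \<in> E}"
    proof
      fix e assume e: "e \<in> closed_edges {i}"
      then have eE: "e \<in> E" and sub: "e \<inter> {1..r} \<subseteq> {i}" by (auto simp: closed_edges_def)
      obtain i' where "i' \<in> e" "i' \<in> {1..r}" using edge_meets[OF eE] .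
      then have "i \<in> e" using sub by auto
      obtain u v where uv: "e = {u, v}" "u \<noteq> v" using edgeD(2)[OF eE] by (auto simp: card_2_iff)
      then obtain j where j: "e = {i, j}" "i \<noteq> j"
        using \<open>i \<in> e\<close> by (cases "i = u") (auto simp: insert_commute)
      have "j \<in> {1..r + m}" using edgeD(1)[OF eE] j(1) by blast
      moreover have "j \<notin> {1..r}" using sub j by blast
      ultimately have "j \<in> {r + 1..r + m}" by auto
      then show "e \<in> (\<lambda>j. {i, j}) ` {j \<in> {r + 1..r + m}. {i, j} \<in> E}" using j eE by blast
    qed
    show "(\<lambda>j. {i, j}) ` {j \<in> {r + 1..r + m}. {i, j} \<in> E} \<subseteq> closed_edges {i}"
    proof
      fix e assume "e \<in> (\<lambda>j. {i, j}) ` {j \<in> {r + 1..r + m}. {i, j} \<in> E}"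
      then obtain j where "e = {i, j}" "j \<ge> r + 1" "e \<in> E" by auto
      then show "e \<in> closed_edges {i}" by (auto simp: closed_edges_def)
    qed
  qed
  moreover have "inj_on (\<lambda>j. {i, j}) {j \<in> {r + 1..r + m}. {i, j} \<in> E}"
    by (auto simp: inj_on_def doubleton_eq_iff)
  ultimately show ?thesis by (simp add: card_image)
qed

lemma a_deg_le:
  assumes i: "i \<in> {1..r}" shows "card (closed_edges {i}) \<le> a_deg r m E"
  unfolding closed_edges_singleton[OF i] a_deg_def using i by (intro Max_ge) auto

lemma a_deg_attained:
  obtains i where "i \<in> {1..r}" "card (closed_edges {i}) = a_deg r m E"
proof -
  have "a_deg r m E \<in> (\<lambda>i. card {j \<in> {r + 1..r + m}. {i, j} \<in> E}) ` {1..r}"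
    unfolding a_deg_def using r2 by (intro Max_in) auto
  then show ?thesis using that closed_edges_singleton by auto
qed

text \<open>For an overlap with \<open>k\<close> Poisson vertices and \<open>e\<close> edges,
  balance says that the point (k, e) lies on or below the line through (1, a) and (r, e(G)). In
  logarithms the cost at a point of this segment is a convex combination of the costs at its ends,
  hence at least their minimum, and having fewer edges only increases it. A single slot is covered
  by the maximality of \<open>a\<close>.\<close>

lemma balanced_lower_bound:
  fixes l c :: real
  assumes bal: "balanced r m E" and l: "l > 0" and c: "0 < c" "c < 1"
    and W: "W \<subseteq> {1..r}" "W \<noteq> {}"
  shows "min (l * c ^ a_deg r m E) (l ^ r * c ^ card E) \<le> l ^ card W * c ^ card (closed_edges W)"
proof -
  let ?a = "a_deg r m E" and ?k = "card W" and ?e = "card (closed_edges W)"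
  have finW: "finite W" using W finite_subset by auto
  have k1: "?k \<ge> 1" using finW W by (simp add: Suc_le_eq card_gt_0_iff)
  show ?thesis
  proof (cases "?k = 1")
    case True
    then obtain i where i: "W = {i}" by (auto simp: card_1_singleton_iff)
    then have "?e \<le> ?a" using a_deg_le W by auto
    then have "c ^ ?a \<le> c ^ ?e" using c by (intro power_decreasing) auto
    then have "l * c ^ ?a \<le> l ^ ?k * c ^ ?e" using l i by simp
    then show ?thesis by (rule min.coboundedI1)
  next
    case False
    then have k2: "?k \<ge> 2" using k1 by simp
    let ?V = "W \<union> {r + 1..r + m}"
    have cV: "card ?V = ?k + m"
      using finW W by (subst card_Un_disjoint) auto
    have sub: "subgraph ?V (closed_edges W) {1..r + m} E"
      unfolding subgraph_def simple_graph_def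
    proof (intro conjI ballI)
      fix e assume e: "e \<in> closed_edges W"
      then have "e \<subseteq> {1..r + m}" "e \<inter> {1..r} \<subseteq> W" "card e = 2"
        using edgeD[of e] by (auto simp: closed_edges_def)
      then show "card e = 2" "e \<subseteq> ?V"
      proof -
        assume "e \<subseteq> {1..r + m}" "e \<inter> {1..r} \<subseteq> W" "card e = 2"
        show "card e = 2" by fact
        show "e \<subseteq> ?V"
        proof
          fix i assume i: "i \<in> e"
          then have "i \<in> {1..r + m}" using \<open>e \<subseteq> {1..r + m}\<close> by blast
          then have "i \<in> {1..r} \<or> i \<in> {r + 1..r + m}" by auto
          then show "i \<in> ?V" using i \<open>e \<inter> {1..r} \<subseteq> W\<close> by blast
        qed
      qed
    qed (use finW W in \<open>auto simp: closed_edges_def\<close>)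
    have "card ?V \<ge> m + 2" using cV k2 by simp
    then have "(real ?e - real ?a) / (real (card ?V) - real m - 1) \<le> (real (card E) - real ?a) / (real r - 1)"
      using bal sub unfolding balanced_def by blast
    then have ineq: "(real ?e - real ?a) / (real ?k - 1) \<le> (real (card E) - real ?a) / (real r - 1)"
      unfolding cV by simp
    \<comment> \<open>The relative position of \<open>k\<close> between 1 and \<open>r\<close>, that
      is, the weight of the right end of the segment.\<close>
    define \<theta> where "\<theta> = (real ?k - 1) / (real r - 1)"
    have kr: "?k \<le> r" using card_mono[OF _ W(1)] by simp
    have \<theta>: "0 \<le> \<theta>" "\<theta> \<le> 1" using k2 kr r2 by (auto simp: \<theta>_def divide_simps)
    have eb: "real ?e \<le> real ?a + \<theta> * (real (card E) - real ?a)"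
    proof -
      have "real ?e - real ?a = (real ?e - real ?a) / (real ?k - 1) * (real ?k - 1)" using k2 by simp
      also have "\<dots> \<le> (real (card E) - real ?a) / (real r - 1) * (real ?k - 1)"
        using ineq k2 by (intro mult_right_mono) auto
      also have "\<dots> = \<theta> * (real (card E) - real ?a)" by (simp add: \<theta>_def)
      finally show ?thesis by simp
    qed
    have kb: "real ?k = 1 + \<theta> * (real r - 1)" using r2 by (simp add: \<theta>_def)
    define x where "x = ln (l * c ^ ?a)"
    define z where "z = ln (l ^ r * c ^ card E)"
    have x: "x = ln l + real ?a * ln c" using l c by (simp add: x_def ln_mult ln_realpow)
    have z: "z = real r * ln l + real (card E) * ln c" using l c by (simp add: z_def ln_mult ln_realpow)
    have "min x z \<le> (1 - \<theta>) * x + \<theta> * z"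
    proof -
      have "min x z = (1 - \<theta>) * min x z + \<theta> * min x z" by (simp add: algebra_simps)
      also have "\<dots> \<le> (1 - \<theta>) * x + \<theta> * z" using \<theta> by (intro add_mono mult_left_mono) auto
      finally show ?thesis .
    qed
    also have "\<dots> = real ?k * ln l + (real ?a + \<theta> * (real (card E) - real ?a)) * ln c"
      unfolding x z kb by (simp add: algebra_simps)
    \<comment> \<open>\<open>ln c\<close> is negative, so the upper bound on the number of edges
      turns into a lower bound on the cost.\<close>
    also have "\<dots> \<le> real ?k * ln l + real ?e * ln c"
      using eb c by (intro add_left_mono mult_right_mono_neg) auto
    also have "\<dots> = ln (l ^ ?k * c ^ ?e)" using l c by (simp add: ln_mult ln_realpow)
    finally have le: "min x z \<le> ln (l ^ ?k * c ^ ?e)" .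
    have p: "l * c ^ ?a > 0" "l ^ r * c ^ card E > 0" "l ^ ?k * c ^ ?e > 0" using l c by auto
    show ?thesis
    proof (cases "x \<le> z")
      case True
      then have "l * c ^ ?a \<le> l ^ ?k * c ^ ?e" using le p by (simp add: x_def ln_le_cancel_iff)
      then show ?thesis by (rule min.coboundedI1)
    next
      case False
      then have "l ^ r * c ^ card E \<le> l ^ ?k * c ^ ?e" using le p by (simp add: z_def ln_le_cancel_iff)
      then show ?thesis by (rule min.coboundedI2)
    qed
  qed
qed

end

section \<open>Weights of label patterns\<close>

lemma nn_integral_PiM_rename:
  fixes \<mu> :: "'a measure" and f :: "('j \<Rightarrow> 'a) \<Rightarrow> ennreal"
  assumes \<mu>: "sigma_finite_measure \<mu>" and L: "finite L" and \<beta>: "inj_on \<beta> L"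
    and f: "f \<in> borel_measurable (\<Pi>\<^sub>M i\<in>L. \<mu>)"
  shows "(\<integral>\<^sup>+x. f (\<lambda>i\<in>L. x (\<beta> i)) \<partial>(\<Pi>\<^sub>M i\<in>\<beta> ` L. \<mu>)) = (\<integral>\<^sup>+x. f x \<partial>(\<Pi>\<^sub>M i\<in>L. \<mu>))"
proof -
  interpret \<mu>: sigma_finite_measure \<mu> by fact
  interpret P: product_sigma_finite "\<lambda>_::'j. \<mu>" by standard
  interpret P': product_sigma_finite "\<lambda>_. \<mu>" by standard
  have meas: "(\<lambda>x. \<lambda>i\<in>L. x (\<beta> i)) \<in> measurable (\<Pi>\<^sub>M i\<in>\<beta> ` L. \<mu>) (\<Pi>\<^sub>M i\<in>L. \<mu>)"
    by (intro measurable_restrict measurable_component_singleton) auto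
  have "distr (\<Pi>\<^sub>M i\<in>\<beta> ` L. \<mu>) (\<Pi>\<^sub>M i\<in>L. \<mu>) (\<lambda>x. \<lambda>i\<in>L. x (\<beta> i)) = (\<Pi>\<^sub>M i\<in>L. \<mu>)"
  proof (rule P.PiM_eqI[OF L])
    fix A assume A: "\<And>i. i \<in> L \<Longrightarrow> A i \<in> sets \<mu>"
    define B where "B k = A (the_inv_into L \<beta> k)" for k
    have B: "B (\<beta> i) = A i" if "i \<in> L" for i using that \<beta> by (simp add: B_def the_inv_into_f_f)
    have sub: "A i \<subseteq> space \<mu>" if "i \<in> L" for i using sets.sets_into_space[OF A[OF that]] .
    have "(\<lambda>x. \<lambda>i\<in>L. x (\<beta> i)) -` (Pi\<^sub>E L A) \<inter> space (\<Pi>\<^sub>M i\<in>\<beta> ` L. \<mu>) = Pi\<^sub>E (\<beta> ` L) B"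
      using B sub by (auto simp: space_PiM PiE_iff) blast
    then have "emeasure (distr (\<Pi>\<^sub>M i\<in>\<beta> ` L. \<mu>) (\<Pi>\<^sub>M i\<in>L. \<mu>) (\<lambda>x. \<lambda>i\<in>L. x (\<beta> i))) (Pi\<^sub>E L A)
      = emeasure (\<Pi>\<^sub>M i\<in>\<beta> ` L. \<mu>) (Pi\<^sub>E (\<beta> ` L) B)"
      using meas A L by (subst emeasure_distr) (auto intro!: sets_PiM_I_finite)
    also have "\<dots> = (\<Prod>k\<in>\<beta> ` L. emeasure \<mu> (B k))"
      using A B L by (subst P'.emeasure_PiM) auto
    also have "\<dots> = (\<Prod>i\<in>L. emeasure \<mu> (A i))"
      using \<beta> B by (subst prod.reindex) auto
    finally show "emeasure (distr (\<Pi>\<^sub>M i\<in>\<beta> ` L. \<mu>) (\<Pi>\<^sub>M i\<in>L. \<mu>) (\<lambda>x. \<lambda>i\<in>L. x (\<beta> i))) (Pi\<^sub>E L A) = (\<Prod>i\<in>L. emeasure \<mu> (A i))" .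
  qed simp
  then have "(\<integral>\<^sup>+x. f x \<partial>(\<Pi>\<^sub>M i\<in>L. \<mu>)) = (\<integral>\<^sup>+x. f x \<partial>distr (\<Pi>\<^sub>M i\<in>\<beta> ` L. \<mu>) (\<Pi>\<^sub>M i\<in>L. \<mu>) (\<lambda>x. \<lambda>i\<in>L. x (\<beta> i)))"
    by simp
  also have "\<dots> = (\<integral>\<^sup>+x. f (\<lambda>i\<in>L. x (\<beta> i)) \<partial>(\<Pi>\<^sub>M i\<in>\<beta> ` L. \<mu>))"
    using meas f by (intro nn_integral_distr) auto
  finally show ?thesis by simp
qed

lemma prod_ennreal_antimono:
  fixes f :: "'b \<Rightarrow> ennreal"
  assumes "finite B" "A \<subseteq> B" "\<And>x. x \<in> B \<Longrightarrow> f x \<le> 1"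
  shows "prod f B \<le> prod f A"
proof -
  have "prod f B = prod f (B - A) * prod f A" using assms by (intro prod.subset_diff)
  also have "\<dots> \<le> 1 * prod f A" using assms by (intro mult_right_mono prod_le_1) auto
  finally show ?thesis by simp
qed

locale connection_graph = endpoint_graph r m E for r m :: nat and E :: "nat set set" +
  fixes \<mu> :: "'a::euclidean_space measure" and \<phi> :: "'a \<Rightarrow> 'a \<Rightarrow> real" and y :: "nat \<Rightarrow> 'a"
  assumes \<mu>: "sets \<mu> = sets borel" "sigma_finite_measure \<mu>"
    and \<phi>_measurable: "(\<lambda>(x, y). \<phi> x y) \<in> borel_measurable (borel \<Otimes>\<^sub>M borel)"
    and \<phi>_range: "\<And>x y. \<phi> x y \<in> {0..1}"
    and \<phi>_sym: "\<And>x y. \<phi> x y = \<phi> y x"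
    and no_endpoints: "m = 0 \<Longrightarrow> finite_measure \<mu>"
    and endpoints: "m \<ge> 1 \<Longrightarrow>
      \<mu> = lborel \<and> (\<forall>x y. \<phi> x y = \<phi> 0 (y - x)) \<and> integrable lborel (\<phi> 0)"
begin

sublocale \<mu>: sigma_finite_measure \<mu> by (rule \<mu>(2))
sublocale P: product_sigma_finite "\<lambda>_::nat. \<mu>" by standard

definition edge_prod :: "vertex set set \<Rightarrow> (nat \<Rightarrow> 'a) \<Rightarrow> ennreal" where
  "edge_prod Q x = (\<Prod>e\<in>Q. ennreal (edge_weight \<phi> y x e))"

abbreviation fam_integral :: "nat set \<Rightarrow> (nat \<Rightarrow> nat \<Rightarrow> nat) \<Rightarrow> ennreal" where
  "fam_integral T p \<equiv> weight \<mu> \<phi> y (fam_labels T p) (fam_edges T p)"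

lemma weight_eq: "weight \<mu> \<phi> y L Q = (\<integral>\<^sup>+x. edge_prod Q x \<partial>(\<Pi>\<^sub>M i\<in>L. \<mu>))"
  by (simp add: weight_def edge_prod_def)

lemma edge_weight_le_1: "ennreal (edge_weight \<phi> y x e) \<le> 1"
  using \<phi>_range by (simp add: edge_weight_def)

lemma borel_measurable_edge_prod: "edges_on L Q \<Longrightarrow> edge_prod Q \<in> borel_measurable (\<Pi>\<^sub>M i\<in>L. \<mu>)"
  unfolding edge_prod_def[abs_def] by (intro edge_prod_measurable \<phi>_measurable \<mu>)

lemma edge_prod_cong:
  assumes "edges_on L Q" "\<And>i. i \<in> L \<Longrightarrow> x i = x' i"
  shows "edge_prod Q x = edge_prod Q x'"
  unfolding edge_prod_def
proof (intro prod.cong refl arg_cong[where f = ennreal] edge_weight_cong)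
  fix e i assume e: "e \<in> Q"
  then show "card e = 2" using assms by (simp add: edges_on_def)
  assume "Poi i \<in> e"
  then have "Poi i \<in> Poi ` L \<union> range Fixed" using e assms(1) unfolding edges_on_def by blast
  then show "x i = x' i" using assms(2) by auto
qed

lemma edge_prod_antimono: "finite B \<Longrightarrow> A \<subseteq> B \<Longrightarrow> edge_prod B x \<le> edge_prod A x"
  unfolding edge_prod_def by (intro prod_ennreal_antimono edge_weight_le_1)

text \<open>Common edges occur twice on the left and once on the right, and every factor is at most
  1.\<close>

lemma edge_prod_union_ge:
  assumes "finite A" "finite B" shows "edge_prod A x * edge_prod B x \<le> edge_prod (A \<union> B) x"
proof -
  have "edge_prod (A \<union> B) x = edge_prod A x * edge_prod (B - A) x"
    using assms unfolding edge_prod_def by (metis Diff_disjoint Un_Diff_cancel finite_Diff prod.union_disjoint)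
  moreover have "edge_prod B x \<le> edge_prod (B - A) x" using assms by (intro edge_prod_antimono) auto
  ultimately show ?thesis by (simp add: mult_left_mono)
qed

lemma weight_union:
  assumes fin: "finite L" "finite L'" and L: "L \<inter> L' = {}" and Q: "edges_on L Q" "edges_on L' Q'" and QQ: "Q \<inter> Q' = {}"
  shows "weight \<mu> \<phi> y (L \<union> L') (Q \<union> Q') = weight \<mu> \<phi> y L Q * weight \<mu> \<phi> y L' Q'"
proof -
  have e: "edges_on (L \<union> L') (Q \<union> Q')" using Q by (auto simp: edges_on_def)
  have s: "edge_prod (Q \<union> Q') (merge L L' (x, z)) = edge_prod Q x * edge_prod Q' z" for x z
  proof -
    have "edge_prod (Q \<union> Q') (merge L L' (x, z)) = edge_prod Q (merge L L' (x, z)) * edge_prod Q' (merge L L' (x, z))"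
      unfolding edge_prod_def using Q QQ by (intro prod.union_disjoint) (auto simp: edges_on_def)
    also have "edge_prod Q (merge L L' (x, z)) = edge_prod Q x"
      by (rule edge_prod_cong[OF Q(1)]) (simp add: merge_def)
    also have "edge_prod Q' (merge L L' (x, z)) = edge_prod Q' z"
      by (rule edge_prod_cong[OF Q(2)]) (use L in \<open>auto simp: merge_def\<close>)
    finally show ?thesis .
  qed
  have "weight \<mu> \<phi> y (L \<union> L') (Q \<union> Q')
    = (\<integral>\<^sup>+x. (\<integral>\<^sup>+z. edge_prod (Q \<union> Q') (merge L L' (x, z)) \<partial>(\<Pi>\<^sub>M i\<in>L'. \<mu>)) \<partial>(\<Pi>\<^sub>M i\<in>L. \<mu>))"
    unfolding weight_eq by (rule P.product_nn_integral_fold[OF L fin borel_measurable_edge_prod[OF e]])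
  also have "\<dots> = (\<integral>\<^sup>+x. edge_prod Q x * weight \<mu> \<phi> y L' Q' \<partial>(\<Pi>\<^sub>M i\<in>L. \<mu>))"
    unfolding s weight_eq using borel_measurable_edge_prod[OF Q(2)] by (simp add: nn_integral_cmult)
  also have "\<dots> = weight \<mu> \<phi> y L Q * weight \<mu> \<phi> y L' Q'"
    unfolding weight_eq[of L] using borel_measurable_edge_prod[OF Q(1)] by (simp add: nn_integral_multc)
  finally show ?thesis .
qed

lemma edge_prod_relabel:
  assumes Q: "edges_on L Q" and \<beta>: "inj_on \<beta> L"
  shows "edge_prod (relabel_edges \<beta> Q) x = edge_prod Q (\<lambda>i. x (\<beta> i))"
  unfolding edge_prod_def using Q edges_on_relabel(2)[OF Q \<beta>]
  by (subst prod.reindex[OF edges_on_relabel(1)[OF Q \<beta>]], intro prod.cong refl)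
    (simp add: edge_weight_relabel \<phi>_sym edges_on_def)

lemma weight_relabel:
  assumes "finite L" "edges_on L Q" "inj_on \<beta> L"
  shows "weight \<mu> \<phi> y (\<beta> ` L) (relabel_edges \<beta> Q) = weight \<mu> \<phi> y L Q"
proof -
  have "edge_prod Q (\<lambda>i. x (\<beta> i)) = edge_prod Q (\<lambda>i\<in>L. x (\<beta> i))" for x
    by (rule edge_prod_cong[OF assms(2)]) simp
  then show ?thesis
    unfolding weight_eq edge_prod_relabel[OF assms(2,3)]
    using nn_integral_PiM_rename[OF \<mu>(2) assms(1,3) borel_measurable_edge_prod[OF assms(2)]] by simp
qed

text \<open>Two copies of \<open>(L, Q)\<close> glued along the single label \<open>l\<close>: as all factors are at most \<open>1\<close>,
  the integral of the union dominates \<open>\<integral>F\<^sup>2\<close>, where \<open>F\<close> integrates out everything but \<open>l\<close>.\<close>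

lemma weight_glue_pos:
  assumes L: "finite L" "l \<in> L" and Q: "edges_on L Q" and \<beta>: "inj_on \<beta> L" "\<beta> l = l" "\<beta> ` (L - {l}) \<inter> L = {}"
    and pos: "weight \<mu> \<phi> y L Q > 0"
  shows "weight \<mu> \<phi> y (L \<union> \<beta> ` L) (Q \<union> relabel_edges \<beta> Q) > 0"
proof -
  let ?Q' = "relabel_edges \<beta> Q"
  define Z where "Z = L - {l}"
  define F where "F u = (\<integral>\<^sup>+z. edge_prod Q (z(l := u)) \<partial>(\<Pi>\<^sub>M i\<in>Z. \<mu>))" for u
  have Z: "finite Z" "l \<notin> Z" "insert l Z = L" using L by (auto simp: Z_def)
  have \<beta>Z: "finite (\<beta> ` Z)" "l \<notin> \<beta> ` Z" "Z \<inter> \<beta> ` Z = {}" "inj_on \<beta> Z"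
    using \<beta> L Z(1) by (auto simp: Z_def intro: inj_on_subset)
  have LL: "insert l (Z \<union> \<beta> ` Z) = L \<union> \<beta> ` L" using Z \<beta>(2) by auto
  have Q': "edges_on (\<beta> ` L) ?Q'" by (rule edges_on_relabel(3)[OF Q \<beta>(1)])
  have "edges_on (insert l Z) Q" using Q Z by simp
  note mQ = borel_measurable_edge_prod[OF this]
  have wF: "weight \<mu> \<phi> y L Q = (\<integral>\<^sup>+u. F u \<partial>\<mu>)"
    unfolding weight_eq F_def Z(3)[symmetric] by (rule P.product_nn_integral_insert_rev[OF Z(1,2) mQ])
  interpret PZ: sigma_finite_measure "\<Pi>\<^sub>M i\<in>Z. \<mu>" by (rule P.sigma_finite[OF Z(1)])
  have F_meas: "F \<in> borel_measurable \<mu>"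
  proof -
    have "(\<lambda>(u, z). z(l := u)) \<in> measurable (\<mu> \<Otimes>\<^sub>M (\<Pi>\<^sub>M i\<in>Z. \<mu>)) (\<Pi>\<^sub>M i\<in>insert l Z. \<mu>)"
      using measurable_add_dim[of l Z "\<lambda>_. \<mu>"] by (auto simp: case_prod_beta' dest: measurable_pair_swap)
    from measurable_compose[OF this mQ] show ?thesis
      unfolding F_def by (intro PZ.borel_measurable_nn_integral) (simp add: case_prod_beta')
  qed
  \<comment> \<open>The second copy, whose labels other than \<open>l\<close> are new, integrates to
    the same function of the position of \<open>l\<close>.\<close>
  have FG: "(\<integral>\<^sup>+z'. edge_prod ?Q' (z'(l := u)) \<partial>(\<Pi>\<^sub>M i\<in>\<beta> ` Z. \<mu>)) = F u" if u: "u \<in> space \<mu>" for u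
  proof -
    have m: "(\<lambda>z. edge_prod Q (z(l := u))) \<in> borel_measurable (\<Pi>\<^sub>M i\<in>Z. \<mu>)"
      using u by (intro measurable_compose[OF _ mQ] measurable_fun_upd[where J = Z]) auto
    have "edge_prod ?Q' (z'(l := u)) = edge_prod Q ((\<lambda>i\<in>Z. z' (\<beta> i))(l := u))" for z'
      unfolding edge_prod_relabel[OF Q \<beta>(1)]
      by (rule edge_prod_cong[OF Q]) (use \<beta>Z(2) Z \<beta>(2) in \<open>auto simp: image_iff\<close>)
    then show ?thesis unfolding F_def
      using nn_integral_PiM_rename[OF \<mu>(2) Z(1) \<beta>Z(4) m] by simp
  qed
  have fin: "finite Q" "finite ?Q'" using Q by (auto simp: edges_on_def)
  have e1: "edges_on (insert l (Z \<union> \<beta> ` Z)) Q" "edges_on (insert l (Z \<union> \<beta> ` Z)) ?Q'"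
    unfolding LL using Q Q' by (auto simp: edges_on_def)
  define f where "f x = edge_prod Q x * edge_prod ?Q' x" for x
  have mf: "f \<in> borel_measurable (\<Pi>\<^sub>M i\<in>insert l (Z \<union> \<beta> ` Z). \<mu>)"
    unfolding f_def[abs_def] using e1 by (intro borel_measurable_times_ennreal borel_measurable_edge_prod)
  have "(\<integral>\<^sup>+u. F u * F u \<partial>\<mu>) = (\<integral>\<^sup>+u. (\<integral>\<^sup>+w. f (w(l := u)) \<partial>(\<Pi>\<^sub>M i\<in>Z \<union> \<beta> ` Z. \<mu>)) \<partial>\<mu>)"
  proof (rule nn_integral_cong)
    fix u assume u: "u \<in> space \<mu>"
    have m: "(\<lambda>w. f (w(l := u))) \<in> borel_measurable (\<Pi>\<^sub>M i\<in>Z \<union> \<beta> ` Z. \<mu>)"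
      using u by (intro measurable_compose[OF _ mf] measurable_fun_upd[where J = "Z \<union> \<beta> ` Z"]) auto
    have m1: "(\<lambda>z. edge_prod Q (z(l := u))) \<in> borel_measurable (\<Pi>\<^sub>M i\<in>Z. \<mu>)"
      using u by (intro measurable_compose[OF _ mQ] measurable_fun_upd[where J = Z]) auto
    have "edges_on (insert l (\<beta> ` Z)) ?Q'" using Q' Z \<beta>(2) by (metis image_insert)
    note mQ' = borel_measurable_edge_prod[OF this]
    have m2: "(\<lambda>z. edge_prod ?Q' (z(l := u))) \<in> borel_measurable (\<Pi>\<^sub>M i\<in>\<beta> ` Z. \<mu>)"
      using u by (intro measurable_compose[OF _ mQ'] measurable_fun_upd[where J = "\<beta> ` Z"]) auto
    have s: "f ((merge Z (\<beta> ` Z) (z, z'))(l := u)) = edge_prod Q (z(l := u)) * edge_prod ?Q' (z'(l := u))" for z z'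
      unfolding f_def
    proof (rule arg_cong2[where f = "(*)"])
      show "edge_prod Q ((merge Z (\<beta> ` Z) (z, z'))(l := u)) = edge_prod Q (z(l := u))"
        by (rule edge_prod_cong[OF Q]) (use Z in \<open>auto simp: merge_def\<close>)
      show "edge_prod ?Q' ((merge Z (\<beta> ` Z) (z, z'))(l := u)) = edge_prod ?Q' (z'(l := u))"
        by (rule edge_prod_cong[OF Q']) (use Z \<beta>Z \<beta>(2) in \<open>auto simp: merge_def\<close>)
    qed
    have "(\<integral>\<^sup>+w. f (w(l := u)) \<partial>(\<Pi>\<^sub>M i\<in>Z \<union> \<beta> ` Z. \<mu>))
      = (\<integral>\<^sup>+z. (\<integral>\<^sup>+z'. f ((merge Z (\<beta> ` Z) (z, z'))(l := u)) \<partial>(\<Pi>\<^sub>M i\<in>\<beta> ` Z. \<mu>)) \<partial>(\<Pi>\<^sub>M i\<in>Z. \<mu>))"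
      by (rule P.product_nn_integral_fold[OF \<beta>Z(3) Z(1) \<beta>Z(1) m])
    also have "\<dots> = (\<integral>\<^sup>+z. edge_prod Q (z(l := u)) * F u \<partial>(\<Pi>\<^sub>M i\<in>Z. \<mu>))"
      unfolding s by (simp add: nn_integral_cmult[OF m2] FG[OF u])
    also have "\<dots> = F u * F u"
      by (subst nn_integral_multc[OF m1]) (simp add: F_def)
    finally show "F u * F u = (\<integral>\<^sup>+w. f (w(l := u)) \<partial>(\<Pi>\<^sub>M i\<in>Z \<union> \<beta> ` Z. \<mu>))" by simp
  qed
  also have "\<dots> = (\<integral>\<^sup>+x. f x \<partial>(\<Pi>\<^sub>M i\<in>L \<union> \<beta> ` L. \<mu>))"
    unfolding LL[symmetric] using Z \<beta>Z by (intro P.product_nn_integral_insert_rev[symmetric] mf) auto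
  also have "\<dots> \<le> weight \<mu> \<phi> y (L \<union> \<beta> ` L) (Q \<union> ?Q')"
    unfolding weight_eq f_def using fin by (intro nn_integral_mono edge_prod_union_ge)
  finally have "(\<integral>\<^sup>+u. F u * F u \<partial>\<mu>) \<le> weight \<mu> \<phi> y (L \<union> \<beta> ` L) (Q \<union> ?Q')" .
  \<comment> \<open>If the square of \<open>F\<close> integrated to 0, then \<open>F\<close> would
    vanish almost everywhere, and so would its integral, the weight of one copy.\<close>
  moreover have "(\<integral>\<^sup>+u. F u * F u \<partial>\<mu>) \<noteq> 0"
  proof
    assume "(\<integral>\<^sup>+u. F u * F u \<partial>\<mu>) = 0"
    then have "AE u in \<mu>. F u * F u = 0" using F_meas by (subst (asm) nn_integral_0_iff_AE) auto
    then have "AE u in \<mu>. F u = 0" by eventually_elim simp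
    then have "weight \<mu> \<phi> y L Q = 0" unfolding wF using F_meas by (subst nn_integral_0_iff_AE) auto
    then show False using pos by simp
  qed
  ultimately show ?thesis by (metis not_gr_zero le_zero_eq)
qed

section \<open>Finiteness of the pattern integrals\<close>

text \<open>Translation invariance makes the integral independent of \<open>a\<close>. So a label
  can be integrated out along one edge with the same constant wherever its neighbour sits.\<close>

lemma connection_integral_finite:
  assumes "m \<ge> 1"
  shows "\<exists>C<\<infinity>. \<forall>a. (\<integral>\<^sup>+z. ennreal (\<phi> a z) \<partial>\<mu>) = C"
proof -
  have lb: "\<mu> = lborel" and tr: "\<And>x y. \<phi> x y = \<phi> 0 (y - x)" and int: "integrable lborel (\<phi> 0)"
    using endpoints[OF assms] by auto
  have m0: "(\<lambda>z. ennreal (\<phi> 0 z)) \<in> borel_measurable borel" using int by auto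
  have "(\<integral>\<^sup>+z. ennreal (\<phi> a z) \<partial>\<mu>) = (\<integral>\<^sup>+z. ennreal (\<phi> 0 z) \<partial>lborel)" for a
  proof -
    have "(\<integral>\<^sup>+z. ennreal (\<phi> 0 z) \<partial>lborel) = (\<integral>\<^sup>+z. ennreal (\<phi> 0 z) \<partial>distr lborel borel ((+) (- a)))"
      by (simp only: lborel_distr_plus)
    also have "\<dots> = (\<integral>\<^sup>+z. ennreal (\<phi> 0 (- a + z)) \<partial>lborel)"
      using m0 by (intro nn_integral_distr) auto
    finally show ?thesis unfolding lb by (subst tr) simp
  qed
  moreover have "(\<integral>\<^sup>+z. ennreal (\<phi> 0 z) \<partial>lborel) < \<infinity>"
    using int \<phi>_range by (subst (asm) integrable_iff_bounded) auto
  ultimately show ?thesis by blast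
qed

lemma fam_edges_on:
  assumes "finite T" "p \<in> families T" shows "edges_on (fam_labels T p) (fam_edges T p)"
  using fam_edges(1,3,4)[OF assms] by (auto simp: edges_on_def)

text \<open>The slots placed on endpoints or on labels of \<open>S\<close> form a non-empty proper
  set, as \<open>m \<ge> 1\<close> supplies an endpoint; connectedness of \<open>G\<close> then
  gives a crossing edge. This determines the order of integration in
  \<open>weight_finite\<close>.\<close>

lemma boundary_edge:
  assumes m: "m \<ge> 1" and p: "p \<in> families T" and S: "S \<subset> fam_labels T p"
  obtains u v where "{u, Poi v} \<in> fam_edges T p" "u \<in> Poi ` S \<union> range Fixed" "v \<in> fam_labels T p - S"
proof -
  from S obtain b where "b \<in> fam_labels T p" "b \<notin> S" by blast
  then obtain t i where t: "t \<in> T" and i: "i \<in> {1..r}" "p t i \<notin> S" unfolding fam_labels_def by blast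
  let ?f = "place_slot (p t)"
  let ?U = "{j \<in> {1..r + m}. ?f j \<in> Poi ` S \<union> range Fixed}"
  have "?f (r + 1) = Fixed 1" by (simp add: place_slot_def)
  then have "r + 1 \<in> ?U" using m by simp
  then have ne: "?U \<noteq> {}" by blast
  have "?f i \<notin> Poi ` S \<union> range Fixed" using i by auto
  moreover have "i \<in> {1..r + m}" using i by auto
  ultimately have neV: "?U \<noteq> {1..r + m}" by blast
  have "connected_graph {1..r + m} E" using G by (simp add: graph_with_endpoints_def)
  then obtain j k where jk: "j \<in> ?U" "k \<in> {1..r + m} - ?U" "{j, k} \<in> E"
    using ne neV by (elim connected_graph_cut[where U = ?U]) auto
  have k: "k \<in> {1..r}" using jk(2) by (auto simp: place_slot_def split: if_splits)
  then have fk: "?f k = Poi (p t k)" by simp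
  have "?f ` {j, k} \<in> fam_edges T p" using jk(3) t unfolding fam_edges_def copy_edges_def by blast
  then have "{?f j, Poi (p t k)} \<in> fam_edges T p" using fk by simp
  moreover have "?f j \<in> Poi ` S \<union> range Fixed" using jk by blast
  moreover have "p t k \<notin> S" using jk(2) fk by auto
  moreover have "p t k \<in> fam_labels T p" using t k unfolding fam_labels_def by blast
  ultimately show ?thesis using that by blast
qed

text \<open>Without endpoints the integrand is at most 1 on a finite measure space. With endpoints,
  labels are added along boundary edges: one edge to the new label is kept, the other new ones are
  bounded by 1, and integrating the label gives the factor \<open>C\<close>.\<close>

lemma weight_finite:
  assumes T: "finite T" and p: "p \<in> families T"
  shows "fam_integral T p < \<infinity>"
proof (cases "m = 0")
  case True
  then interpret fm: finite_measure \<mu> by (rule no_endpoints)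
  have L: "finite (fam_labels T p)" by (rule fam_edges(2)[OF T p])
  have "fam_integral T p \<le> (\<integral>\<^sup>+x. 1 \<partial>(\<Pi>\<^sub>M i\<in>fam_labels T p. \<mu>))"
    unfolding weight_eq edge_prod_def by (intro nn_integral_mono prod_le_1 conjI edge_weight_le_1) auto
  also have "\<dots> = emeasure (\<Pi>\<^sub>M i\<in>fam_labels T p. \<mu>) (Pi\<^sub>E (fam_labels T p) (\<lambda>_. space \<mu>))"
    by (simp add: space_PiM)
  also have "\<dots> = (\<Prod>i\<in>fam_labels T p. emeasure \<mu> (space \<mu>))" using L by (intro P.emeasure_PiM) auto
  also have "\<dots> < \<infinity>" by (simp add: fm.emeasure_eq_measure ennreal_power)
  finally show ?thesis .
next
  case False
  then have m: "m \<ge> 1" by simp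
  obtain C where C: "C < \<infinity>" "\<And>a. (\<integral>\<^sup>+z. ennreal (\<phi> a z) \<partial>\<mu>) = C"
    using connection_integral_finite[OF m] by blast
  let ?L = "fam_labels T p" and ?Q = "fam_edges T p"
  have L: "finite ?L" and Q: "edges_on ?L ?Q" using fam_edges(2)[OF T p] fam_edges_on[OF T p] .
  define R where "R S = {e \<in> ?Q. e \<subseteq> Poi ` S \<union> range Fixed}" for S
  have R: "edges_on S (R S)" for S using Q by (auto simp: edges_on_def R_def)
  have "\<exists>S\<subseteq>?L. card S = k \<and> weight \<mu> \<phi> y S (R S) < \<infinity>" if "k \<le> card ?L" for k
    using that
  proof (induction k)
    case 0
    \<comment> \<open>Endpoints are pairwise non-adjacent, so no edge consists of fixed points alone
      and the induction starts from an empty product.\<close>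
    have "R {} = {}"
    proof -
      have "\<not> e \<subseteq> range Fixed" if "e \<in> ?Q" for e using fam_edges(6)[OF T p that] by auto
      then show ?thesis by (auto simp: R_def)
    qed
    then show ?case by (intro exI[of _ "{}"]) (simp add: weight_eq edge_prod_def PiM_empty)
  next
    case (Suc k)
    then obtain S where S: "S \<subseteq> ?L" "card S = k" "weight \<mu> \<phi> y S (R S) < \<infinity>" by auto
    then have "S \<subset> ?L" using Suc.prems by auto
    then obtain u v where uv: "{u, Poi v} \<in> ?Q" "u \<in> Poi ` S \<union> range Fixed" "v \<in> ?L - S"
      using boundary_edge[OF m p] by metis
    have finS: "finite S" using S L finite_subset by blast
    have vS: "v \<notin> S" using uv by simp
    let ?e = "{u, Poi v}"
    have ne: "u \<noteq> Poi v" using uv by auto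
    have eR: "?e \<notin> R S" using vS by (auto simp: R_def)
    have sub: "insert ?e (R S) \<subseteq> R (insert v S)" using uv by (auto simp: R_def)
    have finR: "finite (R A)" for A using R by (simp add: edges_on_def)
    have eRe: "edges_on (insert v S) (insert ?e (R S))"
    proof -
      have "edges_on A B" if "edges_on A B'" "B \<subseteq> B'" for A B B'
        using that finite_subset unfolding edges_on_def by blast
      then show ?thesis using R sub by blast
    qed
    have mS: "edge_prod (R S) \<in> borel_measurable (\<Pi>\<^sub>M i\<in>S. \<mu>)" by (rule borel_measurable_edge_prod[OF R])
    have "weight \<mu> \<phi> y (insert v S) (R (insert v S)) \<le> (\<integral>\<^sup>+x. edge_prod (insert ?e (R S)) x \<partial>(\<Pi>\<^sub>M i\<in>insert v S. \<mu>))"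
      unfolding weight_eq by (intro nn_integral_mono edge_prod_antimono finR sub)
    also have "\<dots> = (\<integral>\<^sup>+x. (\<integral>\<^sup>+z. edge_prod (insert ?e (R S)) (x(v := z)) \<partial>\<mu>) \<partial>(\<Pi>\<^sub>M i\<in>S. \<mu>))"
      by (rule P.product_nn_integral_insert[OF finS vS borel_measurable_edge_prod[OF eRe]])
    also have "\<dots> = (\<integral>\<^sup>+x. edge_prod (R S) x * C \<partial>(\<Pi>\<^sub>M i\<in>S. \<mu>))"
    proof (intro nn_integral_cong)
      fix x
      have pu: "place (x(v := z)) y u = place x y u" for z using ne by (cases u) auto
      have "edge_prod (insert ?e (R S)) (x(v := z)) = edge_prod (R S) x * ennreal (\<phi> (place x y u) z)" for z
      proof -
        have "edge_prod (insert ?e (R S)) (x(v := z)) = ennreal (edge_weight \<phi> y (x(v := z)) ?e) * edge_prod (R S) (x(v := z))"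
          unfolding edge_prod_def using finR eR by simp
        moreover have "edge_prod (R S) (x(v := z)) = edge_prod (R S) x"
          by (rule edge_prod_cong[OF R]) (use vS in auto)
        moreover have "edge_weight \<phi> y (x(v := z)) ?e = \<phi> (place x y u) z"
          by (subst edge_weight_doubleton[OF \<phi>_sym ne]) (simp add: pu)
        ultimately show ?thesis by (simp only: mult.commute)
      qed
      moreover have "(\<lambda>z. ennreal (\<phi> a z)) \<in> borel_measurable \<mu>" for a
      proof -
        have "(\<lambda>z. (a, z)) \<in> measurable borel (borel \<Otimes>\<^sub>M borel)" by (rule measurable_Pair1') simp
        from measurable_compose[OF this \<phi>_measurable] show ?thesis
          by (simp add: measurable_cong_sets[OF \<mu>(1) refl])
      qed
      ultimately show "(\<integral>\<^sup>+z. edge_prod (insert ?e (R S)) (x(v := z)) \<partial>\<mu>) = edge_prod (R S) x * C"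
        by (simp add: nn_integral_cmult C)
    qed
    also have "\<dots> = weight \<mu> \<phi> y S (R S) * C"
      unfolding weight_eq by (rule nn_integral_multc[OF mS])
    also have "\<dots> < \<infinity>" using S C by (simp add: ennreal_mult_less_top)
    finally show ?case using S uv finS by (intro exI[of _ "insert v S"]) auto
  qed
  then obtain S where S: "S \<subseteq> ?L" "card S = card ?L" "weight \<mu> \<phi> y S (R S) < \<infinity>" by blast
  then have "S = ?L" using L card_subset_eq by blast
  moreover have "R ?L = ?Q" using Q by (auto simp: R_def edges_on_def)
  ultimately show ?thesis using S by simp
qed

end

section \<open>Moments and cumulants of the subgraph count\<close>

text \<open>In the divergent case the default values agree: \<open>infsum\<close> of a family that
  is not summable and \<open>enn2real\<close> of infinity are both 0.\<close>

lemma infsum_eq_enn2real_nn_integral: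
  fixes f :: "'b \<Rightarrow> real"
  assumes "\<And>x. x \<in> A \<Longrightarrow> f x \<ge> 0"
  shows "infsum f A = enn2real (\<integral>\<^sup>+x. ennreal (f x) \<partial>count_space A)"
proof -
  have "infsum f A = infsetsum f A"
  proof (cases "Infinite_Set_Sum.abs_summable_on f A")
    case True
    then show ?thesis by (simp add: infsetsum_infsum)
  next
    case False
    have "infsetsum f A = 0" using False by (rule not_summable_infsetsum_eq)
    moreover have "infsum f A = 0"
    proof (rule infsum_not_exists)
      show "\<not> f summable_on A"
      proof
        assume "f summable_on A"
        then have "(\<lambda>x. norm (f x)) summable_on A"
          by (rule summable_on_cong[THEN iffD1, rotated]) (use assms in auto)
        then show False using False unfolding abs_summable_equivalent[symmetric] by simp
      qed
    qed
    ultimately show ?thesis by simp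
  qed
  also have "\<dots> = enn2real (\<integral>\<^sup>+x. ennreal (f x) \<partial>count_space A)"
    unfolding infsetsum_def by (rule integral_eq_nn_integral) (use assms in \<open>auto simp: AE_count_space\<close>)
  finally show ?thesis .
qed

lemma prod_of_bool: "finite A \<Longrightarrow> (\<Prod>x\<in>A. of_bool (P x)) = (of_bool (\<forall>x\<in>A. P x) :: 'b::comm_semiring_1)"
  by (induction A rule: finite_induct) auto

lemma sum_subsets_card:
  fixes g :: "nat \<Rightarrow> real"
  assumes "finite A"
  shows "(\<Sum>B\<in>Pow A. g (card B)) = (\<Sum>k\<le>card A. real (card A choose k) * g k)"
proof -
  have "(\<Sum>B\<in>Pow A. g (card B)) = (\<Sum>k\<in>{..card A}. \<Sum>B\<in>{B \<in> Pow A. card B = k}. g (card B))"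
    using assms by (intro sum.group[symmetric]) (auto intro: card_mono)
  also have "\<dots> = (\<Sum>k\<le>card A. real (card A choose k) * g k)"
  proof (intro sum.cong refl)
    fix k
    have "(\<Sum>B\<in>{B \<in> Pow A. card B = k}. g (card B)) = (\<Sum>B\<in>{B. B \<subseteq> A \<and> card B = k}. g k)"
      by (intro sum.cong) auto
    then show "(\<Sum>B\<in>{B \<in> Pow A. card B = k}. g (card B)) = real (card A choose k) * g k"
      using n_subsets[OF assms, of k] by simp
  qed
  finally show ?thesis .
qed

lemma sum_pointed_subsets_card:
  fixes f :: "nat \<Rightarrow> real"
  assumes "finite A" "a \<in> A" "card A = Suc n"
  shows "(\<Sum>B\<in>{B. B \<subseteq> A \<and> a \<in> B}. f (card B)) = (\<Sum>k\<le>n. real (n choose k) * f (Suc k))"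
proof -
  have c: "card (A - {a}) = n" using assms by simp
  have "(\<Sum>B\<in>{B. B \<subseteq> A \<and> a \<in> B}. f (card B)) = (\<Sum>B\<in>Pow (A - {a}). f (card (insert a B)))"
    by (rule sum.reindex_bij_witness[of _ "insert a" "\<lambda>B. B - {a}"]) (use assms in \<open>auto simp: insert_absorb\<close>)
  also have "\<dots> = (\<Sum>B\<in>Pow (A - {a}). f (Suc (card B)))"
  proof (intro sum.cong refl)
    fix B assume "B \<in> Pow (A - {a})"
    then have "finite B" "a \<notin> B" using assms finite_subset[of B "A - {a}"] by auto
    then show "f (card (insert a B)) = f (Suc (card B))" by simp
  qed
  also have "\<dots> = (\<Sum>k\<le>n. real (n choose k) * f (Suc k))"
    using sum_subsets_card[of "A - {a}" "\<lambda>k. f (Suc k)"] assms c by simp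
  finally show ?thesis .
qed

lemma cumulant_1: "cumulant M 1 Z = (\<integral>\<omega>. Z \<omega> \<partial>M)"
proof -
  have "{P. partition_on {1..1::nat} P} = {{{1}}}"
  proof (intro equalityI subsetI)
    fix P assume "P \<in> {P. partition_on {1..1::nat} P}"
    then have P: "\<Union>P = {1}" "{} \<notin> P" by (auto simp: partition_on_def)
    have "B = {1}" if "B \<in> P" for B
    proof -
      have "B \<subseteq> {1}" "B \<noteq> {}" using that P by auto
      then show ?thesis by blast
    qed
    then show "P \<in> {{{1}}}" using P by auto
  qed (auto simp: partition_on_def disjoint_def)
  then show ?thesis by (simp add: cumulant_def)
qed

lemma cumulant_2: "cumulant M 2 Z = (\<integral>\<omega>. Z \<omega> ^ 2 \<partial>M) - (\<integral>\<omega>. Z \<omega> \<partial>M)\<^sup>2"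
proof -
  have set2: "{1..2::nat} = {1, 2}" by auto
  have "{P. partition_on {1..2::nat} P} = {{{1, 2}}, {{1}, {2}}}"
  proof (intro equalityI subsetI)
    fix P assume "P \<in> {P. partition_on {1..2::nat} P}"
    then have P: "\<Union>P = {1, 2}" "{} \<notin> P" "\<And>A B. A \<in> P \<Longrightarrow> B \<in> P \<Longrightarrow> A \<noteq> B \<Longrightarrow> A \<inter> B = {}"
      by (auto simp: partition_on_def disjoint_def set2)
    have B: "B = {1} \<or> B = {2} \<or> B = {1, 2}" if "B \<in> P" for B
    proof -
      have "B \<subseteq> {1, 2}" "B \<noteq> {}" using that P by auto
      then show ?thesis by blast
    qed
    show "P \<in> {{{1, 2}}, {{1}, {2}}}"
    proof (cases "{1, 2} \<in> P")
      case True
      have "B = {1, 2}" if "B \<in> P" for B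
      proof (rule ccontr)
        assume ne: "B \<noteq> {1, 2}"
        then have "{1, 2} \<inter> B = {}" using P(3)[OF True that] by metis
        then show False using B[OF that] ne by auto
      qed
      then have "P \<subseteq> {{1, 2}}" by (intro subsetI) (simp only: singleton_iff)
      then have "P = {{1, 2}}" using True by (intro equalityI) simp_all
      then show ?thesis by simp
    next
      case False
      have "1 \<in> \<Union>P" "2 \<in> \<Union>P" using P by auto
      then obtain B1 B2 where b: "B1 \<in> P" "1 \<in> B1" "B2 \<in> P" "2 \<in> B2" by blast
      then have "B1 = {1}" "B2 = {2}" using B[OF b(1)] B[OF b(3)] False by auto
      then have "{1} \<in> P" "{2} \<in> P" using b by simp_all
      moreover have "P \<subseteq> {{1}, {2}}"
      proof
        fix A assume "A \<in> P"
        then show "A \<in> {{1}, {2}}" using B[of A] False by (metis insertCI)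
      qed
      ultimately have "P = {{1}, {2}}" by auto
      then show ?thesis by simp
    qed
  qed (auto simp: partition_on_def disjoint_def set2)
  moreover have "{{1, 2::nat}} \<noteq> {{1}, {2}}" by (auto simp: doubleton_eq_iff)
  moreover have "{1::nat} \<noteq> {2}" by simp
  ultimately show ?thesis by (simp add: cumulant_def power2_eq_square)
qed

text \<open>A spanning tree is grown: each step adds one vertex and one edge leading to it.\<close>

lemma connected_graph_card_edges:
  assumes V: "finite V" and conn: "connected_graph V E" and E: "finite E"
  shows "card V \<le> Suc (card E)"
proof -
  have "\<exists>U F. U \<subseteq> V \<and> card U = k \<and> F \<subseteq> E \<and> \<Union>F \<subseteq> U \<and> k \<le> Suc (card F)" if "1 \<le> k" "k \<le> card V" for k
    using that
  proof (induction k rule: dec_induct)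
    case base
    obtain v where "v \<in> V" using conn by (auto simp: connected_graph_def)
    then show ?case by (intro exI[of _ "{v}"] exI[of _ "{}"]) auto
  next
    case (step k)
    then obtain U F where U: "U \<subseteq> V" "card U = k" "F \<subseteq> E" "\<Union>F \<subseteq> U" "k \<le> Suc (card F)" by auto
    have "U \<noteq> {}" "U \<noteq> V" using U step by auto
    then obtain u v where uv: "u \<in> U" "v \<in> V - U" "{u, v} \<in> E" using connected_graph_cut[OF conn U(1)] by metis
    have "{u, v} \<notin> F" using uv U by auto
    moreover have "finite F" "finite U" using U E V finite_subset by blast+
    ultimately show ?case using U uv
      by (intro exI[of _ "insert v U"] exI[of _ "insert {u, v} F"]) auto
  qed
  moreover have "1 \<le> card V" using conn V by (simp add: connected_graph_def Suc_le_eq card_gt_0_iff)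
  ultimately obtain F where "F \<subseteq> E" "card V \<le> Suc (card F)" using order_refl[of "card V"] by metis
  moreover have "card F \<le> card E" using E calculation by (intro card_mono)
  ultimately show ?thesis by linarith
qed

lemma (in endpoint_graph) card_E_pos: "card E > 0"
proof -
  obtain e where "e \<in> E" using slot_in_edge[of 1] r2 by auto
  then show ?thesis using finite_E by (auto simp: card_gt_0_iff)
qed

text \<open>If \<open>a\<close> is positive then \<open>a\<close> and \<open>m\<close> are 1, and
  counting vertices against edges of the connected graph gives r + 1 \<le> e(G) + 1. Hence r / e(G)
  \<le> 1 = 1 / a, and the minimum is its first argument.\<close>

lemma (in endpoint_graph) crit_exponent_le_1:
  assumes "m \<le> 1" shows "crit_exponent r m E = real r / real (card E)"
proof (cases "a_deg r m E = 0")
  case False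
  obtain i where i: "i \<in> {1..r}" "card (closed_edges {i}) = a_deg r m E" by (rule a_deg_attained)
  have "card {j \<in> {r + 1..r + m}. {i, j} \<in> E} \<le> card {r + 1..r + m}" by (intro card_mono) auto
  then have "a_deg r m E \<le> m" using i closed_edges_singleton[OF i(1)] by simp
  then have a: "a_deg r m E = 1" "m = 1" using False assms by auto
  have "connected_graph {1..r + m} E" using G by (simp add: graph_with_endpoints_def)
  from connected_graph_card_edges[OF _ this finite_E] have "r \<le> card E" using a by simp
  then have "real r / real (card E) \<le> 1" using card_E_pos by simp
  then show ?thesis using a by (simp add: crit_exponent_def)
qed (simp add: crit_exponent_def)

context connection_graph
begin

text \<open>The contribution of the pattern \<open>p\<close> to the moment of order
  \<open>card T\<close>. By \<open>weight_finite\<close> the passage to reals loses nothing.\<close>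

definition fam_weight :: "real \<Rightarrow> real \<Rightarrow> nat set \<Rightarrow> (nat \<Rightarrow> nat \<Rightarrow> nat) \<Rightarrow> real" where
  "fam_weight l c T p = l ^ card (fam_labels T p) * c ^ card (fam_edges T p) *
     enn2real (fam_integral T p)"

text \<open>The connected part of the moment. It is identified with \<open>cumulant\<close> for
  orders 1 and 2; at all orders it is used through \<open>moment_recursion\<close>.\<close>

definition kappa :: "real \<Rightarrow> real \<Rightarrow> nat \<Rightarrow> real" where
  "kappa l c n = (\<Sum>p\<in>connected_reps {..<n} 0. fam_weight l c {..<n} p)"

lemma fam_weight_nonneg: "l > 0 \<Longrightarrow> c > 0 \<Longrightarrow> fam_weight l c T p \<ge> 0"
  by (simp add: fam_weight_def)

lemma fam_weight_cong: "(\<And>t. t \<in> T \<Longrightarrow> p t = q t) \<Longrightarrow> fam_weight l c T p = fam_weight l c T q"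
  using fam_labels_cong[of T p q] fam_edges_cong[of T p q] by (simp add: fam_weight_def)

text \<open>Disjoint labels force disjoint edges, because every edge carries a Poisson label. So
  both exponents add up and the integral factorises, even if the rows have endpoints in
  common.\<close>

lemma fam_weight_mult:
  assumes T: "finite T" and A: "A \<subseteq> T" and p: "p \<in> families T"
    and dis: "fam_labels A p \<inter> fam_labels (T - A) p = {}"
  shows "fam_weight l c T p = fam_weight l c A p * fam_weight l c (T - A) p"
proof -
  have sub: "finite (fam_labels S p)" "finite (fam_edges S p)" "edges_on (fam_labels S p) (fam_edges S p)"
    "\<And>f. f \<in> fam_edges S p \<Longrightarrow> \<exists>i\<in>fam_labels S p. Poi i \<in> f" if S: "S \<subseteq> T" for S
  proof -
    have fS: "finite S" using T S finite_subset by blast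
    have q: "restrict p S \<in> families S" using p S by (auto simp: families_def)
    have e: "fam_labels S (restrict p S) = fam_labels S p" "fam_edges S (restrict p S) = fam_edges S p"
      by (auto intro!: fam_labels_cong fam_edges_cong)
    show "finite (fam_labels S p)" "finite (fam_edges S p)" "edges_on (fam_labels S p) (fam_edges S p)"
      "\<And>f. f \<in> fam_edges S p \<Longrightarrow> \<exists>i\<in>fam_labels S p. Poi i \<in> f"
      using fam_edges[OF fS q] fam_edges_on[OF fS q] unfolding e by blast+
  qed
  let ?B = "T - A"
  have B: "?B \<subseteq> T" by auto
  have L: "fam_labels T p = fam_labels A p \<union> fam_labels ?B p" and Q: "fam_edges T p = fam_edges A p \<union> fam_edges ?B p"
    using A by (auto simp: fam_labels_def fam_edges_def)
  have QQ: "fam_edges A p \<inter> fam_edges ?B p = {}"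
  proof (rule ccontr)
    assume "fam_edges A p \<inter> fam_edges ?B p \<noteq> {}"
    then obtain f where f: "f \<in> fam_edges A p" "f \<in> fam_edges ?B p" by blast
    obtain i where i: "i \<in> fam_labels A p" "Poi i \<in> f" using sub(4)[OF A f(1)] by blast
    have "Poi i \<in> Poi ` fam_labels ?B p \<union> range Fixed" using sub(3)[OF B] f(2) i(2) unfolding edges_on_def by blast
    then show False using i dis by auto
  qed
  show ?thesis
    unfolding fam_weight_def L Q
    using weight_union[OF sub(1)[OF A] sub(1)[OF B] dis sub(3)[OF A] sub(3)[OF B] QQ]
      card_Un_disjoint[OF sub(1)[OF A] sub(1)[OF B] dis] card_Un_disjoint[OF sub(2)[OF A] sub(2)[OF B] QQ]
    by (simp add: power_add enn2real_mult)
qed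

text \<open>That the connected sum over a set of rows depends only on its cardinality is not visible from the
  canonical representatives; it follows by induction from the recursion itself.\<close>

lemma moment_recursion:
  assumes mom: "\<And>T. finite T \<Longrightarrow> (\<Sum>p\<in>reps T. fam_weight l c T p) = mom (card T)" and mom0: "mom 0 = 1"
  shows "mom (Suc n) = (\<Sum>k\<le>n. real (n choose k) * kappa l c (Suc k) * mom (n - k))"
proof -
  define Kc where "Kc A t = (\<Sum>p\<in>connected_reps A t. fam_weight l c A p)" for A t
  have rec: "mom (card A) = (\<Sum>B\<in>{B. B \<subseteq> A \<and> t \<in> B}. Kc B t * mom (card A - card B))"
    if A: "finite A" "t \<in> A" for A t
  proof -
    have "mom (card A) = (\<Sum>p\<in>reps A. fam_weight l c A p)" using mom A by simp
    also have "\<dots> = (\<Sum>B\<in>{B. B \<subseteq> A \<and> t \<in> B}. Kc B t * (\<Sum>q\<in>reps (A - B). fam_weight l c (A - B) q))"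
      unfolding Kc_def
      by (rule sum_reps_components[OF A fam_weight_cong fam_weight_mult[OF A(1)]]) (auto simp: reps_def)
    also have "\<dots> = (\<Sum>B\<in>{B. B \<subseteq> A \<and> t \<in> B}. Kc B t * mom (card A - card B))"
    proof (intro sum.cong refl)
      fix B assume "B \<in> {B. B \<subseteq> A \<and> t \<in> B}"
      then have "card (A - B) = card A - card B" using A by (intro card_Diff_subset) (auto intro: finite_subset)
      then show "Kc B t * (\<Sum>q\<in>reps (A - B). fam_weight l c (A - B) q) = Kc B t * mom (card A - card B)"
        using mom[of "A - B"] A by simp
    qed
    finally show ?thesis .
  qed
  have Kc: "Kc A t = kappa l c (Suc n)" if "finite A" "t \<in> A" "card A = Suc n" for A t n
    using that
  proof (induction n arbitrary: A t rule: less_induct)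
    case (less n)
    \<comment> \<open>The recursion is solved for the term of the full set \<open>A\<close>. By
      induction all other terms depend on cardinalities only, so the right side involves neither
      \<open>A\<close> nor \<open>t\<close>, and comparison with the rows \<open>{..<Suc n}\<close>
      based at 0 finishes the step.\<close>
    have *: "Kc A t = mom (Suc n) - ((\<Sum>k\<le>n. real (n choose k) * (kappa l c (Suc k) * mom (Suc n - Suc k))) - kappa l c (Suc n))"
      if A: "finite A" "t \<in> A" "card A = Suc n" for A t
    proof -
      let ?I = "{B. B \<subseteq> A \<and> t \<in> B}"
      have fI: "finite ?I" and AI: "A \<in> ?I" using A by auto
      have "mom (Suc n) = Kc A t + (\<Sum>B\<in>?I - {A}. Kc B t * mom (Suc n - card B))"
        using rec[OF A(1,2)] sum.remove[OF fI AI, of "\<lambda>B. Kc B t * mom (card A - card B)"] A mom0 by simp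
      also have "(\<Sum>B\<in>?I - {A}. Kc B t * mom (Suc n - card B)) = (\<Sum>B\<in>?I - {A}. kappa l c (card B) * mom (Suc n - card B))"
      proof (intro sum.cong refl)
        fix B assume B: "B \<in> ?I - {A}"
        then have fB: "finite B" using A finite_subset by blast
        have "card B < card A" using B A by (intro psubset_card_mono) auto
        moreover have "card B > 0" using B fB by (auto simp: card_gt_0_iff)
        ultimately obtain k where k: "card B = Suc k" "k < n" using A by (cases "card B") auto
        show "Kc B t * mom (Suc n - card B) = kappa l c (card B) * mom (Suc n - card B)"
          using less.IH[OF k(2) fB _ k(1), of t] B k by simp
      qed
      also have "\<dots> = (\<Sum>B\<in>?I. kappa l c (card B) * mom (Suc n - card B)) - kappa l c (Suc n)"
        using sum.remove[OF fI AI, of "\<lambda>B. kappa l c (card B) * mom (Suc n - card B)"] A mom0 by simp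
      also have "(\<Sum>B\<in>?I. kappa l c (card B) * mom (Suc n - card B))
        = (\<Sum>k\<le>n. real (n choose k) * (kappa l c (Suc k) * mom (Suc n - Suc k)))"
        by (rule sum_pointed_subsets_card[OF A])
      finally show ?thesis by simp
    qed
    have "Kc A t = Kc {..<Suc n} 0" using *[OF less.prems] *[of "{..<Suc n}" 0] by simp
    then show ?case by (simp add: Kc_def kappa_def)
  qed
  have "mom (Suc n) = (\<Sum>B\<in>{B. B \<subseteq> {..<Suc n} \<and> 0 \<in> B}. Kc B 0 * mom (Suc n - card B))"
    using rec[of "{..<Suc n}" 0] by simp
  also have "\<dots> = (\<Sum>B\<in>{B. B \<subseteq> {..<Suc n} \<and> 0 \<in> B}. kappa l c (card B) * mom (Suc n - card B))"
  proof (intro sum.cong refl)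
    fix B assume B: "B \<in> {B. B \<subseteq> {..<Suc n} \<and> 0 \<in> B}"
    then have fB: "finite B" using finite_subset by blast
    then have "card B > 0" using B by (auto simp: card_gt_0_iff)
    then obtain k where "card B = Suc k" by (cases "card B") auto
    then show "Kc B 0 * mom (Suc n - card B) = kappa l c (card B) * mom (Suc n - card B)"
      using Kc[OF fB, of 0 k] B by simp
  qed
  also have "\<dots> = (\<Sum>k\<le>n. real (n choose k) * (kappa l c (Suc k) * mom (Suc n - Suc k)))"
    by (rule sum_pointed_subsets_card) auto
  finally show ?thesis by (simp add: mult.assoc)
qed

lemma countable_families: "finite T \<Longrightarrow> countable (families T)"
  unfolding families_def by (intro countable_PiE countable_label_maps) auto

text \<open>Families are partitioned by canonical form, and each class is parametrised by the
  injective relabellings of its representative.\<close>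

lemma nn_integral_families:
  assumes T: "finite T"
  shows "(\<integral>\<^sup>+a. G a \<partial>count_space (families T)) = (\<Sum>p\<in>reps T. \<integral>\<^sup>+\<beta>. G (relabelled T \<beta> p) \<partial>count_space (label_maps (fam_labels T p)))"
proof -
  let ?S = "\<lambda>p. {a \<in> families T. rep T a = p}"
  have "(\<integral>\<^sup>+a. G a \<partial>count_space (families T)) = (\<integral>\<^sup>+a. G a * indicator (families T) a \<partial>count_space UNIV)"
    by (rule nn_integral_count_space_indicator) simp
  also have "\<dots> = (\<integral>\<^sup>+a. (\<Sum>p\<in>reps T. G a * indicator (?S p) a) \<partial>count_space UNIV)"
  proof (rule nn_integral_cong)
    fix a
    show "G a * indicator (families T) a = (\<Sum>p\<in>reps T. G a * indicator (?S p) a)"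
    proof (cases "a \<in> families T")
      case True
      then have "(\<Sum>p\<in>reps T. G a * indicator (?S p) a) = (\<Sum>p\<in>reps T. if p = rep T a then G a else 0)"
        by (intro sum.cong refl) auto
      then show ?thesis using True rep_in_reps[OF True] finite_reps[OF T] by simp
    qed simp
  qed
  also have "\<dots> = (\<Sum>p\<in>reps T. \<integral>\<^sup>+a. G a * indicator (?S p) a \<partial>count_space UNIV)"
    by (rule nn_integral_sum) simp
  also have "\<dots> = (\<Sum>p\<in>reps T. \<integral>\<^sup>+a. G a \<partial>count_space (?S p))"
    by (intro sum.cong refl nn_integral_count_space_indicator[symmetric]) simp
  also have "\<dots> = (\<Sum>p\<in>reps T. \<integral>\<^sup>+\<beta>. G (relabelled T \<beta> p) \<partial>count_space (label_maps (fam_labels T p)))"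
    by (intro sum.cong refl nn_integral_bij_count_space[OF bij_relabelled, symmetric])
  finally show ?thesis .
qed

text \<open>The factors of a summand are the indicators of the single edges of a copy, so the count
  is the number of copies contained in the random graph. Removing the random index range from the
  sum is what allows Tonelli's theorem later.\<close>

lemma subgraph_count_eq:
  assumes model: "random_connection_model M \<tau> X \<Lambda> \<Gamma> m y \<phi>'" and \<omega>: "\<omega> \<in> space M"
  shows "subgraph_count r m E \<tau> \<Gamma> \<omega>
    = enn2real (\<integral>\<^sup>+\<alpha>. of_bool (copy_edges \<alpha> \<subseteq> \<Gamma> \<omega>) \<partial>count_space (label_maps {1..r}))"
proof -
  interpret random_connection_model M \<tau> X \<Lambda> \<Gamma> m y \<phi>' by (rule model)
  let ?D = "{(j, i). j \<in> {1..m} \<and> i \<in> {1..r} \<and> {r + j, i} \<in> E}"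
  have finD: "finite ?D" by (rule finite_subset[of _ "{1..m} \<times> {1..r}"]) auto
  have finI: "finite (induced_edges E {1..r})" using finite_E by (simp add: induced_edges_def)
  have copy_term: "(\<Prod>e \<in> induced_edges E {1..r}. of_bool ((\<lambda>i. Poi (\<alpha> i)) ` e \<in> \<Gamma> \<omega>)) *
      (\<Prod>(j, i) \<in> ?D. of_bool ({Fixed j, Poi (\<alpha> i)} \<in> \<Gamma> \<omega>)) = (of_bool (copy_edges \<alpha> \<subseteq> \<Gamma> \<omega>) :: real)" for \<alpha>
  proof -
    have ind: "place_slot \<alpha> ` e = (\<lambda>i. Poi (\<alpha> i)) ` e" if "e \<in> induced_edges E {1..r}" for e
      using that by (intro image_cong refl) (auto simp: induced_edges_def place_slot_def)
    have mixed: "place_slot \<alpha> ` {r + j, i} = {Fixed j, Poi (\<alpha> i)}" if "(j, i) \<in> ?D" for j i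
      using that by (auto simp: place_slot_def)
    have edge_cases: "e \<in> induced_edges E {1..r} \<or> (\<exists>(j, i)\<in>?D. e = {r + j, i})" if e: "e \<in> E" for e
    proof (cases "e \<subseteq> {1..r}")
      case True then show ?thesis using e by (simp add: induced_edges_def)
    next
      case False
      obtain i where i: "i \<in> e" "i \<in> {1..r}" using edge_meets[OF e] .
      obtain k where k: "k \<in> e" "k \<notin> {1..r}" using False by blast
      have "card e = 2" "k \<noteq> i" using edgeD[OF e] k i by auto
      then have ek: "e = {k, i}" using k(1) i(1) by (auto simp: card_2_iff)
      have "k \<in> {1..r + m}" using edgeD(1)[OF e] k(1) by blast
      then have "k - r \<in> {1..m}" "k = r + (k - r)" using k(2) by auto
      then have "(k - r, i) \<in> ?D" "e = {r + (k - r), i}" using ek e i(2) by auto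
      then show ?thesis by blast
    qed
    have "copy_edges \<alpha> \<subseteq> \<Gamma> \<omega> \<longleftrightarrow> (\<forall>e\<in>E. place_slot \<alpha> ` e \<in> \<Gamma> \<omega>)"
      by (auto simp: copy_edges_def)
    also have "\<dots> \<longleftrightarrow> (\<forall>e\<in>induced_edges E {1..r}. place_slot \<alpha> ` e \<in> \<Gamma> \<omega>) \<and> (\<forall>(j, i)\<in>?D. place_slot \<alpha> ` {r + j, i} \<in> \<Gamma> \<omega>)"
      (is "?l \<longleftrightarrow> ?r")
    proof
      assume ?l then show ?r by (auto simp: induced_edges_def)
    next
      assume ?r then show ?l using edge_cases by blast
    qed
    also have "\<dots> \<longleftrightarrow> (\<forall>e\<in>induced_edges E {1..r}. (\<lambda>i. Poi (\<alpha> i)) ` e \<in> \<Gamma> \<omega>) \<and> (\<forall>(j, i)\<in>?D. {Fixed j, Poi (\<alpha> i)} \<in> \<Gamma> \<omega>)"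
      using ind mixed by (intro conj_cong ball_cong refl) auto
    finally show ?thesis
      using finD finI by (simp add: prod_of_bool case_prod_beta')
  qed
  have "subgraph_count r m E \<tau> \<Gamma> \<omega>
    = (\<Sum>\<^sub>\<infinity>\<alpha> \<in> {\<alpha> \<in> {1..r} \<rightarrow>\<^sub>E indices \<tau> \<omega>. inj_on \<alpha> {1..r}}. of_bool (copy_edges \<alpha> \<subseteq> \<Gamma> \<omega>))"
    unfolding subgraph_count_def copy_term ..
  \<comment> \<open>Tuples with an index that is not a point may be added: every slot lies on an
    edge of \<open>G\<close>, and edges of the random graph join actual vertices only.\<close>
  also have "\<dots> = (\<Sum>\<^sub>\<infinity>\<alpha> \<in> label_maps {1..r}. of_bool (copy_edges \<alpha> \<subseteq> \<Gamma> \<omega>))"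
  proof (rule infsum_cong_neutral)
    fix \<alpha> assume \<alpha>: "\<alpha> \<in> label_maps {1..r} - {\<alpha> \<in> {1..r} \<rightarrow>\<^sub>E indices \<tau> \<omega>. inj_on \<alpha> {1..r}}"
    have "\<not> copy_edges \<alpha> \<subseteq> \<Gamma> \<omega>"
    proof
      assume sub: "copy_edges \<alpha> \<subseteq> \<Gamma> \<omega>"
      have "\<alpha> i \<in> indices \<tau> \<omega>" if i: "i \<in> {1..r}" for i
      proof -
        have "Poi (\<alpha> i) \<in> \<Union>(copy_edges \<alpha>)" using copy_edges(5)[of \<alpha>] \<alpha> i by blast
        then have "Poi (\<alpha> i) \<in> vertices m \<tau> \<omega>" using sub edges_wf[OF \<omega>] by blast
        then show ?thesis by (auto simp: vertices_def)
      qed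
      then show False using \<alpha> by (auto simp: label_maps_def PiE_iff)
    qed
    then show "of_bool (copy_edges \<alpha> \<subseteq> \<Gamma> \<omega>) = (0 :: real)" by simp
  qed (auto simp: label_maps_def PiE_iff)
  also have "\<dots> = enn2real (\<integral>\<^sup>+\<alpha>. ennreal (of_bool (copy_edges \<alpha> \<subseteq> \<Gamma> \<omega>)) \<partial>count_space (label_maps {1..r}))"
    by (rule infsum_eq_enn2real_nn_integral) simp
  also have "(\<lambda>\<alpha>. ennreal (of_bool (copy_edges \<alpha> \<subseteq> \<Gamma> \<omega>))) = (\<lambda>\<alpha>. of_bool (copy_edges \<alpha> \<subseteq> \<Gamma> \<omega>))"
    by (simp add: of_bool_def fun_eq_iff)
  finally show ?thesis .
qed

lemma moments:
  assumes model: "random_connection_model M \<tau> X (scale_measure (ennreal l) \<mu>) \<Gamma> m y (\<lambda>x y. c * \<phi> x y)"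
    and l: "l > 0" and c: "0 < c" and T: "finite T"
  shows "subgraph_count r m E \<tau> \<Gamma> \<in> borel_measurable M"
    "integrable M (\<lambda>\<omega>. subgraph_count r m E \<tau> \<Gamma> \<omega> ^ card T)"
    "(\<integral>\<omega>. subgraph_count r m E \<tau> \<Gamma> \<omega> ^ card T \<partial>M) = (\<Sum>p\<in>reps T. fam_weight l c T p)"
proof -
  interpret random_connection_model M \<tau> X "scale_measure (ennreal l) \<mu>" \<Gamma> m y "\<lambda>x y. c * \<phi> x y" by (rule model)
  let ?N = "subgraph_count r m E \<tau> \<Gamma>"
  \<comment> \<open>The extended-real count, to which Tonelli's theorem applies; the real count is 0
    where this one is infinite.\<close>
  define N where "N \<omega> = (\<integral>\<^sup>+\<alpha>. of_bool (copy_edges \<alpha> \<subseteq> \<Gamma> \<omega>) \<partial>count_space (label_maps {1..r}))" for \<omega>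
  have NN: "?N \<omega> = enn2real (N \<omega>)" if "\<omega> \<in> space M" for \<omega>
    unfolding N_def by (rule subgraph_count_eq[OF model that])
  note Qind = edges_present(2) and Qint = edges_present(3)
  have N_meas: "N \<in> borel_measurable M"
    unfolding N_def[abs_def]
    by (intro borel_measurable_nn_integral_count_space countable_label_maps Qind copy_edges) auto
  note sf = sigma_finite_scale_measure[OF \<mu>(2), of l]
  have mom: "(\<integral>\<^sup>+\<omega>. N \<omega> ^ card T \<partial>M) = ennreal (\<Sum>p\<in>reps T. fam_weight l c T p)" if T: "finite T" for T
  proof -
    interpret C: product_sigma_finite "\<lambda>_::nat. count_space (label_maps {1..r})"
      by (simp add: product_sigma_finite_def sigma_finite_measure_count_space_countable countable_label_maps)
    \<comment> \<open>A power of the count is an integral over a product of counting measures, which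
      is the counting measure on families.\<close>
    have pow: "N \<omega> ^ card T = (\<integral>\<^sup>+a. of_bool (fam_edges T a \<subseteq> \<Gamma> \<omega>) \<partial>count_space (families T))" for \<omega>
    proof -
      have "N \<omega> ^ card T = (\<Prod>t\<in>T. \<integral>\<^sup>+\<alpha>. of_bool (copy_edges \<alpha> \<subseteq> \<Gamma> \<omega>) \<partial>count_space (label_maps {1..r}))"
        by (simp add: N_def)
      also have "\<dots> = (\<integral>\<^sup>+a. (\<Prod>t\<in>T. of_bool (copy_edges (a t) \<subseteq> \<Gamma> \<omega>)) \<partial>(\<Pi>\<^sub>M t\<in>T. count_space (label_maps {1..r})))"
        using T by (intro C.product_nn_integral_prod[symmetric]) auto
      also have "(\<Pi>\<^sub>M t\<in>T. count_space (label_maps {1..r})) = count_space (families T)"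
        unfolding families_def using T by (intro count_space_PiM_finite countable_label_maps) auto
      finally show ?thesis using T by (simp add: prod_of_bool fam_edges_def UN_subset_iff)
    qed
    have "(\<integral>\<^sup>+\<omega>. N \<omega> ^ card T \<partial>M) = (\<integral>\<^sup>+a. (\<integral>\<^sup>+\<omega>. of_bool (fam_edges T a \<subseteq> \<Gamma> \<omega>) \<partial>M) \<partial>count_space (families T))"
      unfolding pow using fam_edges[OF T]
      by (intro nn_integral_count_space_nn_integral countable_families T Qind) auto
    also have "\<dots> = (\<integral>\<^sup>+a. emeasure M (present (fam_edges T a)) \<partial>count_space (families T))"
      using fam_edges[OF T] by (intro nn_integral_cong Qint) auto
    also have "\<dots> = (\<Sum>p\<in>reps T. \<integral>\<^sup>+\<beta>. emeasure M (present (fam_edges T (relabelled T \<beta> p))) \<partial>count_space (label_maps (fam_labels T p)))"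
      by (rule nn_integral_families[OF T])
    also have "\<dots> = (\<Sum>p\<in>reps T. ennreal (fam_weight l c T p))"
    proof (intro sum.cong refl)
      fix p assume "p \<in> reps T"
      then have p: "p \<in> families T" by (simp add: reps_def)
      note fe = fam_edges[OF T p]
      have cm: "(\<lambda>(x, y). c * \<phi> x y) \<in> borel_measurable (borel \<Otimes>\<^sub>M borel)"
        using \<phi>_measurable by (simp add: case_prod_beta')
      have "(\<integral>\<^sup>+\<beta>. emeasure M (present (fam_edges T (relabelled T \<beta> p))) \<partial>count_space (label_maps (fam_labels T p)))
        = weight (scale_measure (ennreal l) \<mu>) (\<lambda>x y. c * \<phi> x y) y (fam_labels T p) (fam_edges T p)"
        unfolding fam_edges_relabelled
        using c \<phi>_range by (intro sum_emeasure_relabelled_edges fe sf cm) (auto simp: \<phi>_sym \<mu>(1))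
      also have "\<dots> = ennreal (l ^ card (fam_labels T p) * c ^ card (fam_edges T p)) * fam_integral T p"
        using c l \<phi>_range by (intro weight_scale \<mu> fe(2) fam_edges_on[OF T p] \<phi>_measurable) auto
      also have "\<dots> = ennreal (fam_weight l c T p)"
        unfolding fam_weight_def using weight_finite[OF T p] l c
        by (subst ennreal_mult) (auto simp: ennreal_enn2real_if)
      finally show "(\<integral>\<^sup>+\<beta>. emeasure M (present (fam_edges T (relabelled T \<beta> p))) \<partial>count_space (label_maps (fam_labels T p)))
        = ennreal (fam_weight l c T p)" .
    qed
    also have "\<dots> = ennreal (\<Sum>p\<in>reps T. fam_weight l c T p)"
      using l c by (intro sum_ennreal fam_weight_nonneg)
    finally show ?thesis .
  qed
  \<comment> \<open>The first moment, the case of a single row, is finite; hence the real and the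
    extended count differ on a null set only.\<close>
  have fin: "AE \<omega> in M. N \<omega> \<noteq> \<infinity>"
    using mom[of "{0}"] N_meas by (intro nn_integral_PInf_AE) auto
  show meas: "?N \<in> borel_measurable M"
    using N_meas by (subst measurable_cong[OF NN]) auto
  have nn: "?N \<omega> \<ge> 0" if "\<omega> \<in> space M" for \<omega> by (simp add: NN[OF that])
  have I: "(\<integral>\<^sup>+\<omega>. ennreal (?N \<omega> ^ card T) \<partial>M) = ennreal (\<Sum>p\<in>reps T. fam_weight l c T p)"
  proof -
    have "(\<integral>\<^sup>+\<omega>. ennreal (?N \<omega> ^ card T) \<partial>M) = (\<integral>\<^sup>+\<omega>. N \<omega> ^ card T \<partial>M)"
    proof (rule nn_integral_cong_AE, use fin AE_space in eventually_elim)
      case (elim \<omega>)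
      have "ennreal (enn2real (N \<omega>) ^ card T) = ennreal (enn2real (N \<omega>)) ^ card T" by (simp add: ennreal_power)
      then show ?case using elim by (simp add: NN less_top)
    qed
    then show ?thesis using mom[OF T] by simp
  qed
  have s0: "(\<Sum>p\<in>reps T. fam_weight l c T p) \<ge> 0" using l c by (intro sum_nonneg fam_weight_nonneg)
  show int: "integrable M (\<lambda>\<omega>. ?N \<omega> ^ card T)"
    by (rule integrableI_nonneg) (use meas nn I in auto)
  show "(\<integral>\<omega>. ?N \<omega> ^ card T \<partial>M) = (\<Sum>p\<in>reps T. fam_weight l c T p)"
    by (subst integral_eq_nn_integral) (use meas nn I s0 in auto)
qed

end

section \<open>Cumulant asymptotics\<close>

context endpoint_graph
begin

text \<open>Each label is itself the code of a slot carrying it, and no slot carrying it has a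
  smaller code, so it is the least code of its class.\<close>

lemma repsI:
  assumes p: "p \<in> families T"
    and le: "\<And>t i. t \<in> T \<Longrightarrow> i \<in> {1..r} \<Longrightarrow> p t i \<le> prod_encode (t, i)"
    and ex: "\<And>t i. t \<in> T \<Longrightarrow> i \<in> {1..r} \<Longrightarrow> \<exists>t'\<in>T. \<exists>i'\<in>{1..r}. p t i = prod_encode (t', i') \<and> p t' i' = p t i"
  shows "p \<in> reps T"
proof -
  have L: "(LEAST k. \<exists>t'\<in>T. \<exists>i'\<in>{1..r}. k = prod_encode (t', i') \<and> p t' i' = p t i) = p t i"
    if "t \<in> T" "i \<in> {1..r}" for t i
  proof (rule Least_equality)
    show "\<exists>t'\<in>T. \<exists>i'\<in>{1..r}. p t i = prod_encode (t', i') \<and> p t' i' = p t i" using ex that .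
    fix k assume "\<exists>t'\<in>T. \<exists>i'\<in>{1..r}. k = prod_encode (t', i') \<and> p t' i' = p t i"
    then show "p t i \<le> k" using le by metis
  qed
  have "rep T p = p"
  proof
    fix t
    show "rep T p t = p t"
    proof (cases "t \<in> T")
      case True
      then have e: "p t \<in> extensional {1..r}" using familiesD[OF p True] by (auto simp: label_maps_def PiE_def)
      show ?thesis
      proof
        fix i show "rep T p t i = p t i"
        proof (cases "i \<in> {1..r}")
          case i: True
          show ?thesis unfolding rep_def restrict_apply if_P[OF True] if_P[OF i] by (rule L[OF True i])
        next
          case i: False
          show ?thesis
            unfolding rep_def restrict_apply if_P[OF True] if_not_P[OF i] extensional_arb[OF e i] ..
        qed
      qed
    next
      case False
      then show ?thesis using p by (auto simp: rep_def families_def PiE_def extensional_def)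
    qed
  qed
  then show ?thesis using p by (simp add: reps_def)
qed

text \<open>The two patterns that bound the variance from below: a repeated copy, and two copies that share
  only the vertex \<open>i0\<close>.\<close>

definition row0 :: "nat \<Rightarrow> nat" where
  "row0 = (\<lambda>i\<in>{1..r}. prod_encode (0, i))"

definition row1 :: "nat \<Rightarrow> nat \<Rightarrow> nat" where
  "row1 i0 = (\<lambda>i\<in>{1..r}. if i = i0 then prod_encode (0, i0) else prod_encode (1, i))"

definition two_rows :: "(nat \<Rightarrow> nat) \<Rightarrow> nat \<Rightarrow> nat \<Rightarrow> nat" where
  "two_rows q = (\<lambda>t\<in>{..<2}. if t = 0 then row0 else q)"

lemma lessThan_2: "{..<2::nat} = {0, 1}" by auto

lemma row0: "row0 \<in> label_maps {1..r}"
  by (auto simp: row0_def label_maps_def inj_on_def)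

lemma row1: "row1 i0 \<in> label_maps {1..r}"
  by (auto simp: row1_def label_maps_def inj_on_def)

text \<open>Where both rows carry the same label at position \<open>i\<close>, the code from row 0
  is the canonical one.\<close>

lemma prod_encode_01: "prod_encode (0, i) \<le> prod_encode (1, i)"
  by (simp add: prod_encode_def)

lemma two_rows_reps:
  assumes q: "q = row0 \<or> (\<exists>i0\<in>{1..r}. q = row1 i0)"
  shows "two_rows q \<in> connected_reps {..<2} 0"
    "fam_labels {..<2} (two_rows q) = row0 ` {1..r} \<union> q ` {1..r}"
    "fam_edges {..<2} (two_rows q) = copy_edges row0 \<union> copy_edges q"
proof -
  have T: "two_rows q 0 = row0" "two_rows q 1 = q" by (simp_all add: two_rows_def)
  show "fam_labels {..<2} (two_rows q) = row0 ` {1..r} \<union> q ` {1..r}"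
    "fam_edges {..<2} (two_rows q) = copy_edges row0 \<union> copy_edges q"
    unfolding fam_labels_def fam_edges_def lessThan_2 using T by simp_all
  have ql: "q \<in> label_maps {1..r}" using q row0 row1 by auto
  have f: "two_rows q \<in> families {..<2}"
    using ql row0 by (auto simp: families_def two_rows_def)
  have "two_rows q \<in> reps {..<2}"
  proof (rule repsI[OF f])
    fix t i assume t: "t \<in> {..<2::nat}" and i: "i \<in> {1..r}"
    have t01: "t = 0 \<or> t = 1" using t by auto
    show "two_rows q t i \<le> prod_encode (t, i)"
      using t01 i q prod_encode_01[of i] T by (auto simp: row0_def row1_def)
    show "\<exists>t'\<in>{..<2}. \<exists>i'\<in>{1..r}. two_rows q t i = prod_encode (t', i') \<and> two_rows q t' i' = two_rows q t i"
    proof (cases "two_rows q t i = prod_encode (0, i)")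
      case True
      have "two_rows q 0 i = prod_encode (0, i)" using i T(1) by (simp add: row0_def)
      then show ?thesis using True i by (intro bexI[of _ 0] bexI[of _ i]) auto
    next
      case False
      then have "t = 1" using t01 i T(1) by (auto simp: row0_def)
      moreover have "two_rows q t i = prod_encode (1, i)"
        using False i q T t01 by (auto simp: row0_def row1_def)
      ultimately show ?thesis using i by (intro bexI[of _ 1] bexI[of _ i]) auto
    qed
  qed
  moreover have "connected_family {..<2} 0 (two_rows q)"
    unfolding connected_family_def
  proof (intro conjI allI impI)
    fix S assume S: "S \<subset> {..<2::nat}" "0 \<in> S"
    then have S0: "S = {0}" by (auto simp: lessThan_2)
    have "{..<2} - S = {1}" unfolding S0 lessThan_2 by auto
    then have l: "fam_labels S (two_rows q) = row0 ` {1..r}" "fam_labels ({..<2} - S) (two_rows q) = q ` {1..r}"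
      using S0 T by (simp_all add: fam_labels_def)
    obtain i where "i \<in> {1..r}" "row0 i = q i"
    proof (cases "q = row0")
      case True
      have "1 \<in> {1..r}" using r2 by simp
      then show ?thesis using that True by blast
    next
      case False
      then obtain i0 where "i0 \<in> {1..r}" "q = row1 i0" using q by blast
      then show ?thesis using that[of i0] by (simp add: row0_def row1_def)
    qed
    then show "fam_labels S (two_rows q) \<inter> fam_labels ({..<2} - S) (two_rows q) \<noteq> {}"
      unfolding l by blast
  qed simp
  ultimately show "two_rows q \<in> connected_reps {..<2} 0" by (simp add: connected_reps_def)
qed

lemma copy_edges_comp:
  assumes "\<And>i. i \<in> {1..r} \<Longrightarrow> q i = \<gamma> (\<alpha> i)"
  shows "copy_edges q = relabel_edges \<gamma> (copy_edges \<alpha>)"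
proof -
  have "place_slot q i = relabel \<gamma> (place_slot \<alpha> i)" if "i \<in> {1..r + m}" for i
    using that assms[of i] by (auto simp: place_slot_def)
  then have "place_slot q ` e = relabel \<gamma> ` place_slot \<alpha> ` e" if "e \<in> E" for e
    using that edgeD(1)[of e] unfolding image_image by (intro image_cong refl) blast
  then show ?thesis by (auto simp: copy_edges_def image_image)
qed

end

context connection_graph
begin

text \<open>The integral of a single copy; the expected count is \<open>l ^ r * c ^ card E\<close>
  times it. It is free of \<open>l\<close> and \<open>c\<close>, so its vanishing is decided for all
  parameters at once.\<close>

definition base_weight :: ennreal where
  "base_weight = weight \<mu> \<phi> y (row0 ` {1..r}) (copy_edges row0)"

lemma copy_edges_on: "\<alpha> \<in> label_maps {1..r} \<Longrightarrow> edges_on (\<alpha> ` {1..r}) (copy_edges \<alpha>)"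
  using copy_edges[of \<alpha>] by (auto simp: edges_on_def)

lemma weight_copy:
  assumes \<alpha>: "\<alpha> \<in> label_maps {1..r}"
  shows "weight \<mu> \<phi> y (\<alpha> ` {1..r}) (copy_edges \<alpha>) = base_weight"
proof -
  define \<gamma> where "\<gamma> k = \<alpha> (snd (prod_decode k))" for k
  have g: "\<alpha> i = \<gamma> (row0 i)" if "i \<in> {1..r}" for i using that by (simp add: \<gamma>_def row0_def)
  have "inj_on \<gamma> (row0 ` {1..r})"
  proof (rule inj_onI)
    fix k k' assume "k \<in> row0 ` {1..r}" "k' \<in> row0 ` {1..r}" and eq: "\<gamma> k = \<gamma> k'"
    then obtain i i' where i: "i \<in> {1..r}" "i' \<in> {1..r}" "k = row0 i" "k' = row0 i'" by blast
    then have "\<alpha> i = \<alpha> i'" using eq g by simp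
    then have "i = i'" using i \<alpha> by (auto simp: label_maps_def dest: inj_onD)
    then show "k = k'" using i by simp
  qed
  from weight_relabel[OF _ copy_edges_on[OF row0] this]
  have "weight \<mu> \<phi> y (\<gamma> ` row0 ` {1..r}) (relabel_edges \<gamma> (copy_edges row0)) = base_weight"
    by (simp add: base_weight_def)
  moreover have "\<gamma> ` row0 ` {1..r} = \<alpha> ` {1..r}" unfolding image_image using g by (intro image_cong) auto
  ultimately show ?thesis using copy_edges_comp[of \<alpha> \<gamma> row0] g by simp
qed

lemma base_weight_eq_0:
  assumes "base_weight = 0"
  shows "(\<Sum>p\<in>reps {t}. fam_weight l c {t} p) = 0"
proof (rule sum.neutral, intro ballI)
  fix p assume "p \<in> reps {t}"
  then have "p t \<in> label_maps {1..r}" by (intro familiesD[of p "{t}"]) (auto simp: reps_def)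
  from weight_copy[OF this] show "fam_weight l c {t} p = 0"
    using assms by (simp add: fam_weight_def fam_labels_def fam_edges_def)
qed

text \<open>The map that fixes the code of \<open>i0\<close> and moves the other codes to row 1
  turns \<open>row0\<close> into \<open>row1 i0\<close>. So the pattern is two copies glued along
  one label, and \<open>weight_glue_pos\<close> applies.\<close>

lemma weight_two_rows_pos:
  assumes pos: "base_weight > 0" and i0: "i0 \<in> {1..r}"
  shows "weight \<mu> \<phi> y (row0 ` {1..r} \<union> row1 i0 ` {1..r}) (copy_edges row0 \<union> copy_edges (row1 i0)) > 0"
proof -
  let ?l = "prod_encode (0, i0)" and ?L = "row0 ` {1..r}"
  define \<gamma> where "\<gamma> k = (if k = ?l then ?l else prod_encode (1, snd (prod_decode k)))" for k
  have g: "row1 i0 i = \<gamma> (row0 i)" if "i \<in> {1..r}" for i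
    using that by (auto simp: \<gamma>_def row0_def row1_def)
  have "inj_on \<gamma> ?L"
  proof (rule inj_onI)
    fix k k' assume "k \<in> ?L" "k' \<in> ?L" and eq: "\<gamma> k = \<gamma> k'"
    then obtain i i' where i: "i \<in> {1..r}" "i' \<in> {1..r}" "k = row0 i" "k' = row0 i'" by blast
    then have "row1 i0 i = row1 i0 i'" using eq g by simp
    then have "i = i'" using i row1[of i0] by (auto simp: label_maps_def dest: inj_onD)
    then show "k = k'" using i by simp
  qed
  moreover have "\<gamma> ?l = ?l" by (simp add: \<gamma>_def)
  moreover have "\<gamma> ` (?L - {?l}) \<inter> ?L = {}" by (auto simp: \<gamma>_def row0_def)
  moreover have "?l \<in> ?L" using i0 by (auto simp: row0_def image_iff)
  ultimately have "weight \<mu> \<phi> y (?L \<union> \<gamma> ` ?L) (copy_edges row0 \<union> relabel_edges \<gamma> (copy_edges row0)) > 0"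
    using pos by (intro weight_glue_pos[where l = ?l] copy_edges_on row0) (auto simp: base_weight_def)
  moreover have "\<gamma> ` ?L = row1 i0 ` {1..r}" unfolding image_image using g by (intro image_cong) auto
  ultimately show ?thesis using copy_edges_comp[of "row1 i0" \<gamma> row0] g by simp
qed

section \<open>Two-sided bounds on \<open>kappa\<close>\<close>

text \<open>The \<open>D\<close> of the overview: the smaller cost of the two extreme overlaps, a
  single vertex with as many endpoint neighbours as possible and a whole copy.\<close>

definition min_scale :: "real \<Rightarrow> real \<Rightarrow> real" where
  "min_scale l c = min (l * c ^ a_deg r m E) (l ^ r * c ^ card E)"

lemma min_scale_pos: "l > 0 \<Longrightarrow> c > 0 \<Longrightarrow> min_scale l c > 0"
  by (simp add: min_scale_def)

text \<open>\<open>connected_family_bound\<close> is summed over the finitely many patterns. Their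
  integrals are free of \<open>l\<close> and \<open>c\<close>, so the prefactor is constant for
  fixed \<open>n\<close>.\<close>

lemma kappa_bound:
  assumes bal: "balanced r m E" and l: "l > 0" and c: "0 < c" "c < 1"
  shows "kappa l c n \<le> (\<Sum>p\<in>connected_reps {..<n} 0. enn2real (fam_integral {..<n} p))
    * ((l ^ r * c ^ card E) ^ n / min_scale l c ^ (n - 1))"
  unfolding kappa_def sum_distrib_right
proof (rule sum_mono)
  fix p assume p: "p \<in> connected_reps {..<n} 0"
  have "l ^ card (fam_labels {..<n} p) * c ^ card (fam_edges {..<n} p) \<le> (l ^ r * c ^ card E) ^ card {..<n} / min_scale l c ^ (card {..<n} - 1)"
  proof (rule connected_family_bound[OF l c min_scale_pos[OF l c(1)]])
    show "min_scale l c \<le> l ^ card W * c ^ card (closed_edges W)" if "W \<subseteq> {1..r}" "W \<noteq> {}" for W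
      unfolding min_scale_def by (rule balanced_lower_bound[OF bal l c that])
  qed (use p in \<open>auto simp: connected_reps_def reps_def\<close>)
  from mult_left_mono[OF this enn2real_nonneg]
  show "fam_weight l c {..<n} p \<le> enn2real (fam_integral {..<n} p)
      * ((l ^ r * c ^ card E) ^ n / min_scale l c ^ (n - 1))"
    unfolding fam_weight_def card_lessThan by (simp only: mult.commute[of _ "enn2real _"])
qed

lemma kappa_nonneg: "l > 0 \<Longrightarrow> c > 0 \<Longrightarrow> kappa l c n \<ge> 0"
  unfolding kappa_def by (intro sum_nonneg fam_weight_nonneg)

text \<open>All weights are non-negative, so a single pattern bounds the sum from below. The
  repeated copy serves when the minimum in \<open>min_scale\<close> is its second argument, the
  copies glued at \<open>i0\<close> when it is the first.\<close>

lemma kappa_2_lower_bound: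
  assumes pos: "base_weight > 0"
  obtains C where "C > 0"
    "\<And>l c. l > 0 \<Longrightarrow> 0 < c \<Longrightarrow> c < 1 \<Longrightarrow> C * ((l ^ r * c ^ card E)\<^sup>2 / min_scale l c) \<le> kappa l c 2"
proof -
  obtain i0 where i0: "i0 \<in> {1..r}" "card (closed_edges {i0}) = a_deg r m E" by (rule a_deg_attained)
  note p0 = two_rows_reps[of row0, simplified]
  have "row1 i0 = row0 \<or> (\<exists>i\<in>{1..r}. row1 i0 = row1 i)" using i0 by blast
  note p1 = two_rows_reps[OF this]
  let ?p0 = "two_rows row0" and ?p1 = "two_rows (row1 i0)"
  have fin: "finite (connected_reps {..<2} 0)"
    by (rule finite_subset[OF _ finite_reps[of "{..<2}"]]) (auto simp: connected_reps_def)
  have kge: "fam_weight l c {..<2} p \<le> kappa l c 2" if "p \<in> connected_reps {..<2} 0" "l > 0" "c > 0" for l c p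
    unfolding kappa_def using fin that by (intro member_le_sum fam_weight_nonneg) auto
  let ?w0 = "enn2real (fam_integral {..<2} ?p0)"
  let ?w1 = "enn2real (fam_integral {..<2} ?p1)"
  have wfin: "fam_integral {..<2} p < \<infinity>" if "p \<in> connected_reps {..<2} 0" for p
    using that by (intro weight_finite) (auto simp: connected_reps_def reps_def)
  have w0: "?w0 > 0"
    using wfin[OF p0(1)] pos unfolding p0 by (simp add: enn2real_positive_iff base_weight_def)
  have w1: "?w1 > 0"
    using wfin[OF p1(1)] weight_two_rows_pos[OF pos i0(1)] unfolding p1(2,3) by (simp add: enn2real_positive_iff)
  have inj0: "inj_on row0 {1..r}" and inj1: "inj_on (row1 i0) {1..r}"
    using row0 row1[of i0] by (auto simp: label_maps_def)
  have c0: "card (fam_labels {..<2} ?p0) = r" "card (fam_edges {..<2} ?p0) = card E"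
    unfolding p0 using copy_edges(2)[OF row0] card_image[OF inj0] by simp_all
  have lab1: "Suc (card (fam_labels {..<2} ?p1)) = 2 * r"
  proof -
    have int: "row0 ` {1..r} \<inter> row1 i0 ` {1..r} = {prod_encode (0, i0)}"
      using i0 by (auto simp: row0_def row1_def image_iff split: if_splits)
    have "card (row0 ` {1..r}) + card (row1 i0 ` {1..r}) = card (row0 ` {1..r} \<union> row1 i0 ` {1..r}) + card (row0 ` {1..r} \<inter> row1 i0 ` {1..r})"
      by (rule card_Un_Int) auto
    then show ?thesis unfolding p1(2) int using card_image[OF inj0] card_image[OF inj1] by simp
  qed
  \<comment> \<open>The edges joining \<open>i0\<close> to endpoints are the same in both copies, so
    at least \<open>a\<close> edges are saved in the union.\<close>
  have edg1: "card (fam_edges {..<2} ?p1) + a_deg r m E \<le> 2 * card E"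
  proof -
    have "(\<lambda>e. place_slot row0 ` e) ` closed_edges {i0} \<subseteq> copy_edges row0 \<inter> copy_edges (row1 i0)"
    proof
      fix f assume "f \<in> (\<lambda>e. place_slot row0 ` e) ` closed_edges {i0}"
      then obtain e where e: "e \<in> E" "e \<inter> {1..r} \<subseteq> {i0}" and f: "f = place_slot row0 ` e"
        by (auto simp: closed_edges_def)
      have "place_slot row0 j = place_slot (row1 i0) j" if j: "j \<in> e" for j
      proof (cases "j \<in> {1..r}")
        case True
        then have "j = i0" using e(2) j by blast
        then show ?thesis using i0 by (simp add: place_slot_def row0_def row1_def)
      next
        case False
        moreover have "j \<in> {1..r + m}" using edgeD(1)[OF e(1)] j by blast
        ultimately show ?thesis by (auto simp: place_slot_def)
      qed
      then have "f = place_slot (row1 i0) ` e" unfolding f by (intro image_cong) auto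
      then show "f \<in> copy_edges row0 \<inter> copy_edges (row1 i0)"
        using e(1) f unfolding copy_edges_def by blast
    qed
    then have "card ((\<lambda>e. place_slot row0 ` e) ` closed_edges {i0}) \<le> card (copy_edges row0 \<inter> copy_edges (row1 i0))"
      using copy_edges(1)[OF row0] by (intro card_mono) auto
    moreover have "card ((\<lambda>e. place_slot row0 ` e) ` closed_edges {i0}) = a_deg r m E"
      using card_image[OF inj_on_subset[OF inj_copy[OF row0]], of "closed_edges {i0}"] i0(2)
      by (auto simp: closed_edges_def)
    ultimately have "a_deg r m E \<le> card (copy_edges row0 \<inter> copy_edges (row1 i0))" by simp
    moreover have "card (copy_edges row0) + card (copy_edges (row1 i0))
      = card (copy_edges row0 \<union> copy_edges (row1 i0)) + card (copy_edges row0 \<inter> copy_edges (row1 i0))"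
      by (rule card_Un_Int) (rule copy_edges(1)[OF row0], rule copy_edges(1)[OF row1])
    ultimately show ?thesis unfolding p1(3) using copy_edges(2)[OF row0] copy_edges(2)[OF row1[of i0]] by simp
  qed
  show ?thesis
  proof (rule that)
    \<comment> \<open>The smaller of the two integrals serves in both cases, whatever
      \<open>l\<close> and \<open>c\<close> are.\<close>
    show "min ?w0 ?w1 > 0" using w0 w1 by simp
    fix l c :: real assume l: "l > 0" and c: "0 < c" "c < 1"
    let ?b = "l ^ r * c ^ card E" and ?a = "a_deg r m E"
    have b: "?b > 0" using l c by simp
    have la: "l * c ^ ?a > 0" using l c by simp
    show "min ?w0 ?w1 * (?b\<^sup>2 / min_scale l c) \<le> kappa l c 2"
    proof (cases "?b \<le> l * c ^ ?a")
      case True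
      then have s: "min_scale l c = ?b" by (simp add: min_scale_def min_def)
      have "min ?w0 ?w1 * (?b\<^sup>2 / min_scale l c) \<le> ?w0 * (?b\<^sup>2 / min_scale l c)"
        using b s by (intro mult_right_mono) auto
      also have "\<dots> = fam_weight l c {..<2} ?p0"
        unfolding s fam_weight_def c0 using b by (simp add: power2_eq_square)
      also have "\<dots> \<le> kappa l c 2" using kge[OF p0(1) l c(1)] .
      finally show ?thesis .
    next
      case False
      then have s: "min_scale l c = l * c ^ ?a" by (simp add: min_scale_def min_def)
      have "?b\<^sup>2 = l ^ (2 * r) * c ^ (2 * card E)" by (simp add: power_mult_distrib power_mult[symmetric] mult.commute)
      also have "\<dots> \<le> l ^ (2 * r) * c ^ (card (fam_edges {..<2} ?p1) + ?a)"
        using edg1 l c by (intro mult_left_mono power_decreasing) auto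
      also have "\<dots> = (l ^ card (fam_labels {..<2} ?p1) * c ^ card (fam_edges {..<2} ?p1)) * (l * c ^ ?a)"
        unfolding lab1[symmetric] by (simp add: power_add)
      finally have le: "?b\<^sup>2 / (l * c ^ ?a) \<le> l ^ card (fam_labels {..<2} ?p1) * c ^ card (fam_edges {..<2} ?p1)"
        using la by (simp add: pos_divide_le_eq)
      have "min ?w0 ?w1 * (?b\<^sup>2 / min_scale l c) \<le> ?w1 * (?b\<^sup>2 / min_scale l c)"
        using la s by (intro mult_right_mono) auto
      also have "\<dots> \<le> ?w1 * (l ^ card (fam_labels {..<2} ?p1) * c ^ card (fam_edges {..<2} ?p1))"
        unfolding s using le by (intro mult_left_mono) auto
      also have "\<dots> = fam_weight l c {..<2} ?p1" by (simp add: fam_weight_def)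
      also have "\<dots> \<le> kappa l c 2" using kge[OF p1(1) l c(1)] .
      finally show ?thesis .
    qed
  qed
qed

text \<open>In the quotient of the two bounds the powers of \<open>l ^ r * c ^ card E\<close>
  cancel. What remains is a constant times the power \<open>2 - n\<close> of the square root of
  \<open>min_scale\<close>, a negative exponent for \<open>n \<ge> 3\<close>.\<close>

lemma normalized_kappa_tendsto_0:
  fixes l c :: "'i \<Rightarrow> real"
  assumes bal: "balanced r m E" and pos: "base_weight > 0"
    and l: "\<And>i. l i > 0" and c: "\<And>i. 0 < c i" "\<And>i. c i < 1"
    and lim: "filterlim (\<lambda>i. min_scale (l i) (c i)) at_top F" and n: "n \<ge> 3"
  shows "((\<lambda>i. kappa (l i) (c i) n / sqrt (kappa (l i) (c i) 2) ^ n) \<longlongrightarrow> 0) F"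
proof -
  obtain C where C: "C > 0"
    "\<And>l c. l > 0 \<Longrightarrow> 0 < c \<Longrightarrow> c < 1 \<Longrightarrow> C * ((l ^ r * c ^ card E)\<^sup>2 / min_scale l c) \<le> kappa l c 2"
    using kappa_2_lower_bound[OF pos] by blast
  define B where "B = (\<Sum>p\<in>connected_reps {..<n} 0. enn2real (fam_integral {..<n} p))"
  have B0: "B \<ge> 0" unfolding B_def by (intro sum_nonneg) simp
  let ?s = "\<lambda>i. sqrt (min_scale (l i) (c i))"
  have bound: "kappa (l i) (c i) n / sqrt (kappa (l i) (c i) 2) ^ n \<le> B / sqrt C ^ n / ?s i ^ (n - 2)" for i
  proof -
    let ?b = "l i ^ r * c i ^ card E" and ?D = "min_scale (l i) (c i)"
    have b: "?b > 0" using l[of i] c(1)[of i] by simp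
    have D: "?D > 0" by (rule min_scale_pos[OF l c(1)])
    have s: "?s i > 0" "?s i ^ 2 = ?D" using D by auto
    have V: "sqrt C * ?b / ?s i \<le> sqrt (kappa (l i) (c i) 2)"
    proof -
      have "sqrt C * ?b / ?s i = sqrt (C * (?b\<^sup>2 / ?D))"
        using b C by (simp add: real_sqrt_mult real_sqrt_divide)
      also have "\<dots> \<le> sqrt (kappa (l i) (c i) 2)" using C(2)[OF l c(1) c(2)] by simp
      finally show ?thesis .
    qed
    have p: "sqrt C * ?b / ?s i > 0" using C b s by simp
    have "kappa (l i) (c i) n / sqrt (kappa (l i) (c i) 2) ^ n \<le> (B * (?b ^ n / ?D ^ (n - 1))) / (sqrt C * ?b / ?s i) ^ n"
    proof (rule frac_le)
      show "kappa (l i) (c i) n \<le> B * (?b ^ n / ?D ^ (n - 1))"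
        unfolding B_def by (rule kappa_bound[OF bal l c(1) c(2)])
      show "0 \<le> B * (?b ^ n / ?D ^ (n - 1))" using B0 b D by simp
      show "0 < (sqrt C * ?b / ?s i) ^ n" using p by simp
      show "(sqrt C * ?b / ?s i) ^ n \<le> sqrt (kappa (l i) (c i) 2) ^ n" using V p by (intro power_mono) auto
    qed
    also have "\<dots> = B / sqrt C ^ n * (?s i ^ n / ?D ^ (n - 1))"
    proof -
      have *: "(B * (u / v)) / (q * u / w) = B / q * (w / v)" if "u > 0" "v > 0" "q > 0" "w > 0" for u v q w :: real
        using that by (simp add: field_simps)
      show ?thesis unfolding power_divide power_mult_distrib[of "sqrt C"]
        by (intro * zero_less_power b D s(1) real_sqrt_gt_zero C(1))
    qed
    also have "?s i ^ n / ?D ^ (n - 1) = 1 / ?s i ^ (n - 2)"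
    proof -
      have e: "2 * (n - 1) = n + (n - 2)" using n by simp
      have "?D ^ (n - 1) = ?s i ^ (2 * (n - 1))" by (simp only: power_mult s(2))
      also have "\<dots> = ?s i ^ n * ?s i ^ (n - 2)" unfolding e power_add ..
      finally show ?thesis using s(1) by simp
    qed
    finally show ?thesis by simp
  qed
  have "filterlim ?s at_top F"
    by (rule filterlim_compose[OF sqrt_at_top lim])
  then have "filterlim (\<lambda>i. ?s i ^ (n - 2)) at_top F"
    using n by (intro filterlim_pow_at_top) auto
  then have up: "((\<lambda>i. B / sqrt C ^ n / ?s i ^ (n - 2)) \<longlongrightarrow> 0) F"
    by (intro real_tendsto_divide_at_top[OF tendsto_const])
  show ?thesis
  proof (rule tendsto_sandwich[OF _ _ tendsto_const up])
    show "\<forall>\<^sub>F i in F. 0 \<le> kappa (l i) (c i) n / sqrt (kappa (l i) (c i) 2) ^ n"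
      by (intro always_eventually allI divide_nonneg_nonneg kappa_nonneg zero_le_power real_sqrt_ge_zero l c)
  qed (intro always_eventually allI bound)
qed

text \<open>The hypothesis says that \<open>g\<close> tends to infinity. As the critical exponent is
  at most r / e(G) and, for positive \<open>a\<close>, at most 1 / a, each argument of the minimum
  dominates a power of \<open>g\<close> once \<open>l \<ge> 1\<close>; for \<open>a = 0\<close> the
  first argument is \<open>l\<close> itself.\<close>

lemma min_scale_at_top:
  assumes c: "\<And>l. l > 0 \<Longrightarrow> c l \<in> {0<..<1}"
    and ml: "much_less (\<lambda>l. l powr - crit_exponent r m E) c"
  shows "filterlim (\<lambda>l. min_scale l (c l)) at_top at_top"
proof -
  let ?a = "a_deg r m E" and ?e = "card E" and ?k = "crit_exponent r m E"
  define g where "g l = c l * l powr ?k" for l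
  have e0: "?e > 0" by (rule card_E_pos)
  have k1: "?k * real ?e \<le> real r"
  proof -
    have "?k \<le> real r / real ?e" by (auto simp: crit_exponent_def)
    then show ?thesis using e0 by (simp add: field_simps)
  qed
  have k2: "?k * real ?a \<le> 1" if "?a \<noteq> 0"
  proof -
    have "?k \<le> 1 / real ?a" using that by (auto simp: crit_exponent_def)
    then show ?thesis using that by (simp add: field_simps)
  qed
  have g: "filterlim g at_top at_top"
  proof -
    have "((\<lambda>l. l powr - ?k / c l) \<longlongrightarrow> 0) at_top" using ml by (simp add: much_less_def)
    moreover have "\<forall>\<^sub>F l in at_top. 0 < l powr - ?k / c l"
      using eventually_gt_at_top[of 0] by eventually_elim (use c in force)
    ultimately have "filterlim (\<lambda>l. inverse (l powr - ?k / c l)) at_top at_top"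
      by (rule filterlim_inverse_at_top)
    moreover have "\<forall>\<^sub>F l in at_top. inverse (l powr - ?k / c l) = g l"
      using eventually_gt_at_top[of 0] by eventually_elim (simp add: g_def powr_minus field_simps)
    ultimately show ?thesis by (simp add: filterlim_cong)
  qed
  have ev: "\<forall>\<^sub>F l in at_top. (1::real) \<le> l" by (rule eventually_ge_at_top)
  have pw: "g l ^ n = c l ^ n * l powr (?k * real n)" if "l \<ge> 1" for l n
    using that by (simp add: g_def power_mult_distrib powr_realpow[symmetric] powr_powr)
  have 1: "filterlim (\<lambda>l. l ^ r * c l ^ ?e) at_top at_top"
  proof (rule filterlim_at_top_mono)
    show "filterlim (\<lambda>l. g l ^ ?e) at_top at_top" using e0 by (intro filterlim_pow_at_top g)
    show "\<forall>\<^sub>F l in at_top. g l ^ ?e \<le> l ^ r * c l ^ ?e"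
      using ev
    proof eventually_elim
      case (elim l)
      have "l powr (?k * real ?e) \<le> l powr real r" using elim k1 by (intro powr_mono) auto
      also have "\<dots> = l ^ r" using elim by (simp add: powr_realpow)
      finally show ?case using c[of l] elim by (simp add: pw mult.commute mult_left_mono)
    qed
  qed
  have 2: "filterlim (\<lambda>l. l * c l ^ ?a) at_top at_top"
  proof (cases "?a = 0")
    case True
    then show ?thesis by (simp add: filterlim_ident)
  next
    case False
    show ?thesis
    proof (rule filterlim_at_top_mono)
      show "filterlim (\<lambda>l. g l ^ ?a) at_top at_top" using False by (intro filterlim_pow_at_top g) auto
      show "\<forall>\<^sub>F l in at_top. g l ^ ?a \<le> l * c l ^ ?a"
        using ev
      proof eventually_elim
        case (elim l)
        have "l powr (?k * real ?a) \<le> l powr 1" using elim k2[OF False] by (intro powr_mono) auto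
        also have "\<dots> = l" using elim by simp
        finally show ?case using c[of l] elim by (simp add: pw mult.commute mult_left_mono)
      qed
    qed
  qed
  show ?thesis
    unfolding min_scale_def filterlim_at_top
  proof
    fix Z
    show "\<forall>\<^sub>F l in at_top. Z \<le> min (l * c l ^ ?a) (l ^ r * c l ^ ?e)"
      using 1[unfolded filterlim_at_top, rule_format, of Z] 2[unfolded filterlim_at_top, rule_format, of Z]
      by eventually_elim simp
  qed
qed

section \<open>Central moments and the limit theorem\<close>

text \<open>Binomial expansion expresses the central moments by the moments, so that
  \<open>central_moment_recursion\<close> applies. The last conclusion is the link from a positive
  variance to a positive \<open>base_weight\<close>.\<close>

lemma central_moments:
  assumes model: "random_connection_model M \<tau> X (scale_measure (ennreal l) \<mu>) \<Gamma> m y (\<lambda>x y. c * \<phi> x y)"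
    and l: "l > 0" and c: "0 < c"
  defines "N \<equiv> subgraph_count r m E \<tau> \<Gamma>"
  shows "N \<in> borel_measurable M"
    "integrable M (\<lambda>\<omega>. (N \<omega> - cumulant M 1 N) ^ n)"
    "(\<integral>\<omega>. (N \<omega> - cumulant M 1 N) ^ 0 \<partial>M) = 1"
    "(\<integral>\<omega>. (N \<omega> - cumulant M 1 N) ^ Suc n \<partial>M)
      = (\<Sum>k\<in>{1..n}. real (n choose k) * kappa l c (Suc k) * (\<integral>\<omega>. (N \<omega> - cumulant M 1 N) ^ (n - k) \<partial>M))"
    "cumulant M 2 N = kappa l c 2"
    "base_weight = 0 \<Longrightarrow> cumulant M 2 N = 0"
proof -
  interpret random_connection_model M \<tau> X "scale_measure (ennreal l) \<mu>" \<Gamma> m y "\<lambda>x y. c * \<phi> x y" by (rule model)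
  define mom where "mom n = (\<integral>\<omega>. N \<omega> ^ n \<partial>M)" for n
  have int: "integrable M (\<lambda>\<omega>. N \<omega> ^ n)" for n
    using moments(2)[OF model l c, of "{..<n}"] by (simp add: N_def)
  have mom: "(\<Sum>p\<in>reps T. fam_weight l c T p) = mom (card T)" if "finite T" for T
    using moments(3)[OF model l c that] by (simp add: N_def mom_def)
  have mom0: "mom 0 = 1" by (simp add: mom_def prob_space)
  note rec = moment_recursion[OF mom mom0]
  have K1: "kappa l c 1 = mom 1" using rec[of 0] mom0 by simp
  have c1: "cumulant M 1 N = kappa l c 1" unfolding K1 by (simp only: cumulant_1 mom_def power_one_right)
  have "mom 2 = kappa l c 1 * mom 1 + kappa l c 2"
    using rec[of 1] mom0 by (simp add: numeral_2_eq_2)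
  then show c2: "cumulant M 2 N = kappa l c 2"
    unfolding cumulant_2 using K1 by (simp add: mom_def power2_eq_square)
  show "N \<in> borel_measurable M" using moments(1)[OF model l c, of "{}"] by (simp add: N_def)
  define cm where "cm n = (\<Sum>k\<le>n. real (n choose k) * (- kappa l c 1) ^ k * mom (n - k))" for n
  have bin: "(N \<omega> - cumulant M 1 N) ^ n = (\<Sum>k\<le>n. real (n choose k) * (- kappa l c 1) ^ k * N \<omega> ^ (n - k))" for \<omega> n
    unfolding c1 using binomial_ring[of "- kappa l c 1" "N \<omega>" n] by (simp add: algebra_simps)
  show "integrable M (\<lambda>\<omega>. (N \<omega> - cumulant M 1 N) ^ n)" for n
    unfolding bin by (intro Bochner_Integration.integrable_sum integrable_mult_right int)
  have cm: "(\<integral>\<omega>. (N \<omega> - cumulant M 1 N) ^ n \<partial>M) = cm n" for n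
    unfolding bin cm_def mom_def by (subst Bochner_Integration.integral_sum) (auto intro!: integrable_mult_right int)
  show "(\<integral>\<omega>. (N \<omega> - cumulant M 1 N) ^ 0 \<partial>M) = 1" by (simp add: prob_space)
  show "(\<integral>\<omega>. (N \<omega> - cumulant M 1 N) ^ Suc n \<partial>M)
      = (\<Sum>k\<in>{1..n}. real (n choose k) * kappa l c (Suc k) * (\<integral>\<omega>. (N \<omega> - cumulant M 1 N) ^ (n - k) \<partial>M))"
    unfolding cm unfolding cm_def by (rule central_moment_recursion[OF rec])
  \<comment> \<open>The mean is then 0, and a non-negative variable with mean 0 vanishes almost
    surely.\<close>
  assume "base_weight = 0"
  from base_weight_eq_0[OF this, where t = 0 and l = l and c = c] have "mom 1 = 0" using mom[of "{0}"] by simp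
  then have "(\<integral>\<omega>. N \<omega> \<partial>M) = 0" by (simp add: mom_def)
  moreover have "AE \<omega> in M. 0 \<le> N \<omega>"
    using subgraph_count_eq[OF model] unfolding N_def by (intro AE_I2) simp
  ultimately have "AE \<omega> in M. N \<omega> = 0"
    using int[of 1] by (subst (asm) integral_nonneg_eq_0_iff_AE) auto
  then have "(\<integral>\<omega>. N \<omega> ^ 2 \<partial>M) = (\<integral>\<omega>. 0 \<partial>M)"
    using int[of 2] by (intro integral_cong_AE) auto
  then show "cumulant M 2 N = 0" using \<open>(\<integral>\<omega>. N \<omega> \<partial>M) = 0\<close> by (simp add: cumulant_2)
qed

text \<open>A limit along the reals at infinity can be tested on sequences, which is the setting of
  the method of moments; the probability space may change along the sequence.\<close>

lemma subgraph_count_clt: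
  fixes c :: "real \<Rightarrow> real" and M :: "real \<Rightarrow> 'w measure"
  assumes c: "\<And>l. l > 0 \<Longrightarrow> c l \<in> {0<..<1}"
    and model: "\<And>l. l > 0 \<Longrightarrow>
      random_connection_model (M l) (\<tau> l) (X l) (scale_measure (ennreal l) \<mu>) (\<Gamma> l) m y (\<lambda>x y. c l * \<phi> x y)"
    and bal: "balanced r m E"
    and ml: "much_less (\<lambda>l. l powr - crit_exponent r m E) c"
    and V: "\<forall>\<^sub>F l in at_top. cumulant (M l) 2 (subgraph_count r m E (\<tau> l) (\<Gamma> l)) > 0"
  shows "weak_conv_filter (\<lambda>l. distr (M l) borel (normalized (M l) (subgraph_count r m E (\<tau> l) (\<Gamma> l))))
            std_normal_distribution at_top"
  unfolding weak_conv_filter_def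
proof (intro allI impI tendsto_at_topI_sequentially)
  fix x and L :: "nat \<Rightarrow> real"
  assume x: "isCont (cdf std_normal_distribution) x" and L: "filterlim L at_top sequentially"
  let ?D = "\<lambda>l. distr (M l) borel (normalized (M l) (subgraph_count r m E (\<tau> l) (\<Gamma> l)))"
  have "\<forall>\<^sub>F l in at_top. l > 0 \<and> cumulant (M l) 2 (subgraph_count r m E (\<tau> l) (\<Gamma> l)) > 0"
    using V eventually_gt_at_top[of 0] by eventually_elim simp
  then have "\<forall>\<^sub>F n in sequentially. L n > 0 \<and> cumulant (M (L n)) 2 (subgraph_count r m E (\<tau> (L n)) (\<Gamma> (L n))) > 0"
    using L by (rule eventually_compose_filterlim)
  then obtain n0 where n0: "\<And>n. n \<ge> n0 \<Longrightarrow> L n > 0"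
    "\<And>n. n \<ge> n0 \<Longrightarrow> cumulant (M (L n)) 2 (subgraph_count r m E (\<tau> (L n)) (\<Gamma> (L n))) > 0"
    by (auto simp: eventually_sequentially)
  \<comment> \<open>Dropping the first \<open>n0\<close> terms makes the parameter and the variance
    positive at every index, not just eventually; \<open>LIMSEQ_offset\<close> undoes the shift at
    the end.\<close>
  define l where "l n = L (n + n0)" for n
  let ?N = "\<lambda>n. subgraph_count r m E (\<tau> (l n)) (\<Gamma> (l n))"
  have l: "l n > 0" and V: "cumulant (M (l n)) 2 (?N n) > 0" for n using n0[of "n + n0"] by (auto simp: l_def)
  have cl: "0 < c (l n)" "c (l n) < 1" for n using c[OF l[of n]] by auto
  note cm = central_moments[OF model[OF l] l cl(1)]
  \<comment> \<open>\<open>base_weight\<close> is the same for all parameters, so the variance at a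
    single index decides.\<close>
  have pos: "base_weight > 0"
    using V[of 0] cm(6)[of 0] by (metis less_irrefl not_gr_zero)
  have K2: "kappa (l n) (c (l n)) 2 > 0" for n using V[of n] cm(5)[of n] by simp
  have ltop: "filterlim l at_top sequentially"
    unfolding l_def by (rule filterlim_compose[OF L filterlim_add_const_nat_at_top])
  have "filterlim (\<lambda>n. min_scale (l n) (c (l n))) at_top sequentially"
    by (rule filterlim_compose[OF min_scale_at_top[OF c ml] ltop])
  note K0 = normalized_kappa_tendsto_0[OF bal pos l cl this]
  let ?cm = "\<lambda>n k. \<integral>\<omega>. (?N n \<omega> - cumulant (M (l n)) 1 (?N n)) ^ k \<partial>M (l n)"
  have gm: "(\<lambda>n. ?cm n k / sqrt (kappa (l n) (c (l n)) 2) ^ k) \<longlonglongrightarrow> gauss_moment k" for k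
  proof (rule gaussian_moment_limit[of ?cm "\<lambda>n. kappa (l n) (c (l n))"])
    show "\<forall>\<^sub>F n in sequentially. kappa (l n) (c (l n)) 2 > 0" by (intro always_eventually allI K2)
  qed (fact cm(3), fact cm(4), fact K0)
  have meas: "normalized (M (l n)) (?N n) \<in> borel_measurable (M (l n))" for n
    unfolding normalized_def[abs_def] using cm(1)[of n] by simp
  have "weak_conv_m (\<lambda>n. ?D (l n)) std_normal_distribution"
  proof (rule gaussian_method_of_moments)
    fix n
    interpret random_connection_model "M (l n)" "\<tau> (l n)" "X (l n)" "scale_measure (ennreal (l n)) \<mu>" "\<Gamma> (l n)" m y "\<lambda>x y. c (l n) * \<phi> x y"
      by (rule model[OF l])
    show "real_distribution (?D (l n))" by (rule real_distribution_distr[OF meas])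
    show "integrable (?D (l n)) (\<lambda>x. x ^ k)" for k
    proof (subst integrable_distr_eq[OF meas])
      show "integrable (M (l n)) (\<lambda>\<omega>. normalized (M (l n)) (?N n) \<omega> ^ k)"
        unfolding normalized_def power_divide by (intro integrable_divide cm(2))
    qed simp
  next
    fix k
    have "(LINT x|?D (l n). x ^ k) = ?cm n k / sqrt (kappa (l n) (c (l n)) 2) ^ k" for n
      by (subst integral_distr[OF meas]) (simp_all add: normalized_def power_divide cm(5))
    then show "(\<lambda>n. LINT x|?D (l n). x ^ k) \<longlonglongrightarrow> gauss_moment k" using gm by simp
  qed
  then have "(\<lambda>n. cdf (?D (l n)) x) \<longlonglongrightarrow> cdf std_normal_distribution x"
    using x by (simp add: weak_conv_m_def weak_conv_def)
  then show "(\<lambda>n. cdf (?D (L n)) x) \<longlonglongrightarrow> cdf std_normal_distribution x"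
    unfolding l_def by (rule LIMSEQ_offset)
qed

end

theorem corollary3p4:
  fixes r m :: nat and E :: "nat set set"
    and \<mu> :: "'a::euclidean_space measure" and \<phi> :: "'a \<Rightarrow> 'a \<Rightarrow> real" and y :: "nat \<Rightarrow> 'a"
    and c :: "real \<Rightarrow> real"
    and M :: "real \<Rightarrow> 'w measure" and \<tau> :: "real \<Rightarrow> 'w \<Rightarrow> enat"
    and X :: "real \<Rightarrow> nat \<Rightarrow> 'w \<Rightarrow> 'a" and \<Gamma> :: "real \<Rightarrow> 'w \<Rightarrow> vertex set set"
  assumes r: "r \<ge> 2"
    and G: "graph_with_endpoints r m E"
    and \<mu>: "sets \<mu> = sets borel" "sigma_finite_measure \<mu>" "diffuse \<mu>"
    and \<phi>_measurable: "(\<lambda>(x, y). \<phi> x y) \<in> borel_measurable (borel \<Otimes>\<^sub>M borel)"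
    and \<phi>_range: "\<And>x y. \<phi> x y \<in> {0..1}"
    and \<phi>_sym: "\<And>x y. \<phi> x y = \<phi> y x"
    and no_endpoints: "m = 0 \<Longrightarrow> finite_measure \<mu>"
    and endpoints: "m \<ge> 1 \<Longrightarrow>
      \<mu> = lborel \<and> (\<forall>x y. \<phi> x y = \<phi> 0 (y - x)) \<and> integrable lborel (\<phi> 0)"
    and y_distinct: "inj_on y {1..m}"
    and c_range: "\<And>lam. lam > 0 \<Longrightarrow> c lam \<in> {0<..<1}"
    and model: "\<And>lam. lam > 0 \<Longrightarrow>
      random_connection_model (M lam) (\<tau> lam) (X lam) (scale_measure (ennreal lam) \<mu>) (\<Gamma> lam) m y
        (\<lambda>x y. c lam * \<phi> x y)"
    and balance: "balanced r m E"
  shows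
    "(lesssim c (\<lambda>_. 1) \<and> much_less (\<lambda>lam. lam powr - crit_exponent r m E) c \<and>
      (\<forall>\<^sub>F lam in at_top. cumulant (M lam) 2 (subgraph_count r m E (\<tau> lam) (\<Gamma> lam)) > 0)
      \<longrightarrow> weak_conv_filter (\<lambda>lam. distr (M lam) borel
              (normalized (M lam) (subgraph_count r m E (\<tau> lam) (\<Gamma> lam))))
            std_normal_distribution at_top) \<and>
     (m \<le> 1 \<longrightarrow>
       (lesssim c (\<lambda>_. 1) \<and> much_less (\<lambda>lam. lam powr - crit_exponent r m E) c \<longleftrightarrow>
        lesssim c (\<lambda>_. 1) \<and> much_less (\<lambda>lam. lam powr - (real r / real (card E))) c)) \<and>
     (m = 0 \<longrightarrow>
       (lesssim c (\<lambda>_. 1) \<and> much_less (\<lambda>lam. lam powr - crit_exponent r m E) c \<longleftrightarrow>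
        lesssim c (\<lambda>_. 1) \<and>
        much_less (\<lambda>lam. lam powr - (real (card {1..r + m}) / real (card E))) c))"
proof -
  interpret endpoint_graph r m E by standard (rule r, rule G)
  interpret connection_graph r m E \<mu> \<phi> y
    by (rule connection_graph.intro[OF endpoint_graph_axioms connection_graph_axioms.intro])
      (fact \<mu> \<phi>_measurable \<phi>_range \<phi>_sym no_endpoints endpoints)+
  have clt: "weak_conv_filter (\<lambda>lam. distr (M lam) borel
            (normalized (M lam) (subgraph_count r m E (\<tau> lam) (\<Gamma> lam)))) std_normal_distribution at_top"
    if "much_less (\<lambda>lam. lam powr - crit_exponent r m E) c"
      "\<forall>\<^sub>F lam in at_top. cumulant (M lam) 2 (subgraph_count r m E (\<tau> lam) (\<Gamma> lam)) > 0"
    by (rule subgraph_count_clt[where X = X, OF c_range model balance that])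
  have exponent_0: "crit_exponent r m E = real (card {1..r + m}) / real (card E)" if "m = 0"
    using crit_exponent_le_1 that by simp
  show ?thesis
  proof (intro conjI impI)
    assume "m \<le> 1"
    from crit_exponent_le_1[OF this]
    show "lesssim c (\<lambda>_. 1) \<and> much_less (\<lambda>lam. lam powr - crit_exponent r m E) c \<longleftrightarrow>
        lesssim c (\<lambda>_. 1) \<and> much_less (\<lambda>lam. lam powr - (real r / real (card E))) c"
      by (simp only:)
  next
    assume "m = 0"
    from exponent_0[OF this]
    show "lesssim c (\<lambda>_. 1) \<and> much_less (\<lambda>lam. lam powr - crit_exponent r m E) c \<longleftrightarrow>
        lesssim c (\<lambda>_. 1) \<and> much_less (\<lambda>lam. lam powr - (real (card {1..r + m}) / real (card E))) c"
      by (simp only:)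
  qed (elim conjE, rule clt)
qed

end
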